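(* Let $(0\in X)\cong(0\in\mathbb C^n)/G$ be an isolated quotient singularity, where $G\subset \mathrm{GL}(n,\mathbb C)$ is a finite subgroup containing no pseudo-reflections. Then there are natural identifications $$\pi_0\bigl(\operatorname{ShArc}(0\in X)\bigr)=\pi_1\bigl(\operatorname{link}(0\in X)\bigr)/(\text{conjugation})=G/(\text{conjugation}),$$ the first one being given by the winding number map.
   Context: A pseudo-reflection is a non-identity element of $\mathrm{GL}(n,\mathbb C)$ whose fixed point set is a hyperplane. With no pseudo-reflections in $G$, the singularity of $X=\mathbb C^n/G$ at $0$ is isolated iff $G$ acts freely on $\mathbb C^n\setminus\{0\}$, and $G=\pi_1(X\setminus\operatorname{Sing}X)$. Let $\mathbb D\subset\mathbb C$ be the open unit disk and $\overline{\mathbb D}$ its closure. An arc in a complex space $X$ is a holomorphic map $\phi:\overline{\mathbb D}\to X$ (defined and holomorphic in some neighborhood of $\overline{\mathbb D}$). A short arc on $(0\in X)$ is an arc $\phi$ with $\phi^{-1}(0)=\{0\}$ as a set. $\operatorname{ShArc}(0\in X)$ is the set of short arcs, with the topology given by the metric $\sup\{d(\phi(t),\psi(t)):t\in\overline{\mathbb D}\}$ for any continuous metric $d$ on $X$. $\pi_0$ denotes the set of connected components. The topology of $\operatorname{ShArc}(0\in X)$ does not depend on the chosen representative of an isolated singularity; for a contractible (conical) representative, $X\setminus\{0\}$ is homotopy equivalent to $\operatorname{link}(0\in X)$. Winding number map: with $\partial\overline{\mathbb D}$ oriented counterclockwise, a short arc $\phi$ restricts to a free loop $\phi|_{\partial\overline{\mathbb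 D}}:\mathbb S^1\to X\setminus\{0\}\simeq\operatorname{link}(0\in X)$, hence gives a conjugacy class in $\pi_1(\operatorname{link}(0\in X))$; this is locally constant in $\phi$ and so defines a map on $\pi_0(\operatorname{ShArc}(0\in X))$. *)

theory Defs
  imports "HOL-Analysis.Analysis" "HOL-Algebra.Group"
begin

section \<open>Reduced complex spaces\<close>

text \<open>
  A reduced complex space is recorded as a topological space with its structure sheaf, the latter
  viewed as a sheaf of complex-valued functions. The values of a section outside of
  the open set over which it is taken are irrelevant.
\<close>

record 'a cspace =
  top_of :: "'a topology"
  sections :: "'a set \<Rightarrow> ('a \<Rightarrow> complex) set"

definition open_subspace :: "'a cspace \<Rightarrow> 'a set \<Rightarrow> 'a cspace" where
  "open_subspace X U = \<lparr>top_of = subtopology (top_of X) U, sections = sections X\<rparr>"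

definition holomorphic_map :: "'a cspace \<Rightarrow> 'b cspace \<Rightarrow> ('a \<Rightarrow> 'b) \<Rightarrow> bool" where
  "holomorphic_map X Y \<phi> \<longleftrightarrow>
     continuous_map (top_of X) (top_of Y) \<phi> \<and>
     (\<forall>V f. openin (top_of Y) V \<and> f \<in> sections Y V \<longrightarrow>
        (\<lambda>x. f (\<phi> x)) \<in> sections X {x \<in> topspace (top_of X). \<phi> x \<in> V})"

definition biholomorphic :: "'a cspace \<Rightarrow> 'b cspace \<Rightarrow> bool" where
  "biholomorphic X Y \<longleftrightarrow>
     (\<exists>f g. holomorphic_map X Y f \<and> holomorphic_map Y X g \<and>
        (\<forall>x \<in> topspace (top_of X). g (f x) = x) \<and>
        (\<forall>y \<in> topspace (top_of Y). f (g y) = y))"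

definition complex_plane :: "complex cspace" where
  "complex_plane = \<lparr>top_of = euclidean, sections = (\<lambda>U. {f. f holomorphic_on U})\<rparr>"

text \<open>Holomorphy in several variables, on an open set: the real Frechet derivative exists at every
  point and is complex linear.\<close>

definition holomorphic_vec_on :: "(complex^'n \<Rightarrow> complex) \<Rightarrow> (complex^'n) set \<Rightarrow> bool" where
  "holomorphic_vec_on f U \<longleftrightarrow>
     (\<forall>z\<in>U. \<exists>L. (f has_derivative L) (at z) \<and> (\<forall>c v. L (c *s v) = c * L v))"

definition affine_cspace :: "(complex^'n) cspace" where
  "affine_cspace = \<lparr>top_of = euclidean, sections = (\<lambda>U. {f. holomorphic_vec_on f U})\<rparr>"

definition smooth_point :: "'n::finite itself \<Rightarrow> 'a cspace \<Rightarrow> 'a \<Rightarrow> bool" where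
  "smooth_point (_ :: 'n itself) X x \<longleftrightarrow>
     (\<exists>U (V :: (complex^'n) set). openin (top_of X) U \<and> x \<in> U \<and> open V \<and>
        biholomorphic (open_subspace X U) (open_subspace affine_cspace V))"

text \<open>The type argument gives the dimension: the space is understood to have pure dimension
  \<open>CARD('n)\<close>, so that its smooth points are exactly those with a chart in \<open>complex^'n\<close>.\<close>

definition singular_locus :: "'n::finite itself \<Rightarrow> 'a cspace \<Rightarrow> 'a set" where
  "singular_locus n X = {x \<in> topspace (top_of X). \<not> smooth_point n X x}"

definition isolated_singularity :: "'n::finite itself \<Rightarrow> 'a cspace \<Rightarrow> 'a \<Rightarrow> bool" where
  "isolated_singularity n X x \<longleftrightarrow>
     (\<exists>U. openin (top_of X) U \<and> U \<inter> singular_locus n X = {x})"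


section \<open>Short arcs\<close>

text \<open>An arc is a map on the closed disk only, hence the extensionality condition; the extension
  \<open>\<psi>\<close> to a neighbourhood is not part of the data.\<close>

definition arcs :: "'a cspace \<Rightarrow> (complex \<Rightarrow> 'a) set" where
  "arcs X = {\<phi> \<in> extensional (cball 0 1).
     \<exists>W \<psi>. open W \<and> cball 0 1 \<subseteq> W \<and>
       holomorphic_map (open_subspace complex_plane W) X \<psi> \<and> (\<forall>t \<in> cball 0 1. \<phi> t = \<psi> t)}"

definition short_arcs :: "'a cspace \<Rightarrow> 'a \<Rightarrow> (complex \<Rightarrow> 'a) set" where
  "short_arcs X x0 = {\<phi> \<in> arcs X. {t \<in> cball 0 1. \<phi> t = x0} = {0}}"

text \<open>\<^const>\<open>cfunspace\<close> carries the supremum metric.\<close>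

definition ShArc :: "'a cspace \<Rightarrow> 'a \<Rightarrow> 'a metric \<Rightarrow> (complex \<Rightarrow> 'a) topology" where
  "ShArc X x0 m =
     subtopology (mtopology_of (cfunspace (top_of_set (cball 0 1)) m)) (short_arcs X x0)"


section \<open>Fundamental groups and conjugacy classes\<close>

definition loops_at :: "'a topology \<Rightarrow> 'a \<Rightarrow> (real \<Rightarrow> 'a) set" where
  "loops_at T x = {p. pathin T p \<and> p 0 = x \<and> p 1 = x}"

definition loop_class :: "'a topology \<Rightarrow> 'a \<Rightarrow> (real \<Rightarrow> 'a) \<Rightarrow> (real \<Rightarrow> 'a) set" where
  "loop_class T x p =
     {q. homotopic_with (\<lambda>r. r 0 = x \<and> r 1 = x) (top_of_set {0..1}) T p q}"

definition join_loops :: "(real \<Rightarrow> 'a) \<Rightarrow> (real \<Rightarrow> 'a) \<Rightarrow> real \<Rightarrow> 'a" where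
  "join_loops p q = (\<lambda>t. if t \<le> 1/2 then p (2 * t) else q (2 * t - 1))"

definition fundamental_group :: "'a topology \<Rightarrow> 'a \<Rightarrow> (real \<Rightarrow> 'a) set monoid" where
  "fundamental_group T x =
     \<lparr>carrier = loop_class T x ` loops_at T x,
      mult = (\<lambda>a b. \<Union>p\<in>a. \<Union>q\<in>b. loop_class T x (join_loops p q)),
      one = loop_class T x (\<lambda>_. x)\<rparr>"

definition freely_homotopic :: "'a topology \<Rightarrow> (real \<Rightarrow> 'a) \<Rightarrow> (real \<Rightarrow> 'a) \<Rightarrow> bool" where
  "freely_homotopic T = homotopic_with (\<lambda>r. r 0 = r 1) (top_of_set {0..1}) T"

definition conj_classes :: "('a, 'b) monoid_scheme \<Rightarrow> 'a set set" where
  "conj_classes H =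
     (\<lambda>a. {g \<otimes>\<^bsub>H\<^esub> a \<otimes>\<^bsub>H\<^esub> inv\<^bsub>H\<^esub> g | g. g \<in> carrier H}) ` carrier H"

text \<open>The winding number of a short arc, for \<open>L\<close> a subset of the punctured space whose inclusion
  is a homotopy equivalence: the classes in \<open>\<pi>\<^sub>1(L, b)\<close> whose loops become freely homotopic, in the
  punctured space, to the restriction of the arc to the unit circle.\<close>

definition winding_class ::
    "'a cspace \<Rightarrow> 'a \<Rightarrow> 'a set \<Rightarrow> 'a \<Rightarrow> (complex \<Rightarrow> 'a) \<Rightarrow> (real \<Rightarrow> 'a) set set" where
  "winding_class X x0 L b \<phi> =
     {a \<in> carrier (fundamental_group (subtopology (top_of X) L) b).
        \<exists>p\<in>a. freely_homotopic (subtopology (top_of X) (topspace (top_of X) - {x0}))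
                p (\<lambda>t. \<phi> (cis (2 * pi * t)))}"


section \<open>Quotients by linear groups\<close>

definition GL :: "(complex^'n^'n) monoid" where
  "GL = \<lparr>carrier = {A. invertible A}, mult = (**), one = mat 1\<rparr>"

text \<open>\<^term>\<open>vec.dim\<close> is the complex dimension.\<close>

definition pseudo_reflection :: "complex^'n^'n \<Rightarrow> bool" where
  "pseudo_reflection A \<longleftrightarrow>
     A \<in> carrier GL \<and> A \<noteq> mat 1 \<and> vec.dim {v. A *v v = v} + 1 = CARD('n)"

definition orbit :: "(complex^'n^'n) set \<Rightarrow> complex^'n \<Rightarrow> (complex^'n) set" where
  "orbit G z = (\<lambda>A. A *v z) ` G"

text \<open>The quotient topology, and the invariant holomorphic functions on saturated open sets as
  structure sheaf.\<close>

definition quotient_cspace :: "(complex^'n^'n) set \<Rightarrow> (complex^'n) set cspace" where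
  "quotient_cspace G =
     \<lparr>top_of = topology (\<lambda>U. U \<subseteq> range (orbit G) \<and> open {z. orbit G z \<in> U}),
      sections = (\<lambda>U. {f. holomorphic_vec_on (\<lambda>z. f (orbit G z)) {z. orbit G z \<in> U}})\<rparr>"

lemma openin_quotient_cspace:
  "openin (top_of (quotient_cspace G)) U \<longleftrightarrow> U \<subseteq> range (orbit G) \<and> open {z. orbit G z \<in> U}"
proof -
  have "istopology (\<lambda>U. U \<subseteq> range (orbit G) \<and> open {z. orbit G z \<in> U})"
    unfolding istopology_def
  proof (intro conjI allI impI)
    fix S T
    assume *: "S \<subseteq> range (orbit G) \<and> open {z. orbit G z \<in> S}"
      "T \<subseteq> range (orbit G) \<and> open {z. orbit G z \<in> T}"
    then show "S \<inter> T \<subseteq> range (orbit G)" by blast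
    show "open {z. orbit G z \<in> S \<inter> T}"
      using * by (simp add: open_Collect_conj)
  next
    fix K assume *: "\<forall>S\<in>K. S \<subseteq> range (orbit G) \<and> open {z. orbit G z \<in> S}"
    then show "\<Union>K \<subseteq> range (orbit G)" by blast
    have "{z. orbit G z \<in> \<Union>K} = (\<Union>S\<in>K. {z. orbit G z \<in> S})" by blast
    then show "open {z. orbit G z \<in> \<Union>K}" using * by auto
  qed
  then show ?thesis
    by (simp add: quotient_cspace_def topology_inverse')
qed

lemma topspace_quotient_cspace: "topspace (top_of (quotient_cspace G)) = range (orbit G)"
proof
  show "topspace (top_of (quotient_cspace G)) \<subseteq> range (orbit G)"
    using openin_topspace[of "top_of (quotient_cspace G)"] unfolding openin_quotient_cspace by blast
  have "openin (top_of (quotient_cspace G)) (range (orbit G))"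
    unfolding openin_quotient_cspace by simp
  then show "range (orbit G) \<subseteq> topspace (top_of (quotient_cspace G))"
    by (rule openin_subset)
qed

text \<open>The link of the origin is the image of a sphere \<open>link_cover G \<epsilon>\<close> around the origin for the
  \<open>G\<close>-invariant Hermitian norm obtained by averaging. For unitary \<open>G\<close> this is a round sphere.\<close>

definition link_cover :: "(complex^'n^'n) set \<Rightarrow> real \<Rightarrow> (complex^'n) set" where
  "link_cover G \<epsilon> = {z. (\<Sum>A\<in>G. (norm (A *v z))\<^sup>2) = \<epsilon>\<^sup>2}"

definition link :: "(complex^'n^'n) set \<Rightarrow> real \<Rightarrow> (complex^'n) set set" where
  "link G \<epsilon> = orbit G ` link_cover G \<epsilon>"

text \<open>The identification of \<open>\<pi>\<^sub>1\<close> of the link with the deck group \<open>G\<close>: lift a loop to a path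
  starting at \<open>z0\<close> and take the \<open>A \<in> G\<close> that moves \<open>z0\<close> to its end point.\<close>

definition monodromy ::
    "(complex^'n^'n) set \<Rightarrow> complex^'n \<Rightarrow> (real \<Rightarrow> (complex^'n) set) set \<Rightarrow> complex^'n^'n" where
  "monodromy G z0 a =
     (THE A. A \<in> G \<and> (\<exists>q. path q \<and> q 0 = z0 \<and> q 1 = A *v z0 \<and> (\<lambda>t. orbit G (q t)) \<in> a))"

end

theory Submission
  imports Defs "HOL-Complex_Analysis.Conformal_Mappings"
begin

text \<open>
  Freeness. Suppose that \<open>A \<in> G\<close> fixes \<open>p \<noteq> 0\<close>. Points of the ray through \<open>p\<close> close to \<open>0\<close> have smooth
  images, so a chart there is a \<open>G\<close>-invariant holomorphic map \<open>F\<close>. Off the fixed spaces, which have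
  codimension at least 2, \<open>F\<close> is a local biholomorphism. Restricted to a 2-plane that meets them
  in \<open>p\<close> only, \<open>det DF\<close> is holomorphic without zeros except possibly at \<open>p\<close>, hence without zeros.
  Since \<open>DF(p) A = DF(p)\<close>, this forces \<open>A = 1\<close>. So \<open>G\<close> acts freely on \<open>complex^'n\<close> minus the origin,
  and this space is simply connected because a trivial \<open>G\<close> or \<open>n = 1\<close> would give a smooth quotient.

  Arcs. Along \<open>exp\<close>, a short arc lifts to a nowhere vanishing holomorphic map \<open>\<Phi>\<close> of a half plane with
  \<open>\<Phi> (s + 2 \<pi> i) = A \<Phi> s\<close>, and the class of \<open>A\<close> is the winding number. It is locally constant, since
  lifts of close arcs stay close along the unit circle. Conversely, the arcs belonging to one \<open>A\<close>
  are connected to each other by segments: if \<open>M s\<close> is a one-parameter group with \<open>M (2 \<pi> i) = A\<close>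
  that tends to \<open>0\<close> as \<open>Re s\<close> tends to minus infinity, the segment from \<open>\<Phi>\<close> to \<open>M s w\<close> contains a map with zeros
  only if \<open>w\<close> lies in the image of a real 3-dimensional domain, which is a null set in \<open>complex^'n\<close>.
\<close>

section \<open>Finite linear groups and their orbit spaces\<close>

text \<open>The orbit space has no linear structure in which to deform arcs. The lifts for a fixed
  \<open>A\<close> on a fixed half plane do form a vector space, once zeros are allowed, so a convex
  combination of two lifts descends to a short arc unless it vanishes somewhere. A direct segment
  between two given lifts may vanish; the detour through \<open>M s w\<close> has the free parameter
  \<open>w\<close>. Real segments keep the bad parameters in real dimension 3, below 2n \<ge> 4;
  complex coefficients would already fail for n = 2.

  A lift is unique only up to an element of \<open>G\<close>, and another choice replaces
  \<open>A\<close> by a conjugate. Hence arcs are sorted into sets \<open>stratum A\<close> that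
  depend only on the class of \<open>A\<close>; being connected, open and pairwise equal or
  disjoint, they are the components.

  \<open>G\<close> is not assumed unitary, and the metric on the orbit space is only assumed to
  induce its topology. The constant \<open>op_bound\<close> therefore replaces invariance of the
  norm, and for openness distances are compared only along the compact image of the unit circle,
  where the metric and the embedding \<open>bdist\<close> can be matched uniformly.\<close>

lemma group_GL: "group (GL :: (complex^'n^'n) monoid)"
proof (rule groupI)
  fix A assume "A \<in> carrier (GL :: (complex^'n^'n) monoid)"
  then show "\<exists>B\<in>carrier GL. B \<otimes>\<^bsub>GL\<^esub> A = \<one>\<^bsub>GL\<^esub>"
    by (auto simp: GL_def invertible_def)
next
  have "invertible (mat 1 :: complex^'n^'n)"
    unfolding invertible_def by (rule exI[of _ "mat 1"]) (simp add: matrix_mul_lid)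
  then show "\<one>\<^bsub>GL\<^esub> \<in> carrier (GL :: (complex^'n^'n) monoid)" by (simp add: GL_def)
qed (simp_all add: GL_def invertible_mult matrix_mul_assoc matrix_mul_lid)

locale finite_linear_group =
  fixes G :: "(complex^'n^'n) set"
  assumes subgroup: "subgroup G GL" and finite: "finite G"
begin

lemma one_mem: "mat 1 \<in> G"
  using subgroup.one_closed[OF subgroup] by (simp add: GL_def)

lemma mult_mem: "A \<in> G \<Longrightarrow> B \<in> G \<Longrightarrow> A ** B \<in> G"
  using subgroup.m_closed[OF subgroup] by (simp add: GL_def)

lemma invertible_mem: "A \<in> G \<Longrightarrow> invertible A"
  using subgroup.subset[OF subgroup] by (auto simp: GL_def)

lemma inverse_mem:
  assumes "A \<in> G"
  obtains B where "B \<in> G" "A ** B = mat 1" "B ** A = mat 1"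
proof -
  have A: "A \<in> carrier GL" using invertible_mem[OF assms] by (simp add: GL_def)
  have "inv\<^bsub>GL\<^esub> A \<in> G" by (rule subgroup.m_inv_closed[OF subgroup assms])
  moreover have "A ** inv\<^bsub>GL\<^esub> A = mat 1" "inv\<^bsub>GL\<^esub> A ** A = mat 1"
    using group.r_inv[OF group_GL A] group.l_inv[OF group_GL A] by (simp_all add: GL_def)
  ultimately show ?thesis using that by blast
qed

lemma right_mult_image: "A \<in> G \<Longrightarrow> (\<lambda>B. B ** A) ` G = G"
proof (intro equalityI subsetI)
  fix B assume A: "A \<in> G" and B: "B \<in> G"
  obtain A' where A': "A' \<in> G" "A' ** A = mat 1" using inverse_mem[OF A] by metis
  have "B = (B ** A') ** A" by (simp add: matrix_mul_assoc[symmetric] A' matrix_mul_rid)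
  then show "B \<in> (\<lambda>B. B ** A) ` G" using mult_mem A' B by blast
qed (auto intro: mult_mem)

lemma inj_action: "A \<in> G \<Longrightarrow> A *v z = A *v w \<Longrightarrow> z = w"
  by (metis inverse_mem matrix_vector_mul_assoc matrix_vector_mul_lid)

lemma action_eq_0_iff: "A \<in> G \<Longrightarrow> A *v z = 0 \<longleftrightarrow> z = 0"
  by (metis inj_action matrix_vector_mult_0_right)

lemma orbit_eq_iff: "orbit G z = orbit G w \<longleftrightarrow> (\<exists>A\<in>G. w = A *v z)"
proof
  assume "orbit G z = orbit G w"
  moreover have "w \<in> orbit G w" unfolding orbit_def using one_mem by (metis imageI matrix_vector_mul_lid)
  ultimately have "w \<in> orbit G z" by simp
  then show "\<exists>A\<in>G. w = A *v z" by (auto simp: orbit_def)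
next
  assume "\<exists>A\<in>G. w = A *v z"
  then obtain A where A: "A \<in> G" "w = A *v z" by blast
  have "orbit G w = (\<lambda>B. B *v z) ` ((\<lambda>B. B ** A) ` G)"
    by (simp add: orbit_def A image_image matrix_vector_mul_assoc)
  then show "orbit G z = orbit G w" by (simp add: right_mult_image A orbit_def)
qed

lemma orbit_action [simp]: "A \<in> G \<Longrightarrow> orbit G (A *v z) = orbit G z"
  using orbit_eq_iff by metis

lemma mem_orbit: "z \<in> orbit G z"
  unfolding orbit_def using one_mem by (metis imageI matrix_vector_mul_lid)

lemma orbit_eq_orbit_0_iff: "orbit G z = orbit G 0 \<longleftrightarrow> z = 0"
  by (metis action_eq_0_iff orbit_eq_iff)

text \<open>A single Lipschitz constant for all elements of \<open>G\<close>. The summand 1 makes it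
  at least 1, hence safe to divide by.\<close>

definition op_bound :: real where
  "op_bound = (\<Sum>A\<in>G. onorm ((*v) A)) + 1"

lemma op_bound_ge_1: "op_bound \<ge> 1"
  unfolding op_bound_def by (simp add: sum_nonneg onorm_pos_le)

lemma norm_action_le: "A \<in> G \<Longrightarrow> norm (A *v z) \<le> op_bound * norm z"
proof -
  assume A: "A \<in> G"
  have "norm (A *v z) \<le> onorm ((*v) A) * norm z" by (rule onorm) simp
  also have "onorm ((*v) A) \<le> op_bound"
    unfolding op_bound_def using member_le_sum[OF A, of "\<lambda>A. onorm ((*v) A)"] finite
    by (simp add: onorm_pos_le add.commute add_increasing)
  finally show ?thesis by (simp add: mult_right_mono)
qed

lemma norm_action_diff_le: "A \<in> G \<Longrightarrow> norm (A *v z - A *v w) \<le> op_bound * norm (z - w)"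
  using norm_action_le[of A "z - w"] by (simp add: matrix_vector_mult_diff_distrib)

end

lemma isCont_action: "isCont (\<lambda>z. A *v z) (z :: complex^'n)"
  using matrix_vector_mul_bounded_linear[of A] by (simp add: linear_continuous_at)

lemma continuous_on_action [continuous_intros]:
  "continuous_on S f \<Longrightarrow> continuous_on S (\<lambda>x. A *v (f x :: complex^'n))"
  by (rule continuous_on_compose2[of UNIV "(*v) A"])
     (auto intro: continuous_at_imp_continuous_on isCont_action)

subsection \<open>Embedding into a normed space\<close>

text \<open>A Kuratowski-type embedding of a space of closed sets. It makes the covering space theory
  of the library, which lives on normed spaces, applicable to orbit spaces.\<close>

definition bdist :: "'a::metric_space set \<Rightarrow> ('a \<Rightarrow>\<^sub>C real)" where
  "bdist S = Bcontfun (\<lambda>y. min 1 (infdist y S))"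

text \<open>Distance functions are unbounded on \<open>complex^'n\<close>; truncation at 1 makes
  them bounded continuous functions without affecting small distances.\<close>

lemma apply_bdist [simp]: "apply_bcontfun (bdist S) y = min 1 (infdist y S)"
proof -
  have "(\<lambda>y. min 1 (infdist y S)) \<in> bcontfun"
    by (rule bcontfun_normI[of _ 1]) (auto intro!: continuous_intros simp: infdist_nonneg)
  then show ?thesis by (simp add: bdist_def Bcontfun_inverse)
qed

context finite_linear_group
begin

abbreviation X where "X \<equiv> quotient_cspace G"

text \<open>The finite orbit of \<open>w\<close> has a point \<open>A *v w\<close> nearest to
  \<open>y\<close>, and the same \<open>A\<close> moves \<open>z\<close> close to that
  point.\<close>

lemma infdist_orbit_le: "infdist y (orbit G z) \<le> infdist y (orbit G w) + op_bound * norm (z - w)"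
proof -
  have "closed (orbit G w)" "orbit G w \<noteq> {}"
    using finite mem_orbit by (auto simp: orbit_def finite_imp_closed)
  then obtain A where A: "A \<in> G" "infdist y (orbit G w) = dist y (A *v w)"
    using infdist_attains_inf[of "orbit G w" y] by (auto simp: orbit_def)
  have "infdist y (orbit G z) \<le> dist y (A *v z)"
    using A by (auto simp: orbit_def intro: infdist_le)
  also have "\<dots> \<le> dist y (A *v w) + dist (A *v w) (A *v z)" by (rule dist_triangle)
  also have "dist (A *v w) (A *v z) \<le> op_bound * norm (z - w)"
    using norm_action_diff_le[OF A(1), of z w] by (simp add: dist_norm norm_minus_commute)
  finally show ?thesis using A by simp
qed

lemma dist_bdist_orbit_le: "dist (bdist (orbit G z)) (bdist (orbit G w)) \<le> op_bound * norm (z - w)"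
proof (rule dist_bound)
  fix y
  show "dist (bdist (orbit G z) y) (bdist (orbit G w) y) \<le> op_bound * norm (z - w)"
    using infdist_orbit_le[of y z w] infdist_orbit_le[of y w z]
    by (simp add: dist_real_def norm_minus_commute min_def abs_if)
qed

text \<open>Evaluation at \<open>z\<close> itself suffices: the first function vanishes there and
  the second is the truncated distance to the other orbit. The bound \<open>\<delta> \<le> 1\<close>
  prevents the truncation from hiding a large distance.\<close>

lemma dist_bdist_orbit_less:
  assumes "dist (bdist (orbit G z)) (bdist (orbit G w)) < \<delta>" "\<delta> \<le> 1"
  obtains A where "A \<in> G" "norm (z - A *v w) < \<delta>"
proof -
  have "dist (bdist (orbit G z) z) (bdist (orbit G w) z) < \<delta>"
    using assms(1) dist_bounded le_less_trans by blast
  then have *: "infdist z (orbit G w) < \<delta>"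
    using mem_orbit[of z] assms(2) infdist_nonneg[of z "orbit G w"] by (simp add: dist_real_def min_def split: if_splits)
  have "closed (orbit G w)" "orbit G w \<noteq> {}"
    using finite mem_orbit by (auto simp: orbit_def finite_imp_closed)
  then obtain A where A: "A \<in> G" "infdist z (orbit G w) = dist z (A *v w)"
    using infdist_attains_inf[of "orbit G w" z] by (auto simp: orbit_def)
  then show ?thesis using * that by (simp add: dist_norm)
qed

lemma bdist_orbit_eq_iff: "bdist (orbit G z) = bdist (orbit G w) \<longleftrightarrow> orbit G z = orbit G w"
proof
  assume eq: "bdist (orbit G z) = bdist (orbit G w)"
  have "infdist z (orbit G w) = 0"
    using arg_cong[OF eq, of "\<lambda>f. apply_bcontfun f z"] mem_orbit[of z] by (simp add: min_def split: if_splits)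
  moreover have "closed (orbit G w)" "orbit G w \<noteq> {}"
    using finite mem_orbit by (auto simp: orbit_def finite_imp_closed)
  ultimately have "z \<in> orbit G w" using in_closed_iff_infdist_zero by blast
  then show "orbit G z = orbit G w" by (auto simp: orbit_def[of G w])
qed simp

definition proj :: "complex^'n \<Rightarrow> ((complex^'n) \<Rightarrow>\<^sub>C real)" where
  "proj z = bdist (orbit G z)"

lemma proj_eq_iff: "proj z = proj w \<longleftrightarrow> (\<exists>A\<in>G. w = A *v z)"
  by (simp add: proj_def bdist_orbit_eq_iff orbit_eq_iff)

lemma proj_action [simp]: "A \<in> G \<Longrightarrow> proj (A *v z) = proj z"
  by (simp add: proj_def)

lemma continuous_on_proj: "continuous_on S proj"
proof (rule continuous_on_subset[of UNIV])
  show "continuous_on UNIV proj"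
    unfolding continuous_on_iff
  proof (intro ballI allI impI)
    fix z :: "complex^'n" and e :: real assume "e > 0"
    have "dist (proj w) (proj z) < e" if "dist w z < e / op_bound" for w
    proof -
      have "dist (proj w) (proj z) \<le> op_bound * norm (w - z)"
        unfolding proj_def by (rule dist_bdist_orbit_le)
      also have "\<dots> < e" using that op_bound_ge_1 by (simp add: dist_norm field_simps)
      finally show ?thesis .
    qed
    then show "\<exists>d>0. \<forall>w\<in>UNIV. dist w z < d \<longrightarrow> dist (proj w) (proj z) < e"
      using \<open>e > 0\<close> op_bound_ge_1 by (intro exI[of _ "e / op_bound"]) auto
  qed
qed simp

text \<open>If \<open>proj w\<close> is close to \<open>proj z\<close>, some translate of
  \<open>w\<close> is close to \<open>z\<close>. Hence \<open>proj\<close> is open onto its range,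
  and the quotient topology agrees with the one induced by the embedding.\<close>

lemma proj_open_image:
  assumes "open U"
  obtains W where "open W" "proj ` U = W \<inter> range proj"
    "\<And>z. proj z \<in> W \<longleftrightarrow> orbit G z \<in> orbit G ` U"
proof -
  have "\<exists>W. open W \<and> proj z \<in> W \<and> (\<forall>w. proj w \<in> W \<longrightarrow> orbit G w \<in> orbit G ` U)" if "z \<in> U" for z
  proof -
    obtain \<delta> where \<delta>: "\<delta> > 0" "ball z \<delta> \<subseteq> U" using assms \<open>z \<in> U\<close> openE by blast
    have "orbit G w \<in> orbit G ` U" if "proj w \<in> ball (proj z) (min \<delta> 1)" for w
    proof -
      have "dist (bdist (orbit G z)) (bdist (orbit G w)) < min \<delta> 1"
        using that by (simp add: proj_def)
      then obtain A where A: "A \<in> G" "norm (z - A *v w) < min \<delta> 1"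
        by (rule dist_bdist_orbit_less) auto
      then have "A *v w \<in> U" using \<delta> by (auto simp: dist_norm)
      then show ?thesis using orbit_action[OF A(1), of w] by (metis imageI)
    qed
    then show ?thesis using \<delta>(1) by (intro exI[of _ "ball (proj z) (min \<delta> 1)"]) auto
  qed
  then obtain W where W: "\<And>z. z \<in> U \<Longrightarrow> open (W z) \<and> proj z \<in> W z \<and> (\<forall>w. proj w \<in> W z \<longrightarrow> orbit G w \<in> orbit G ` U)"
    by metis
  have **: "proj w \<in> (\<Union>z\<in>U. W z) \<longleftrightarrow> orbit G w \<in> orbit G ` U" for w
  proof
    assume "orbit G w \<in> orbit G ` U"
    then obtain z where z: "z \<in> U" "orbit G w = orbit G z" by blast
    then have "proj w = proj z" by (simp add: proj_def)
    then show "proj w \<in> (\<Union>z\<in>U. W z)" using W z by auto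
  qed (use W in auto)
  show ?thesis
  proof (rule that)
    show "open (\<Union>z\<in>U. W z)" using W by blast
    show "proj z \<in> (\<Union>z\<in>U. W z) \<longleftrightarrow> orbit G z \<in> orbit G ` U" for z by (rule **)
    show "proj ` U = (\<Union>z\<in>U. W z) \<inter> range proj"
    proof (intro equalityI subsetI)
      fix y assume "y \<in> (\<Union>z\<in>U. W z) \<inter> range proj"
      then obtain w where w: "y = proj w" "proj w \<in> (\<Union>z\<in>U. W z)" by auto
      then have "orbit G w \<in> orbit G ` U" using ** by blast
      then show "y \<in> proj ` U" using w by (auto simp: proj_def)
    qed (use W in auto)
  qed
qed

lemma openin_orbit_image: "open U \<Longrightarrow> openin (top_of X) (orbit G ` U)"
proof -
  assume U: "open U"
  obtain W where W: "open W" "\<And>z. proj z \<in> W \<longleftrightarrow> orbit G z \<in> orbit G ` U"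
    using proj_open_image[OF U] by metis
  have "{z. orbit G z \<in> orbit G ` U} = proj -` W" using W by auto
  then show ?thesis
    using continuous_on_proj[of UNIV] W(1) by (auto simp: openin_quotient_cspace open_vimage)
qed

lemma continuous_map_orbit: "continuous_map euclidean (top_of X) (orbit G)"
  by (auto simp: continuous_map_def openin_quotient_cspace topspace_quotient_cspace)

lemma continuous_map_bdist: "continuous_map (top_of X) euclidean bdist"
proof -
  have "{z. orbit G z \<in> {x \<in> range (orbit G). bdist x \<in> U}} = proj -` U" for U
    by (auto simp: proj_def)
  then show ?thesis
    using continuous_on_proj[of UNIV]
    by (auto simp: continuous_map_def openin_quotient_cspace topspace_quotient_cspace open_vimage)
qed

text \<open>As \<open>bdist\<close> embeds the orbit space, continuity into it can be tested in a
  normed space, the form in which the lifting theorems are applied.\<close>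

lemma continuous_map_into_X_iff:
  "continuous_map T (top_of X) f \<longleftrightarrow>
     f \<in> topspace T \<rightarrow> range (orbit G) \<and> continuous_map T euclidean (\<lambda>x. bdist (f x))"
proof
  assume L: "continuous_map T (top_of X) f"
  have "continuous_map T euclidean (bdist \<circ> f)"
    using continuous_map_compose[OF L continuous_map_bdist] .
  then show "f \<in> topspace T \<rightarrow> range (orbit G) \<and> continuous_map T euclidean (\<lambda>x. bdist (f x))"
    using L by (auto simp: o_def continuous_map_def topspace_quotient_cspace)
next
  assume R: "f \<in> topspace T \<rightarrow> range (orbit G) \<and> continuous_map T euclidean (\<lambda>x. bdist (f x))"
  have "openin T {x \<in> topspace T. f x \<in> U}" if U: "openin (top_of X) U" for U
  proof -
    have *: "open {z. orbit G z \<in> U}" "U \<subseteq> range (orbit G)" using U by (auto simp: openin_quotient_cspace)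
    then have U_eq: "orbit G ` {z. orbit G z \<in> U} = U" by auto
    obtain W where W: "open W" "\<And>z. proj z \<in> W \<longleftrightarrow> orbit G z \<in> U"
      using proj_open_image[OF *(1)] unfolding U_eq by metis
    have "{x \<in> topspace T. f x \<in> U} = {x \<in> topspace T. bdist (f x) \<in> W}"
      using R W(2) by (auto simp: proj_def Pi_iff image_iff)
    then show ?thesis using R W(1) by (auto simp: continuous_map_def)
  qed
  then show "continuous_map T (top_of X) f"
    using R by (auto simp: continuous_map_def topspace_quotient_cspace)
qed

lemma continuous_map_into_X_iff_on:
  "continuous_map (top_of_set S) (top_of X) f \<longleftrightarrow>
     f \<in> S \<rightarrow> range (orbit G) \<and> continuous_on S (\<lambda>x. bdist (f x))"
  by (simp add: continuous_map_into_X_iff)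

lemma continuous_map_orbit_comp:
  "continuous_on S q \<Longrightarrow> continuous_map (top_of_set S) (top_of X) (\<lambda>t. orbit G (q t))"
  by (metis continuous_map_compose[OF _ continuous_map_orbit, unfolded o_def] continuous_map_iff_continuous)

subsection \<open>Local sections\<close>

text \<open>A candidate for a sheet of the covering: translates of \<open>B\<close> under distinct
  elements of \<open>G\<close> are disjoint, and the orbit map is injective on
  \<open>B\<close>.\<close>

definition evenly :: "(complex^'n) set \<Rightarrow> bool" where
  "evenly B \<longleftrightarrow> open B \<and> (\<forall>A\<in>G. \<forall>x\<in>B. A *v x \<in> B \<longrightarrow> A = mat 1)"

lemma trivial_stabilizer_ball:
  assumes "\<And>A. A \<in> G \<Longrightarrow> A *v z = z \<Longrightarrow> A = mat 1"
  obtains \<delta> where "\<delta> > 0" "evenly (ball z \<delta>)"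
proof -
  obtain e where e: "e > 0" "\<And>A. A \<in> G \<Longrightarrow> A \<noteq> mat 1 \<Longrightarrow> e \<le> norm (A *v z - z)"
  proof (cases "G - {mat 1} = {}")
    case True
    then show ?thesis using that[of 1] by auto
  next
    case False
    let ?e = "Min ((\<lambda>A. norm (A *v z - z)) ` (G - {mat 1}))"
    have "?e > 0" using False finite assms by (subst Min_gr_iff) auto
    moreover have "?e \<le> norm (A *v z - z)" if "A \<in> G" "A \<noteq> mat 1" for A
      using that finite by (intro Min_le) auto
    ultimately show ?thesis using that by blast
  qed
  \<comment> \<open>If \<open>x\<close> and \<open>A *v x\<close> both lay in the ball,
    \<open>A *v z\<close> would be closer to \<open>z\<close> than
    \<open>op_bound * \<delta> + \<delta>\<close>, which is exactly the lower bound \<open>e\<close>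
    on the displacement.\<close>
  define \<delta> where "\<delta> = e / (1 + op_bound)"
  have pos: "1 + op_bound > 0" using op_bound_ge_1 by linarith
  then have "\<delta> > 0" using e by (simp add: \<delta>_def)
  moreover have "A *v x \<notin> ball z \<delta>" if "A \<in> G" "A \<noteq> mat 1" "x \<in> ball z \<delta>" for A x
  proof
    assume "A *v x \<in> ball z \<delta>"
    then have "norm (A *v x - z) < \<delta>" by (simp add: dist_norm norm_minus_commute)
    moreover have "norm (A *v z - A *v x) \<le> op_bound * \<delta>"
      using norm_action_diff_le[OF that(1), of z x] that(3) op_bound_ge_1
      by (smt (verit) dist_norm mem_ball mult_left_mono)
    moreover have "norm (A *v z - z) \<le> norm (A *v z - A *v x) + norm (A *v x - z)"
      using norm_triangle_ineq[of "A *v z - A *v x" "A *v x - z"] by simp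
    ultimately have "e < op_bound * \<delta> + \<delta>" using e(2)[OF that(1,2)] by linarith
    also have "\<dots> = \<delta> * (1 + op_bound)" by (simp add: algebra_simps)
    also have "\<dots> = e" using pos by (simp add: \<delta>_def)
    finally show False by simp
  qed
  ultimately show ?thesis using that unfolding evenly_def by blast
qed

lemma evenly_inj: "evenly B \<Longrightarrow> x \<in> B \<Longrightarrow> y \<in> B \<Longrightarrow> orbit G x = orbit G y \<Longrightarrow> x = y"
  unfolding evenly_def orbit_eq_iff by (metis matrix_vector_mul_lid)

definition lsec :: "(complex^'n) set \<Rightarrow> (complex^'n) set \<Rightarrow> complex^'n" where
  "lsec B y = (THE x. x \<in> B \<and> orbit G x = y)"

lemma lsec_orbit: "evenly B \<Longrightarrow> x \<in> B \<Longrightarrow> lsec B (orbit G x) = x"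
  unfolding lsec_def by (rule the_equality) (auto dest: evenly_inj)

text \<open>If \<open>A\<close> moves a point into \<open>B\<close>, then near that point the local
  inverse composed with the orbit map is just the linear map given by \<open>A\<close>. So the
  inverse has components in the structure sheaf, which is what makes lifts of holomorphic maps
  holomorphic.\<close>

lemma lsec_sections:
  assumes "evenly B"
  shows "(\<lambda>y. lsec B y $ i) \<in> sections X (orbit G ` B)"
proof -
  have "\<exists>L. ((\<lambda>z. lsec B (orbit G z) $ i) has_derivative L) (at z) \<and> (\<forall>c v. L (c *s v) = c * L v)"
    if z: "orbit G z \<in> orbit G ` B" for z
  proof -
    obtain x where x: "x \<in> B" "orbit G z = orbit G x" using z by blast
    then obtain A where A: "A \<in> G" "x = A *v z" by (auto simp: orbit_eq_iff)
    have "open ((*v) A -` B)" using assms isCont_action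
      by (intro continuous_open_vimage) (auto simp: evenly_def)
    moreover have "z \<in> (*v) A -` B" using A x by simp
    moreover have "(A *v w) $ i = lsec B (orbit G w) $ i" if "w \<in> (*v) A -` B" for w
      using lsec_orbit[OF assms, of "A *v w"] that A(1) by simp
    moreover have "((\<lambda>w. (A *v w) $ i) has_derivative (\<lambda>w. (A *v w) $ i)) (at z)"
      by (rule bounded_linear_imp_has_derivative)
         (rule bounded_linear_compose[OF bounded_linear_vec_nth matrix_vector_mul_bounded_linear])
    ultimately have "((\<lambda>z. lsec B (orbit G z) $ i) has_derivative (\<lambda>w. (A *v w) $ i)) (at z)"
      by (rule has_derivative_transform_within_open[rotated, of _ z]) auto
    moreover have "(A *v (c *s v)) $ i = c * (A *v v) $ i" for c v
      by (simp add: vector_scalar_commute)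
    ultimately show ?thesis by blast
  qed
  then show ?thesis by (auto simp: quotient_cspace_def holomorphic_vec_on_def)
qed

end

section \<open>The covering of the punctured orbit space by a free action\<close>

locale free_linear_group = finite_linear_group G for G :: "(complex^'n^'n) set" +
  assumes free: "\<And>A z. A \<in> G \<Longrightarrow> z \<noteq> 0 \<Longrightarrow> A *v z = z \<Longrightarrow> A = mat 1"
begin

lemma evenly_ball:
  assumes "z \<noteq> 0"
  obtains \<delta> where "\<delta> > 0" "evenly (ball z \<delta>)" "0 \<notin> ball z \<delta>"
proof -
  obtain \<delta> where \<delta>: "\<delta> > 0" "evenly (ball z \<delta>)"
    using trivial_stabilizer_ball free[OF _ assms] by blast
  show ?thesis
  proof (rule that)
    show "min \<delta> (norm z) > 0" using \<delta>(1) assms by simp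
    have "ball z (min \<delta> (norm z)) \<subseteq> ball z \<delta>" by (rule subset_ball) simp
    then show "evenly (ball z (min \<delta> (norm z)))"
      using \<delta>(2) unfolding evenly_def by blast
  qed simp
qed

text \<open>Over the image of an \<open>evenly\<close> ball \<open>B\<close> avoiding 0 the sheets
  are the translates of \<open>B\<close>. Two sheets that meet coincide, because
  \<open>A1 *v b1 = A2 *v b2\<close> lets the inverse of \<open>A2\<close> times \<open>A1\<close>
  carry a point of \<open>B\<close> into \<open>B\<close>.\<close>

lemma covering_space_proj: "covering_space (-{0}) proj (proj ` (-{0}))"
proof (rule covering_spaceI)
  show "continuous_on (-{0}) proj" by (rule continuous_on_proj)
  fix y assume "y \<in> proj ` (-{0})"
  then obtain z where z: "y = proj z" "z \<noteq> 0" by auto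
  obtain \<delta> where \<delta>: "\<delta> > 0" "evenly (ball z \<delta>)" "0 \<notin> ball z \<delta>" using evenly_ball[OF z(2)] .
  define B where "B = ball z \<delta>"
  define v where "v = (\<lambda>A. (*v) A ` B) ` G"
  have B: "evenly B" "0 \<notin> B" "z \<in> B" using \<delta> by (auto simp: B_def)
  have sheet_open: "open ((*v) A ` U)" if AU: "A \<in> G" "open U" for A U
  proof -
    obtain A' where A': "A' \<in> G" "A ** A' = mat 1" "A' ** A = mat 1" using inverse_mem[OF AU(1)] by metis
    have "(*v) A ` U = (*v) A' -` U"
      by (auto simp: image_iff matrix_vector_mul_assoc A')
         (metis A'(2) matrix_vector_mul_assoc matrix_vector_mul_lid)
    then show ?thesis using AU(2) isCont_action[where A = A']
      by (simp add: continuous_open_vimage)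
  qed
  show "\<exists>T. y \<in> T \<and> openin (top_of_set (proj ` (-{0}))) T \<and>
           (\<exists>v. \<Union>v = (-{0}) \<inter> proj -` T \<and> (\<forall>u\<in>v. openin (top_of_set (-{0})) u) \<and>
             pairwise disjnt v \<and> (\<forall>u\<in>v. \<exists>q. homeomorphism u T proj q))"
  proof (intro exI[of _ "proj ` B"] exI[of _ v] conjI ballI)
    show "y \<in> proj ` B" using z B by auto
    obtain W where "open W" "proj ` B = W \<inter> range proj"
      using proj_open_image[of B] B(1) unfolding evenly_def by metis
    then show "openin (top_of_set (proj ` (-{0}))) (proj ` B)"
      using B(2) unfolding openin_open by (intro exI[of _ W]) auto
    show "\<Union>v = (-{0}) \<inter> proj -` proj ` B"
    proof (intro equalityI subsetI)
      fix x assume "x \<in> \<Union>v"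
      then obtain A b where "A \<in> G" "b \<in> B" "x = A *v b" by (auto simp: v_def)
      then show "x \<in> (-{0}) \<inter> proj -` proj ` B" using B(2) by (auto simp: action_eq_0_iff)
    next
      fix x assume "x \<in> (-{0}) \<inter> proj -` proj ` B"
      then obtain b where "b \<in> B" "proj b = proj x" by auto
      then show "x \<in> \<Union>v" unfolding proj_eq_iff by (auto simp: v_def)
    qed
    show "openin (top_of_set (-{0})) u" if "u \<in> v" for u
    proof -
      have "open u" using that sheet_open B(1) by (auto simp: v_def evenly_def)
      moreover have "u \<subseteq> -{0}" using that B(2) by (auto simp: v_def action_eq_0_iff)
      ultimately show ?thesis by (auto simp: openin_open)
    qed
    show "pairwise disjnt v"
    proof (rule pairwiseI)
      fix u1 u2 assume u: "u1 \<in> v" "u2 \<in> v" "u1 \<noteq> u2"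
      then obtain A1 A2 where A: "A1 \<in> G" "A2 \<in> G" "u1 = (*v) A1 ` B" "u2 = (*v) A2 ` B"
        by (auto simp: v_def)
      obtain A' where A': "A' \<in> G" "A2 ** A' = mat 1" "A' ** A2 = mat 1"
        using inverse_mem[OF \<open>A2 \<in> G\<close>] by metis
      have "A1 = A2" if b: "b1 \<in> B" "b2 \<in> B" "A1 *v b1 = A2 *v b2" for b1 b2
      proof -
        have "(A' ** A1) *v b1 = b2"
          using b(3) A' by (metis matrix_vector_mul_assoc matrix_vector_mul_lid)
        then have "A' ** A1 = mat 1"
          using B(1) b mult_mem[OF A'(1) A(1)] unfolding evenly_def by metis
        then show ?thesis using A' by (metis matrix_mul_assoc matrix_mul_lid matrix_mul_rid)
      qed
      then show "disjnt u1 u2" using u(3) A by (auto simp: disjnt_iff)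
    qed
    show "\<exists>q. homeomorphism u (proj ` B) proj q" if "u \<in> v" for u
    proof -
      obtain A where A: "A \<in> G" "u = (*v) A ` B" using \<open>u \<in> v\<close> by (auto simp: v_def)
      have u_open: "open u" using A sheet_open B(1) by (auto simp: evenly_def)
      have img: "proj ` u = proj ` B" using A by (simp add: image_image)
      have inj: "inj_on proj u"
      proof (rule inj_onI)
        fix x y assume xy: "x \<in> u" "y \<in> u" "proj x = proj y"
        then obtain b c where bc: "x = A *v b" "y = A *v c" "b \<in> B" "c \<in> B" using A by auto
        then have "orbit G b = orbit G c" using xy A by (simp add: proj_def bdist_orbit_eq_iff)
        then show "x = y" using evenly_inj[OF B(1)] bc by blast
      qed
      have "openin (top_of_set (proj ` u)) (proj ` T)" if T: "openin (top_of_set u) T" for T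
      proof -
        have "open T" "T \<subseteq> u" using T u_open by (auto simp: openin_open_eq)
        then obtain W where "open W" "proj ` T = W \<inter> range proj" using proj_open_image by metis
        then have "proj ` T = proj ` u \<inter> W" using \<open>T \<subseteq> u\<close> by auto
        then show ?thesis using \<open>open W\<close> by (auto simp: openin_open)
      qed
      then obtain q where "homeomorphism u (proj ` u) proj q"
        using homeomorphism_injective_open_map[OF continuous_on_proj refl inj] by metis
      then show ?thesis using img by auto
    qed
  qed
qed auto

end

section \<open>Holomorphic functions of several variables\<close>

lemma has_derivative_vec:
  fixes f :: "'a::real_normed_vector \<Rightarrow> 'b::euclidean_space^'n"
  assumes "\<And>i. ((\<lambda>x. f x $ i) has_derivative D i) (at a within S)"
  shows "(f has_derivative (\<lambda>v. \<chi> i. D i v)) (at a within S)"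
  unfolding has_derivative_componentwise_within[of f]
proof
  fix b :: "'b^'n" assume "b \<in> Basis"
  then obtain i u where b: "b = axis i u" by (auto simp: Basis_vec_def)
  have "((\<lambda>x. f x $ i \<bullet> u) has_derivative (\<lambda>v. D i v \<bullet> u)) (at a within S)"
    by (intro has_derivative_inner_left assms)
  then show "((\<lambda>x. f x \<bullet> b) has_derivative (\<lambda>v. (\<chi> i. D i v) \<bullet> b)) (at a within S)"
    by (simp add: b inner_axis)
qed

lemma norm_smult_vec: "norm (c *s (v :: complex^'n)) = norm c * norm v"
  by (simp add: norm_vec_def norm_mult L2_set_right_distrib)

lemma bounded_linear_smult_left: "bounded_linear (\<lambda>c. c *s (v :: complex^'n))"
  by (rule bounded_linear_intro[of _ "norm v"])
     (auto simp: norm_smult_vec vector_sadd_rdistrib vec_eq_iff distrib_right mult.commute)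

lemmas continuous_on_smult_left [continuous_intros] =
  bounded_linear.continuous_on[OF bounded_linear_smult_left]

text \<open>The chain rule yields a real derivative; complex linearity of \<open>L\<close> turns it
  into multiplication by a single complex number.\<close>

lemma holomorphic_vec_on_compose:
  assumes f: "holomorphic_vec_on f U" and h: "\<And>i. (\<lambda>s. h s $ i) holomorphic_on T"
    and "open T" and hU: "\<And>s. s \<in> T \<Longrightarrow> h s \<in> U"
  shows "(\<lambda>s. f (h s)) holomorphic_on T"
proof (subst holomorphic_on_open[OF \<open>open T\<close>], intro ballI)
  fix s assume s: "s \<in> T"
  obtain L where L: "(f has_derivative L) (at (h s))" "\<And>c v. L (c *s v) = c * L v"
    using f hU[OF s] by (auto simp: holomorphic_vec_on_def)
  have "((\<lambda>s. h s $ i) has_derivative (\<lambda>c. deriv (\<lambda>s. h s $ i) s * c)) (at s)" for i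
    using holomorphic_derivI[OF h[of i] \<open>open T\<close> s] by (simp add: has_field_derivative_def)
  then have "(h has_derivative (\<lambda>c. \<chi> i. deriv (\<lambda>s. h s $ i) s * c)) (at s)"
    by (rule has_derivative_vec)
  then have "((\<lambda>s. f (h s)) has_derivative (\<lambda>c. L (\<chi> i. deriv (\<lambda>s. h s $ i) s * c))) (at s)"
    using has_derivative_compose L(1) by blast
  also have "(\<lambda>c. L (\<chi> i. deriv (\<lambda>s. h s $ i) s * c)) = (\<lambda>c. L (\<chi> i. deriv (\<lambda>s. h s $ i) s) * c)"
  proof
    fix c
    have "(\<chi> i. deriv (\<lambda>s. h s $ i) s * c) = c *s (\<chi> i. deriv (\<lambda>s. h s $ i) s)"
      by (simp add: vec_eq_iff mult.commute)
    then show "L (\<chi> i. deriv (\<lambda>s. h s $ i) s * c) = L (\<chi> i. deriv (\<lambda>s. h s $ i) s) * c"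
      by (simp add: L mult.commute)
  qed
  finally show "\<exists>f'. ((\<lambda>s. f (h s)) has_field_derivative f') (at s)"
    by (auto simp: has_field_derivative_def)
qed

lemma holomorphic_vec_on_imp_continuous_on: "holomorphic_vec_on f U \<Longrightarrow> continuous_on U f"
  unfolding holomorphic_vec_on_def
  by (meson continuous_at_imp_continuous_on has_derivative_continuous)

section \<open>Partial derivatives: continuity and holomorphy along lines\<close>

definition pd :: "(complex^'n \<Rightarrow> complex) \<Rightarrow> 'n \<Rightarrow> complex^'n \<Rightarrow> complex" where
  "pd f j z = deriv (\<lambda>\<zeta>. f (z + \<zeta> *s axis j 1)) 0"

lemma holomorphic_on_line:
  assumes "holomorphic_vec_on f U" "open T" "\<And>\<zeta>. \<zeta> \<in> T \<Longrightarrow> z + \<zeta> *s v \<in> U"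
  shows "(\<lambda>\<zeta>. f (z + \<zeta> *s v)) holomorphic_on T"
  by (rule holomorphic_vec_on_compose[OF assms(1) _ assms(2,3)]) (auto intro!: holomorphic_intros)

lemma open_line: "open U \<Longrightarrow> open {\<zeta>. z + \<zeta> *s (v :: complex^'n) \<in> U}"
proof -
  assume "open U"
  then have "open ((\<lambda>\<zeta>. z + \<zeta> *s v) -` U)"
    by (intro open_vimage) (auto intro!: continuous_intros)
  then show ?thesis by (simp add: vimage_def)
qed

lemma pd_has_field_derivative:
  assumes "holomorphic_vec_on f U" "open U" "z + \<zeta> *s axis j 1 \<in> U"
  shows "((\<lambda>\<zeta>. f (z + \<zeta> *s axis j 1)) has_field_derivative pd f j (z + \<zeta> *s axis j 1)) (at \<zeta>)"
proof -
  have "(\<lambda>\<xi>. f ((z + \<zeta> *s axis j 1) + \<xi> *s axis j 1)) holomorphic_on {\<xi>. (z + \<zeta> *s axis j 1) + \<xi> *s axis j 1 \<in> U}"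
    by (rule holomorphic_on_line[OF assms(1)]) (auto intro: open_line assms)
  from holomorphic_derivI[OF this open_line[OF assms(2)], of 0] assms(3)
  have "((\<lambda>\<xi>. f ((z + \<zeta> *s axis j 1) + \<xi> *s axis j 1)) has_field_derivative pd f j (z + \<zeta> *s axis j 1)) (at (\<zeta> - \<zeta>))"
    by (simp add: pd_def)
  then have "((\<lambda>\<xi>. (\<lambda>\<zeta>. f (z + \<zeta> *s axis j 1)) (\<xi> + \<zeta>)) has_field_derivative pd f j (z + \<zeta> *s axis j 1)) (at 0)"
    by (simp add: vector_sadd_rdistrib add_ac)
  then show ?thesis by (subst (asm) DERIV_shift[symmetric]) simp
qed

lemma has_derivative_pd:
  assumes "holomorphic_vec_on f U" "open U" "z \<in> U"
  shows "(f has_derivative (\<lambda>v. \<Sum>j\<in>UNIV. v $ j * pd f j z)) (at z)"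
proof -
  obtain L where L: "(f has_derivative L) (at z)" "\<And>c v. L (c *s v) = c * L v"
    using assms by (auto simp: holomorphic_vec_on_def)
  have axis: "L (axis j 1) = pd f j z" for j
  proof -
    have "((\<lambda>\<zeta>::complex. z + \<zeta> *s axis j 1) has_derivative (\<lambda>\<zeta>. \<zeta> *s axis j 1)) (at 0)"
    proof -
      have "((\<lambda>\<zeta>::complex. z + \<zeta> *s axis j 1) has_derivative (\<lambda>\<zeta>. \<chi> i. \<zeta> * axis j 1 $ i)) (at 0)"
        by (rule has_derivative_vec) (auto intro!: derivative_eq_intros)
      then show ?thesis by (simp add: vector_scalar_mult_def)
    qed
    moreover have "(f has_derivative L) (at (z + 0 *s axis j 1))" using L by simp
    ultimately have "((\<lambda>\<zeta>. f (z + \<zeta> *s axis j 1)) has_derivative (\<lambda>\<zeta>. L (\<zeta> *s axis j 1))) (at 0)"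
      using has_derivative_compose[of "\<lambda>\<zeta>::complex. z + \<zeta> *s axis j 1" _ 0 UNIV f L] by simp
    then have "((\<lambda>\<zeta>. f (z + \<zeta> *s axis j 1)) has_field_derivative L (axis j 1)) (at 0)"
      by (simp add: has_field_derivative_def L mult_commute_abs)
    then show ?thesis by (simp add: pd_def DERIV_imp_deriv)
  qed
  have "L v = (\<Sum>j\<in>UNIV. v $ j * pd f j z)" for v
  proof -
    have "v = (\<Sum>j\<in>UNIV. v $ j *s axis j 1)" by (simp add: basis_expansion)
    then have "L v = (\<Sum>j\<in>UNIV. L (v $ j *s axis j 1))"
      using linear_sum[OF has_derivative_linear[OF L(1)]] by metis
    then show ?thesis by (simp add: L axis)
  qed
  then show ?thesis using L(1) by presburger
qed

text \<open>Holomorphy only provides a derivative at each point, so continuity of the partials comes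
  from Cauchy's inequality: on discs of radius \<open>r\<close> along the j-th axis through nearby
  points \<open>w\<close> and \<open>z\<close> the values of \<open>f\<close> differ by less than
  \<open>e * r / 2\<close>, so the derivatives at the centres differ by at most
  \<open>e / 2\<close>.\<close>

lemma continuous_on_pd:
  fixes f :: "complex^'n \<Rightarrow> complex"
  assumes f: "holomorphic_vec_on f U" and U: "open U"
  shows "continuous_on U (pd f j)"
  unfolding continuous_on_iff
proof (intro ballI allI impI)
  fix z e assume z: "z \<in> U" and e: "e > (0::real)"
  obtain r0 where r0: "r0 > 0" "cball z r0 \<subseteq> U" using U z open_contains_cball by blast
  define r where "r = r0 / 2"
  have r: "r > 0" using r0 by (simp add: r_def)
  have "uniformly_continuous_on (cball z r0) f"
    by (rule compact_uniformly_continuous)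
       (use holomorphic_vec_on_imp_continuous_on[OF f] r0 continuous_on_subset in auto)
  then obtain d where d: "d > 0" "\<And>x y. x \<in> cball z r0 \<Longrightarrow> y \<in> cball z r0 \<Longrightarrow> dist x y < d \<Longrightarrow> dist (f x) (f y) < e * r / 2"
    using e r unfolding uniformly_continuous_on_def by (metis half_gt_zero mult_pos_pos)
  show "\<exists>d>0. \<forall>w\<in>U. dist w z < d \<longrightarrow> dist (pd f j w) (pd f j z) < e"
  proof (intro exI[of _ "min d r"] conjI ballI impI)
    show "0 < min d r" using d r by simp
    fix w assume w: "dist w z < min d r"
    have in_ball: "w + \<zeta> *s axis j 1 \<in> cball z r0" "z + \<zeta> *s axis j 1 \<in> cball z r0" if "norm \<zeta> \<le> r" for \<zeta>
    proof -
      have "norm (w + \<zeta> *s axis j 1 - z) \<le> norm (w - z) + norm (\<zeta> *s axis j (1::complex))"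
        using norm_triangle_ineq[of "w - z" "\<zeta> *s axis j 1"] by (simp add: algebra_simps)
      also have "\<dots> \<le> r + r" using w that by (intro add_mono) (auto simp: dist_norm norm_smult_vec)
      finally show "w + \<zeta> *s axis j 1 \<in> cball z r0" by (simp add: dist_norm norm_minus_commute r_def)
      show "z + \<zeta> *s axis j 1 \<in> cball z r0" using that r by (simp add: dist_norm norm_smult_vec r_def)
    qed
    let ?k = "\<lambda>\<zeta>. f (w + \<zeta> *s axis j 1) - f (z + \<zeta> *s axis j 1)"
    have der: "(?k has_field_derivative (pd f j (w + \<zeta> *s axis j 1) - pd f j (z + \<zeta> *s axis j 1))) (at \<zeta>)"
      if "norm \<zeta> \<le> r" for \<zeta>
      using in_ball[OF that] r0 by (intro DERIV_diff pd_has_field_derivative[OF f U]) auto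
    have "norm ((deriv ^^ 1) ?k 0) \<le> fact 1 * (e * r / 2) / r ^ 1"
    proof (rule Cauchy_inequality)
      show "?k holomorphic_on ball 0 r"
      proof (subst holomorphic_on_open[OF open_ball], intro ballI exI)
        fix \<zeta> :: complex assume "\<zeta> \<in> ball 0 r"
        then show "(?k has_field_derivative (pd f j (w + \<zeta> *s axis j 1) - pd f j (z + \<zeta> *s axis j 1))) (at \<zeta>)"
          by (intro der) simp
      qed
      show "continuous_on (cball 0 r) ?k"
      proof (intro continuous_at_imp_continuous_on ballI)
        fix \<zeta> :: complex assume "\<zeta> \<in> cball 0 r"
        then show "isCont ?k \<zeta>" by (intro DERIV_isCont[OF der]) simp
      qed
      show "r > 0" by fact
      fix \<zeta> :: complex assume "norm (0 - \<zeta>) = r"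
      then have "dist (f (w + \<zeta> *s axis j 1)) (f (z + \<zeta> *s axis j 1)) < e * r / 2"
        using in_ball[of \<zeta>] w by (intro d) (auto simp: dist_norm)
      then show "norm (?k \<zeta>) \<le> e * r / 2" by (simp add: dist_norm)
    qed
    moreover have "deriv ?k 0 = pd f j w - pd f j z"
      using DERIV_imp_deriv[OF der[of 0]] r by simp
    ultimately have "norm (pd f j w - pd f j z) \<le> e / 2" using r by (simp add: field_simps)
    then show "dist (pd f j w) (pd f j z) < e" using e by (simp add: dist_norm)
  qed
qed

text \<open>Along the line, the partial derivative is a locally uniform limit of difference
  quotients in the j-th direction, each of which is holomorphic in \<open>s\<close>.\<close>

lemma pd_holomorphic_on_line:
  fixes f :: "complex^'n \<Rightarrow> complex"
  assumes f: "holomorphic_vec_on f U" and U: "open U" and T: "open T"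
    and TU: "\<And>s. s \<in> T \<Longrightarrow> z + s *s u \<in> U"
  shows "(\<lambda>s. pd f j (z + s *s u)) holomorphic_on T"
proof -
  have "\<exists>r>0. (\<lambda>s. pd f j (z + s *s u)) holomorphic_on ball s0 r" if s0: "s0 \<in> T" for s0
  proof -
    obtain r0 where r0: "r0 > 0" "cball (z + s0 *s u) r0 \<subseteq> U"
      using U TU[OF s0] open_contains_cball by blast
    \<comment> \<open>Half of the radius \<open>r0\<close> is reserved for moving \<open>s\<close>,
      the other half for the shift along the j-th axis.\<close>
    define r where "r = r0 / (2 * (norm u + 1))"
    have nu: "norm u + 1 > 0" by (smt (verit) norm_ge_zero)
    have r: "r > 0" using r0 nu by (simp add: r_def)
    have in_ball: "z + s *s u + h *s axis j 1 \<in> cball (z + s0 *s u) r0"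
      if "s \<in> ball s0 r" "norm h \<le> r0 / 2" for s h
    proof -
      have "norm (z + s *s u + h *s axis j 1 - (z + s0 *s u)) = norm ((s - s0) *s u + h *s axis j 1)"
        by (simp add: vector_sub_rdistrib algebra_simps)
      also have "\<dots> \<le> norm (s - s0) * norm u + norm h"
        by (rule norm_triangle_le) (simp add: norm_smult_vec del: vector_sub_rdistrib)
      also have "\<dots> \<le> r * (norm u + 1) + r0 / 2"
        using that r by (intro add_mono mult_mono) (auto simp: dist_norm norm_minus_commute)
      also have "r * (norm u + 1) = r0 / 2"
      proof -
        have "r0 / (2 * k) * k = r0 / 2" if "k > 0" for k :: real using that by simp
        then show ?thesis using nu unfolding r_def by blast
      qed
      finally show ?thesis by (metis dist_commute dist_norm field_sum_of_halves mem_cball)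
    qed
    \<comment> \<open>The index shift by \<open>N\<close> makes every increment \<open>h n\<close>,
      including \<open>h 0\<close>, nonzero and at most \<open>r0 / 2\<close>.\<close>
    obtain N where N: "N > 0" "1 / real N < r0 / 2"
      using r0 by (metis half_gt_zero nat_approx_posE zero_less_Suc)
    define h where "h n = complex_of_real (1 / (real n + real N))" for n
    have h: "h n \<noteq> 0" "norm (h n) \<le> 1 / real N" for n
      using N by (auto simp: h_def norm_divide frac_le simp del: of_real_divide of_real_add)
    then have h2: "norm (h n) \<le> r0 / 2" for n using N by (meson less_imp_le order_trans)
    have hlim: "\<exists>n0. \<forall>n\<ge>n0. norm (h n) < d" if dpos: "d > 0" for d
    proof -
      obtain n0 where "n0 > 0" "1 / real n0 < d" using dpos by (metis nat_approx_posE zero_less_Suc)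
      then have "1 / (real n + real N) < d" if "n \<ge> n0" for n
        using that N frac_le[of 1 1 "real n0" "real n + real N"] by simp
      then show ?thesis using N by (auto simp: h_def simp del: of_real_divide of_real_add)
    qed
    let ?q = "\<lambda>n s. (f (z + s *s u + h n *s axis j 1) - f (z + s *s u)) / h n"
    let ?g = "\<lambda>s. pd f j (z + s *s u)"
    have hol: "?q n holomorphic_on ball s0 r" for n
    proof -
      have "(\<lambda>s. f ((z + h n *s axis j 1) + s *s u)) holomorphic_on ball s0 r"
        using in_ball[OF _ h2] r0 by (intro holomorphic_on_line[OF f]) (auto simp: add_ac)
      moreover have "(\<lambda>s. f (z + s *s u)) holomorphic_on ball s0 r"
        using in_ball[of _ 0] r0 by (intro holomorphic_on_line[OF f]) auto
      ultimately show ?thesis by (intro holomorphic_intros) (auto simp: add_ac h)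
    qed
    have "uniformly_continuous_on (cball (z + s0 *s u) r0) (pd f j)"
      by (rule compact_uniformly_continuous[OF continuous_on_subset[OF continuous_on_pd[OF f U] r0(2)]]) simp
    have "uniform_limit (ball s0 r) ?q ?g sequentially"
      unfolding uniform_limit_sequentially_iff
    proof (intro allI impI)
      fix e :: real assume e: "e > 0"
      obtain d where d: "d > 0" "\<And>x y. x \<in> cball (z + s0 *s u) r0 \<Longrightarrow> y \<in> cball (z + s0 *s u) r0 \<Longrightarrow>
           dist x y < d \<Longrightarrow> dist (pd f j x) (pd f j y) < e / 2"
        using \<open>uniformly_continuous_on _ _\<close> e unfolding uniformly_continuous_on_def by (metis half_gt_zero)
      obtain n0 where n0: "\<And>n. n \<ge> n0 \<Longrightarrow> norm (h n) < d" using hlim[OF d(1)] by blast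
      have "dist (?q n s) (?g s) < e" if n: "n \<ge> n0" and s: "s \<in> ball s0 r" for n s
      proof -
        \<comment> \<open>Subtracting the linear term leaves a function whose derivative is a
          difference of two nearby values of \<open>pd f j\<close>, at most \<open>e / 2\<close> in
          norm. The mean value inequality then bounds the error of the difference quotient,
          uniformly in \<open>s\<close>.\<close>
        let ?k = "\<lambda>\<zeta>. f (z + s *s u + \<zeta> *s axis j 1) - \<zeta> * ?g s"
        have "norm (?k (h n) - ?k 0) \<le> (e / 2) * norm (h n - 0)"
        proof (rule field_differentiable_bound[of "cball 0 (norm (h n))"])
          fix \<zeta> :: complex assume "\<zeta> \<in> cball 0 (norm (h n))"
          then have \<zeta>: "norm \<zeta> \<le> norm (h n)" by simp
          then have inb: "z + s *s u + \<zeta> *s axis j 1 \<in> cball (z + s0 *s u) r0"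
            using in_ball[OF s] h2[of n] by simp
          then have "(?k has_field_derivative (pd f j (z + s *s u + \<zeta> *s axis j 1) - ?g s)) (at \<zeta>)"
            using r0 by (auto intro!: derivative_eq_intros pd_has_field_derivative[OF f U])
          then show "(?k has_field_derivative (pd f j (z + s *s u + \<zeta> *s axis j 1) - ?g s)) (at \<zeta> within cball 0 (norm (h n)))"
            by (rule has_field_derivative_at_within)
          have "dist (pd f j (z + s *s u + \<zeta> *s axis j 1)) (?g s) < e / 2"
            using in_ball[OF s, of 0] r0 \<zeta> n0[OF n] by (intro d inb) (auto simp: dist_norm norm_smult_vec)
          then show "norm (pd f j (z + s *s u + \<zeta> *s axis j 1) - ?g s) \<le> e / 2"
            by (simp add: dist_norm)
        qed auto
        then have "norm (f (z + s *s u + h n *s axis j 1) - f (z + s *s u) - h n * ?g s) \<le> (e / 2) * norm (h n)"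
          by (simp add: algebra_simps)
        moreover have "f (z + s *s u + h n *s axis j 1) - f (z + s *s u) - h n * ?g s = h n * (?q n s - ?g s)"
          using h(1) by (simp add: field_simps)
        ultimately have "norm (?q n s - ?g s) \<le> e / 2"
          using h(1)[of n] by (simp add: norm_mult mult.commute)
        then show ?thesis using e by (simp add: dist_norm)
      qed
      then show "\<exists>n0. \<forall>n\<ge>n0. \<forall>s\<in>ball s0 r. dist (?q n s) (?g s) < e" by blast
    qed
    then have "?g holomorphic_on ball s0 r"
    proof (intro holomorphic_uniform_sequence[OF open_ball hol])
      fix x assume "x \<in> ball s0 r"
      then obtain d where "d > 0" "cball x d \<subseteq> ball s0 r"
        by (meson open_ball open_contains_cball)
      then show "\<exists>d>0. cball x d \<subseteq> ball s0 r \<and> uniform_limit (cball x d) ?q ?g sequentially"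
        using uniform_limit_on_subset[OF \<open>uniform_limit (ball s0 r) ?q ?g sequentially\<close>] by blast
    qed
    then show ?thesis using r by blast
  qed
  then have "\<exists>f'. ((\<lambda>s. pd f j (z + s *s u)) has_field_derivative f') (at s)" if "s \<in> T" for s
    using that by (metis centre_in_ball holomorphic_derivI open_ball)
  then show ?thesis using T by (simp add: holomorphic_on_open)
qed

text \<open>A Hartogs-type argument in one variable: for \<open>t \<noteq> 0\<close> the function
  \<open>g s t\<close> has no zero on the closed \<open>s\<close>-disc, so its inverse at the centre
  is bounded by its maximum on the circle. This bound is uniform in \<open>t\<close> by compactness,
  and letting \<open>t\<close> tend to 0 contradicts a zero at the origin.\<close>

lemma no_isolated_zero_two_variables:
  fixes g :: "complex \<Rightarrow> complex \<Rightarrow> complex"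
  assumes r: "r > 0" and cont: "continuous_on (cball 0 r \<times> cball 0 r) (\<lambda>(s, t). g s t)"
    and hol: "\<And>t. t \<in> cball 0 r \<Longrightarrow> (\<lambda>s. g s t) holomorphic_on ball 0 r"
    and nz: "\<And>s t. s \<in> cball 0 r \<Longrightarrow> t \<in> cball 0 r \<Longrightarrow> (s, t) \<noteq> (0, 0) \<Longrightarrow> g s t \<noteq> 0"
  shows "g 0 0 \<noteq> 0"
proof
  assume g00: "g 0 0 = 0"
  let ?K = "sphere 0 r \<times> cball 0 r :: (complex \<times> complex) set"
  have contK: "continuous_on ?K (\<lambda>(s, t). norm (g s t))"
  proof -
    have "continuous_on ?K (\<lambda>x. norm ((\<lambda>(s, t). g s t) x))"
      by (rule continuous_on_norm[OF continuous_on_subset[OF cont]]) auto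
    then show ?thesis by (simp add: case_prod_unfold)
  qed
  have "?K \<noteq> {}" using r by auto
  then obtain k where k: "k \<in> ?K" "\<And>y. y \<in> ?K \<Longrightarrow> (\<lambda>(s, t). norm (g s t)) k \<le> (\<lambda>(s, t). norm (g s t)) y"
    using continuous_attains_inf[OF _ _ contK] compact_Times compact_sphere compact_cball by metis
  define \<mu> where "\<mu> = (\<lambda>(s, t). norm (g s t)) k"
  have \<mu>: "\<mu> > 0" using k(1) nz r by (auto simp: \<mu>_def)
  have bound: "\<mu> \<le> norm (g s t)" if "norm s = r" "t \<in> cball 0 r" for s t
    using k(2)[of "(s, t)"] that by (auto simp: \<mu>_def)
  have lower: "\<mu> \<le> norm (g 0 t)" if t: "t \<in> cball 0 r" "t \<noteq> 0" for t
  proof -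
    \<comment> \<open>Cauchy's inequality for the derivative of order 0 serves as the maximum
      principle.\<close>
    have "norm ((deriv ^^ 0) (\<lambda>s. inverse (g s t)) 0) \<le> fact 0 * (inverse \<mu>) / r ^ 0"
    proof (rule Cauchy_inequality)
      show "(\<lambda>s. inverse (g s t)) holomorphic_on ball 0 r"
        using nz t by (intro holomorphic_on_inverse hol) auto
      have "continuous_on (cball 0 r) (\<lambda>s. g s t)"
        by (rule continuous_on_compose2[OF cont, of _ "\<lambda>s. (s, t)", simplified]) (use t in \<open>auto intro!: continuous_intros\<close>)
      then show "continuous_on (cball 0 r) (\<lambda>s. inverse (g s t))"
        using nz t by (intro continuous_on_inverse) auto
      fix s :: complex assume "norm (0 - s) = r"
      then show "norm (inverse (g s t)) \<le> inverse \<mu>"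
        using bound[of s t] t \<mu> by (simp add: norm_inverse le_imp_inverse_le)
    qed fact
    then have "inverse (norm (g 0 t)) \<le> inverse \<mu>" by (simp add: norm_inverse)
    then show ?thesis using \<mu> nz[of 0 t] t r by (simp add: inverse_le_iff_le)
  qed
  have "continuous_on (cball 0 r) (\<lambda>t. g 0 t)"
    by (rule continuous_on_compose2[OF cont, of _ "\<lambda>t. (0, t)", simplified]) (use r in \<open>auto intro!: continuous_intros\<close>)
  then obtain d where d: "d > 0" "\<And>t. t \<in> cball 0 r \<Longrightarrow> dist t 0 < d \<Longrightarrow> dist (g 0 t) (g 0 0) < \<mu>"
    using \<mu> r unfolding continuous_on_iff by (metis centre_in_cball less_imp_le)
  define t where "t = complex_of_real (min (d / 2) r)"
  have "t \<noteq> 0" "norm t < d" "norm t \<le> r" using d(1) r by (auto simp: t_def min_def)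
  then show False using lower[of t] d(2)[of t] g00 by simp
qed

section \<open>Jacobian determinants\<close>

definition jac :: "(complex^'n \<Rightarrow> complex^'n) \<Rightarrow> complex^'n \<Rightarrow> complex^'n^'n" where
  "jac F z = (\<chi> i j. pd (\<lambda>z. F z $ i) j z)"

lemma has_derivative_jac:
  assumes "\<And>i. holomorphic_vec_on (\<lambda>z. F z $ i) U" "open U" "z \<in> U"
  shows "(F has_derivative (*v) (jac F z)) (at z)"
proof -
  have "(F has_derivative (\<lambda>v. \<chi> i. \<Sum>j\<in>UNIV. v $ j * pd (\<lambda>z. F z $ i) j z)) (at z)"
    by (rule has_derivative_vec) (rule has_derivative_pd[OF assms])
  also have "(\<lambda>v. \<chi> i. \<Sum>j\<in>UNIV. v $ j * pd (\<lambda>z. F z $ i) j z) = (*v) (jac F z)"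
    by (simp add: fun_eq_iff jac_def matrix_vector_mult_def mult.commute)
  finally show ?thesis .
qed

lemma det_nz_iff_kernel: "det (M :: complex^'n^'n) \<noteq> 0 \<longleftrightarrow> (\<forall>v. M *v v = 0 \<longrightarrow> v = 0)"
  using invertible_det_nz[of M] invertible_left_inverse[of M] matrix_left_invertible_ker[of M] by blast

text \<open>Differentiating \<open>k (F z) = z\<close> exhibits a left inverse of the Jacobian
  matrix, so its kernel is trivial.\<close>

lemma det_jac_nonzero:
  assumes F: "\<And>i. holomorphic_vec_on (\<lambda>z. F z $ i) U" "open U" "w \<in> U"
    and k: "\<And>i. holomorphic_vec_on (\<lambda>z. k z $ i) V" "open V" "F w \<in> V"
    and N: "open N" "w \<in> N" "\<And>z. z \<in> N \<Longrightarrow> k (F z) = z"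
  shows "det (jac F w) \<noteq> 0"
proof -
  have "((\<lambda>z. k (F z)) has_derivative (\<lambda>v. jac k (F w) *v (jac F w *v v))) (at w)"
    by (rule has_derivative_compose[OF has_derivative_jac[OF F] has_derivative_jac[OF k]])
  then have "((\<lambda>z. z) has_derivative (\<lambda>v. jac k (F w) *v (jac F w *v v))) (at w)"
    by (rule has_derivative_transform_within_open[OF _ N(1,2)]) (use N(3) in auto)
  then have "(\<lambda>v. jac k (F w) *v (jac F w *v v)) = (\<lambda>v. v)"
    using has_derivative_unique has_derivative_ident by blast
  then show ?thesis unfolding det_nz_iff_kernel by (metis matrix_vector_mult_0_right)
qed

lemma small_bidisc:
  fixes p u v :: "complex^'n"
  assumes "r > 0"
  shows "\<exists>\<rho>>0. \<forall>s\<in>cball 0 \<rho>. \<forall>t\<in>cball 0 \<rho>. dist p (p + s *s u + t *s v) < r"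
proof -
  have nuv: "norm u + norm v + 1 > 0" by (smt (verit) norm_ge_zero)
  define \<rho> where "\<rho> = r / (norm u + norm v + 1)"
  have \<rho>: "\<rho> > 0" "\<rho> * (norm u + norm v + 1) = r" using assms nuv by (simp_all add: \<rho>_def)
  have "dist p (p + s *s u + t *s v) < r" if "s \<in> cball 0 \<rho>" "t \<in> cball 0 \<rho>" for s t
  proof -
    have "norm (s *s u + t *s v) \<le> norm s * norm u + norm t * norm v"
      by (rule norm_triangle_le) (simp add: norm_smult_vec)
    also have "\<dots> \<le> \<rho> * norm u + \<rho> * norm v"
      using that by (intro add_mono mult_right_mono) auto
    also have "\<dots> < \<rho> * (norm u + norm v + 1)" using \<rho>(1) by (simp add: distrib_left)
    also have "\<dots> = r" by (rule \<rho>)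
    finally show ?thesis by (simp add: dist_norm norm_minus_commute algebra_simps)
  qed
  then show ?thesis using \<rho>(1) by blast
qed

text \<open>The determinant is a polynomial in the partial derivatives, hence jointly continuous on
  the bidisc spanned by \<open>u\<close> and \<open>v\<close> and holomorphic in \<open>s\<close>;
  \<open>no_isolated_zero_two_variables\<close> then applies.\<close>

lemma det_jac_nonzero_of_nonzero_around:
  fixes F :: "complex^'n \<Rightarrow> complex^'n"
  assumes F: "\<And>i. holomorphic_vec_on (\<lambda>z. F z $ i) U" "open U" "p \<in> U"
    and r: "r > 0"
    and nz: "\<And>s t. s \<in> cball 0 r \<Longrightarrow> t \<in> cball 0 r \<Longrightarrow> (s, t) \<noteq> (0, 0) \<Longrightarrow>
               p + s *s u + t *s v \<in> U \<Longrightarrow> det (jac F (p + s *s u + t *s v)) \<noteq> 0"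
  shows "det (jac F p) \<noteq> 0"
proof -
  obtain r0 where r0: "r0 > 0" "cball p r0 \<subseteq> U" using F open_contains_cball by blast
  obtain \<rho>0 where \<rho>0: "\<rho>0 > 0" "\<forall>s\<in>cball 0 \<rho>0. \<forall>t\<in>cball 0 \<rho>0. dist p (p + s *s u + t *s v) < r0"
    using small_bidisc[OF r0(1)] by blast
  define \<rho> where "\<rho> = min r \<rho>0"
  have \<rho>: "\<rho> > 0" using r \<rho>0 by (simp add: \<rho>_def)
  have in_U: "p + s *s u + t *s v \<in> U" if "s \<in> cball 0 \<rho>" "t \<in> cball 0 \<rho>" for s t
  proof -
    have "dist p (p + s *s u + t *s v) < r0" using \<rho>0(2) that by (simp add: \<rho>_def)
    then show ?thesis using r0(2) by auto
  qed
  have "det (jac F (p + 0 *s u + 0 *s v)) \<noteq> 0"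
  proof (rule no_isolated_zero_two_variables[OF \<rho>, where g = "\<lambda>s t. det (jac F (p + s *s u + t *s v))"])
    have "continuous_on (cball 0 \<rho> \<times> cball 0 \<rho>) (\<lambda>x. pd (\<lambda>z. F z $ i) j (p + fst x *s u + snd x *s v))" for i j
      by (rule continuous_on_compose2[OF continuous_on_pd[OF F(1,2)]])
         (use in_U in \<open>auto intro!: continuous_intros\<close>)
    then show "continuous_on (cball 0 \<rho> \<times> cball 0 \<rho>) (\<lambda>(s, t). det (jac F (p + s *s u + t *s v)))"
      by (auto simp: det_def jac_def case_prod_unfold intro!: continuous_intros)
    fix t :: complex assume t: "t \<in> cball 0 \<rho>"
    have "(\<lambda>s. pd (\<lambda>z. F z $ i) j (p + t *s v + s *s u)) holomorphic_on ball 0 \<rho>" for i j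
      using in_U[OF _ t] by (intro pd_holomorphic_on_line[OF F(1,2)]) (auto simp: add_ac)
    then show "(\<lambda>s. det (jac F (p + s *s u + t *s v))) holomorphic_on ball 0 \<rho>"
      by (auto simp: det_def jac_def add_ac intro!: holomorphic_intros)
  next
    fix s t :: complex assume "s \<in> cball 0 \<rho>" "t \<in> cball 0 \<rho>" "(s, t) \<noteq> (0, 0)"
    then show "det (jac F (p + s *s u + t *s v)) \<noteq> 0"
      using in_U by (intro nz) (auto simp: \<rho>_def)
  qed
  then show ?thesis by simp
qed

section \<open>Freeness of the action\<close>

lemma negligible_complex_subspace:
  fixes S :: "(complex^'n) set"
  assumes "vec.subspace S" "S \<noteq> UNIV"
  shows "negligible S"
proof (rule negligible_lowdim)
  have "c *\<^sub>R x = complex_of_real c *s x" for c and x :: "complex^'n"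
    by (simp add: vec_eq_iff) (simp add: scaleR_conv_of_real)
  then have "subspace S"
    using assms(1) by (simp add: subspace_def vec.subspace_def)
  then have "span S \<noteq> UNIV" using assms(2) by (metis span_eq_iff)
  then have "dim S \<noteq> DIM(complex^'n)" using dim_eq_full by blast
  then show "dim S < DIM(complex^'n)" using dim_subset_UNIV[of S] by linarith
qed

text \<open>Proper subspaces are null sets, and finitely many null sets do not cover the space. This
  supplies directions in general position.\<close>

lemma avoid_complex_subspaces:
  fixes K :: "(complex^'n) set set"
  assumes "finite K" "\<And>S. S \<in> K \<Longrightarrow> vec.subspace S \<and> S \<noteq> UNIV"
  shows "\<exists>v. \<forall>S\<in>K. v \<notin> S"
proof -
  have "negligible (\<Union>K)" using assms negligible_complex_subspace by (intro negligible_Union) auto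
  then have "\<Union>K \<noteq> UNIV" using non_negligible_UNIV by metis
  then show ?thesis by blast
qed

lemma subspace_fixed: "vec.subspace {v. A *v v = (v :: complex^'n)}"
  by (simp add: vec.subspace_def matrix_vector_right_distrib vector_scalar_commute)

lemma fixed_UNIV_iff: "{v. A *v v = (v :: complex^'n)} = UNIV \<longleftrightarrow> A = mat 1"
proof
  assume "{v. A *v v = (v :: complex^'n)} = UNIV"
  then have "A *v v = mat 1 *v v" for v by auto
  then show "A = mat 1" by (simp add: matrix_eq)
qed simp

lemma vec_dim_eq_UNIV: "vec.subspace S \<Longrightarrow> vec.dim S = CARD('n) \<Longrightarrow> S = (UNIV :: (complex^'n) set)"
  using vec.subspace_dim_equal[of S UNIV] by (simp add: vec.dim_UNIV vec.dimension_def card_cart_basis)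

lemma vec_dim_le: "vec.dim (S :: (complex^'n) set) \<le> CARD('n)"
  using vec.dim_subset_UNIV[of S] by (simp add: vec.dimension_def card_cart_basis)

text \<open>Full dimension would mean \<open>A = mat 1\<close>, and codimension 1 would make
  \<open>A\<close> a pseudo-reflection.\<close>

lemma codim_fixed:
  fixes A :: "complex^'n^'n"
  assumes "invertible A" "A \<noteq> mat 1" "\<not> pseudo_reflection A"
  shows "vec.dim {v. A *v v = v} + 2 \<le> CARD('n)"
proof -
  have "vec.dim {v. A *v v = v} \<noteq> CARD('n)"
    using vec_dim_eq_UNIV[OF subspace_fixed] fixed_UNIV_iff assms(2) by blast
  moreover have "vec.dim {v. A *v v = v} + 1 \<noteq> CARD('n)"
    using assms by (simp add: pseudo_reflection_def GL_def)
  ultimately show ?thesis using vec_dim_le[of "{v. A *v v = v}"] by linarith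
qed

context finite_linear_group
begin

lemma smooth_point_trivial_stabilizer:
  assumes npr: "\<And>A. A \<in> G \<Longrightarrow> \<not> pseudo_reflection A"
    and smooth: "smooth_point TYPE('n) X (orbit G p)"
    and B: "B \<in> G" "B *v p = p"
  shows "B = mat 1"
proof -
  obtain W :: "(complex^'n) set set" and V :: "(complex^'n) set" and f g where
    W: "openin (top_of X) W" "orbit G p \<in> W" and V: "open V" and
    f: "holomorphic_map (open_subspace X W) (open_subspace affine_cspace V) f" and
    g: "holomorphic_map (open_subspace affine_cspace V) (open_subspace X W) g" and
    gf: "\<forall>x \<in> topspace (top_of (open_subspace X W)). g (f x) = x"
    using smooth unfolding smooth_point_def biholomorphic_def by blast
  have topW: "topspace (top_of (open_subspace X W)) = W"
    using openin_subset[OF W(1)] by (auto simp: open_subspace_def)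
  have topV: "topspace (top_of (open_subspace affine_cspace V)) = V"
    by (simp add: open_subspace_def affine_cspace_def)
  define U where "U = {z. orbit G z \<in> W}"
  have U: "open U" "p \<in> U" using W by (auto simp: U_def openin_quotient_cspace)
  define F where "F z = f (orbit G z)" for z
  have fV: "f x \<in> V" if "x \<in> W" for x
    using f that topW topV unfolding holomorphic_map_def continuous_map_def by blast
  have gW: "g x \<in> W" if "x \<in> V" for x
    using g that topW topV unfolding holomorphic_map_def continuous_map_def by blast
  \<comment> \<open>The coordinate functions are sections over \<open>V\<close>; pulling them back
    along the chart gives sections over \<open>W\<close>, that is, invariant holomorphic functions
    on \<open>U\<close>.\<close>
  have holF: "holomorphic_vec_on (\<lambda>z. F z $ i) U" for i
  proof -
    have "holomorphic_vec_on (\<lambda>z::complex^'n. z $ i) V"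
      unfolding holomorphic_vec_on_def
      by (intro ballI exI[of _ "\<lambda>z. z $ i"])
         (auto intro!: bounded_linear_imp_has_derivative bounded_linear_vec_nth)
    moreover have "(\<lambda>x. \<phi> (f x)) \<in> sections (open_subspace X W)
        {x \<in> topspace (top_of (open_subspace X W)). f x \<in> V}"
      if "\<phi> \<in> sections (open_subspace affine_cspace V) V" for \<phi>
      using f that V unfolding holomorphic_map_def
      by (simp add: open_subspace_def affine_cspace_def openin_open_eq)
    ultimately have "(\<lambda>x. f x $ i) \<in> sections (open_subspace X W)
        {x \<in> topspace (top_of (open_subspace X W)). f x \<in> V}"
      by (simp add: open_subspace_def affine_cspace_def)
    moreover have "{x \<in> topspace (top_of (open_subspace X W)). f x \<in> V} = W"
      using topW fV by auto
    ultimately have "(\<lambda>x. f x $ i) \<in> sections (open_subspace X W) W" by (simp only:)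
    then show ?thesis
      by (simp add: open_subspace_def quotient_cspace_def U_def F_def)
  qed
  \<comment> \<open>At a point with trivial stabilizer the orbit map is locally invertible, so
    \<open>lsec N\<close> after the inverse chart \<open>g\<close> is a holomorphic left inverse of
    \<open>F\<close>.\<close>
  have nz: "det (jac F w) \<noteq> 0" if w: "w \<in> U" and stab: "\<And>A. A \<in> G \<Longrightarrow> A *v w = w \<Longrightarrow> A = mat 1" for w
  proof -
    obtain \<delta> where \<delta>: "\<delta> > 0" "evenly (ball w \<delta>)"
      using trivial_stabilizer_ball stab by blast
    define N where "N = ball w \<delta> \<inter> U"
    have N: "evenly N" "w \<in> N" "open N" "N \<subseteq> U"
      using \<delta> w U unfolding N_def evenly_def by auto
    have ope: "openin (top_of (open_subspace X W)) (orbit G ` N)"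
      using openin_orbit_image[OF N(3)] N(4) by (auto simp: open_subspace_def openin_subtopology U_def)
    let ?S = "{v \<in> topspace (top_of (open_subspace affine_cspace V)). g v \<in> orbit G ` N}"
    show ?thesis
    proof (rule det_jac_nonzero[OF holF U(1) w])
      show "holomorphic_vec_on (\<lambda>v. lsec N (g v) $ i) ?S" for i
        using g lsec_sections[OF N(1), of i] ope unfolding holomorphic_map_def
        by (auto simp: open_subspace_def affine_cspace_def)
      have "openin (top_of (open_subspace affine_cspace V)) ?S"
        by (rule openin_continuous_map_preimage[OF _ ope]) (use g in \<open>simp add: holomorphic_map_def\<close>)
      then show "open ?S" using V by (auto simp: open_subspace_def affine_cspace_def openin_open_eq)
      have gF: "g (F z) = orbit G z" if "z \<in> U" for z
        using gf that topW by (simp add: F_def U_def)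
      then show "F w \<in> ?S" using topV fV w N by (auto simp: F_def U_def)
      show "lsec N (g (F z)) = z" if "z \<in> N" for z
        using gF[of z] that N lsec_orbit by auto
    qed (use N in auto)
  qed
  \<comment> \<open>Codimension at least 2 leaves room for two choices: \<open>u\<close> outside
    every fixed space and \<open>v\<close> outside every span of \<open>u\<close> and a fixed space,
    which is still proper. The plane spanned by \<open>u\<close> and \<open>v\<close> then meets
    each fixed space only in 0.\<close>
  define K where "K = (\<lambda>A. {v. A *v v = v}) ` (G - {mat 1})"
  have Kfin: "finite K" using finite by (simp add: K_def)
  have Kdim: "vec.subspace S" "vec.dim S + 2 \<le> CARD('n)" if "S \<in> K" for S
    using that npr codim_fixed invertible_mem by (auto simp: K_def subspace_fixed)
  have proper: "S \<noteq> UNIV" if "vec.dim S < CARD('n)" for S :: "(complex^'n) set"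
    using that by (auto simp: vec.dim_UNIV vec.dimension_def card_cart_basis)
  have "vec.subspace S \<and> S \<noteq> UNIV" if "S \<in> K" for S
    using Kdim[OF that] proper by simp
  then obtain u where u: "u \<notin> S" if "S \<in> K" for S
    using avoid_complex_subspaces[OF Kfin] by blast
  have "vec.dim (vec.span (insert u S)) < CARD('n)" if "S \<in> K" for S
    using Kdim(2)[OF that] vec.dim_insert[of u S] by (auto split: if_splits)
  then have "vec.subspace S \<and> S \<noteq> UNIV" if "S \<in> (\<lambda>S. vec.span (insert u S)) ` K" for S
    using that proper by auto
  then obtain v where v: "v \<notin> vec.span (insert u S)" if "S \<in> K" for S
    using avoid_complex_subspaces[OF finite_imageI[OF Kfin], of "\<lambda>S. vec.span (insert u S)"] by blast
  have uv: "s = 0 \<and> t = 0" if S: "S \<in> K" and st: "s *s u + t *s v \<in> S" for S s t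
  proof -
    have t: "t = 0"
    proof (rule ccontr)
      assume "t \<noteq> 0"
      have "s *s u + t *s v \<in> vec.span (insert u S)" "s *s u \<in> vec.span (insert u S)"
        using st by (auto intro: vec.span_base vec.span_scale)
      then have "t *s v \<in> vec.span (insert u S)" using vec.span_diff by force
      then have "inverse t *s (t *s v) \<in> vec.span (insert u S)" by (rule vec.span_scale)
      then show False using v[OF S] \<open>t \<noteq> 0\<close> by simp
    qed
    moreover have "s = 0"
    proof (rule ccontr)
      assume "s \<noteq> 0"
      have "s *s u \<in> S" using st t by simp
      then have "inverse s *s (s *s u) \<in> S" by (rule vec.subspace_scale[OF Kdim(1)[OF S]])
      then show False using u[OF S] \<open>s \<noteq> 0\<close> by simp
    qed
    ultimately show ?thesis by simp
  qed
  \<comment> \<open>Moving a point is an open condition and \<open>G\<close> is finite, so elements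
    that move \<open>p\<close> also move all points of a small bidisc around it. Near
    \<open>p\<close> only the stabilizer of \<open>p\<close> can fix anything.\<close>
  obtain r where r: "r > 0" "\<And>s t A. s \<in> cball 0 r \<Longrightarrow> t \<in> cball 0 r \<Longrightarrow> A \<in> G \<Longrightarrow> A *v p \<noteq> p \<Longrightarrow>
      A *v (p + s *s u + t *s v) \<noteq> p + s *s u + t *s v"
  proof -
    let ?K = "{A \<in> G. A *v p \<noteq> p}"
    let ?O = "\<Inter>A\<in>?K. {z. A *v z \<noteq> z}"
    have "open ?O" using finite
      by (intro open_INT ballI) (auto intro!: open_Collect_neq continuous_intros)
    moreover have "p \<in> ?O" by auto
    ultimately obtain r0 where r0: "r0 > 0" "ball p r0 \<subseteq> ?O" using openE by blast
    obtain \<rho> where "\<rho> > 0" "\<forall>s\<in>cball 0 \<rho>. \<forall>t\<in>cball 0 \<rho>. dist p (p + s *s u + t *s v) < r0"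
      using small_bidisc[OF r0(1)] by blast
    moreover from this have "p + s *s u + t *s v \<in> ?O" if "s \<in> cball 0 \<rho>" "t \<in> cball 0 \<rho>" for s t
      using r0(2) that by (meson mem_ball subsetD)
    ultimately show ?thesis using that[of \<rho>] by blast
  qed
  have "det (jac F p) \<noteq> 0"
  proof (rule det_jac_nonzero_of_nonzero_around[OF holF U r(1)])
    fix s t assume st: "s \<in> cball 0 r" "t \<in> cball 0 r" "(s, t) \<noteq> (0, 0)" "p + s *s u + t *s v \<in> U"
    show "det (jac F (p + s *s u + t *s v)) \<noteq> 0"
    proof (rule nz[OF st(4)], rule ccontr)
      fix A assume A: "A \<in> G" "A *v (p + s *s u + t *s v) = p + s *s u + t *s v" "A \<noteq> mat 1"
      then have "A *v p = p" using r(2) st by blast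
      \<comment> \<open>As \<open>A\<close> fixes both \<open>p\<close> and the displaced point, it
        fixes the displacement, which lies in the chosen plane.\<close>
      then have "s *s u + t *s v \<in> {v. A *v v = v}"
        using A(2) by (simp add: matrix_vector_right_distrib add.assoc)
      then show False using uv[of "{v. A *v v = v}" s t] A st(3) by (auto simp: K_def)
    qed
  qed
  \<comment> \<open>\<open>F\<close> is invariant under \<open>B\<close> and \<open>B\<close> fixes
    \<open>p\<close>, so differentiating at \<open>p\<close> shows that the Jacobian kills every
    \<open>B *v x - x\<close>.\<close>
  moreover have "jac F p *v (B *v x - x) = 0" for x
  proof -
    have der: "(F has_derivative (*v) (jac F p)) (at p)" by (rule has_derivative_jac[OF holF U])
    have "((\<lambda>z. B *v z) has_derivative (\<lambda>z. B *v z)) (at p)"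
      by (rule bounded_linear_imp_has_derivative) simp
    then have "((\<lambda>z. F (B *v z)) has_derivative (\<lambda>x. jac F p *v (B *v x))) (at p)"
      using has_derivative_compose[of "(*v) B" "(*v) B" p UNIV F "(*v) (jac F p)"] der B(2) by simp
    moreover have "(\<lambda>z. F (B *v z)) = F" using B(1) by (simp add: F_def fun_eq_iff)
    ultimately have "(\<lambda>x. jac F p *v (B *v x)) = (*v) (jac F p)"
      using der has_derivative_unique by metis
    then show ?thesis by (metis matrix_vector_mult_diff_distrib right_minus_eq)
  qed
  ultimately have "B *v x - x = 0" for x using det_nz_iff_kernel by blast
  then have "B *v x = x" for x by simp
  then show ?thesis using fixed_UNIV_iff by blast
qed

text \<open>For the trivial group the orbit map is bijective onto the quotient, and
  \<open>lsec UNIV\<close> is a global chart.\<close>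

lemma smooth_point_trivial_group:
  assumes "G = {mat 1}"
  shows "smooth_point TYPE('n) X (orbit G z)"
proof -
  have ev: "evenly UNIV" unfolding evenly_def using assms by simp
  have lo: "lsec UNIV (orbit G z) = z" for z using lsec_orbit[OF ev] by simp
  have inj: "x = y" if "orbit G x = orbit G y" for x y
  proof -
    have "x = lsec UNIV (orbit G x)" by (rule lo[symmetric])
    also have "\<dots> = y" unfolding that by (rule lo)
    finally show ?thesis .
  qed
  have pre: "{x \<in> range (orbit G). lsec UNIV x \<in> V} = orbit G ` V" for V
    by (force simp: lo)
  have pre2: "{z. orbit G z \<in> orbit G ` V} = V" for V by (auto dest: inj)
  show ?thesis
    unfolding smooth_point_def biholomorphic_def
  proof (intro exI conjI)
    show "openin (top_of X) (range (orbit G))" by (rule openin_orbit_image) simp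
    show "orbit G z \<in> range (orbit G)" by simp
    show "open (UNIV :: (complex^'n) set)" by simp
    show "holomorphic_map (open_subspace X (range (orbit G))) (open_subspace affine_cspace UNIV) (lsec UNIV)"
      unfolding holomorphic_map_def
      by (auto simp: open_subspace_def affine_cspace_def continuous_map_def topspace_quotient_cspace
        pre openin_orbit_image subtopology_topspace[of "top_of X", unfolded topspace_quotient_cspace])
         (simp add: quotient_cspace_def pre2 lo)
    show "holomorphic_map (open_subspace affine_cspace UNIV) (open_subspace X (range (orbit G))) (orbit G)"
      unfolding holomorphic_map_def
      using continuous_map_orbit
      by (auto simp: open_subspace_def affine_cspace_def
         subtopology_topspace[of "top_of X", unfolded topspace_quotient_cspace])
         (simp add: quotient_cspace_def)
    show "\<forall>x\<in>topspace (top_of (open_subspace X (range (orbit G)))). orbit G (lsec UNIV x) = x"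
      by (auto simp: open_subspace_def lo topspace_quotient_cspace)
    show "\<forall>y\<in>topspace (top_of (open_subspace affine_cspace UNIV)). lsec UNIV (orbit G y) = y"
      by (simp add: lo)
  qed
qed

theorem isolated_singularity_imp_free:
  assumes npr: "\<And>A. A \<in> G \<Longrightarrow> \<not> pseudo_reflection A"
    and iso: "isolated_singularity TYPE('n) X (orbit G 0)"
  shows "free_linear_group G" "2 \<le> CARD('n)"
proof -
  obtain U where U: "openin (top_of X) U" "U \<inter> singular_locus TYPE('n) X = {orbit G 0}"
    using iso by (auto simp: isolated_singularity_def)
  show "free_linear_group G"
  proof
    fix A z assume A: "A \<in> G" and z: "z \<noteq> 0" "A *v z = z"
    have "open {z. orbit G z \<in> U}" "0 \<in> {z. orbit G z \<in> U}"
      using U by (auto simp: openin_quotient_cspace)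
    then obtain e where e: "e > 0" "ball 0 e \<subseteq> {z. orbit G z \<in> U}" using openE by blast
    \<comment> \<open>Scaling keeps the point in the fixed space of \<open>A\<close> and off the
      origin while bringing it to norm \<open>e / 2\<close>, inside the region where only the origin
      is singular.\<close>
    define c where "c = complex_of_real (e / (2 * norm z))"
    have c: "c \<noteq> 0" "norm (c *s z) < e" using e z by (auto simp: c_def norm_smult_vec norm_divide norm_mult)
    then have "orbit G (c *s z) \<in> U" using e by auto
    moreover have "orbit G (c *s z) \<noteq> orbit G 0" using c z by (simp add: orbit_eq_orbit_0_iff)
    ultimately have "smooth_point TYPE('n) X (orbit G (c *s z))"
      using U(2) by (auto simp: singular_locus_def topspace_quotient_cspace)
    moreover have "A *v (c *s z) = c *s z" using z by (simp add: vector_scalar_commute)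
    ultimately show "A = mat 1" using smooth_point_trivial_stabilizer[OF npr] A by blast
  qed
  have "\<not> smooth_point TYPE('n) X (orbit G 0)" using U(2) by (auto simp: singular_locus_def)
  then have "G \<noteq> {mat 1}" using smooth_point_trivial_group by blast
  then obtain A where "A \<in> G" "A \<noteq> mat 1" using one_mem by blast
  then show "2 \<le> CARD('n)" using codim_fixed[OF invertible_mem, of A] npr by fastforce
qed

end

section \<open>Homotopy classes of loops in the orbit space\<close>

context finite_linear_group
begin

lemma group_G: "group (GL\<lparr>carrier := G\<rparr>)"
  using subgroup.subgroup_is_group[OF subgroup group_GL] .

text \<open>Written without inverses, so that it matches directly the relation obtained by comparing
  two lifts at both ends.\<close>

definition conjugate :: "complex^'n^'n \<Rightarrow> complex^'n^'n \<Rightarrow> bool" where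
  "conjugate A B \<longleftrightarrow> (\<exists>C\<in>G. C ** A = B ** C)"

lemma conjugate_sym: "conjugate A B \<Longrightarrow> conjugate B A"
proof -
  assume "conjugate A B"
  then obtain C where C: "C \<in> G" "C ** A = B ** C" by (auto simp: conjugate_def)
  obtain D where D: "D \<in> G" "C ** D = mat 1" "D ** C = mat 1" using inverse_mem[OF C(1)] by metis
  have "D ** B = D ** B ** (C ** D)" by (simp add: D matrix_mul_rid)
  also have "\<dots> = D ** (B ** C) ** D" by (simp add: matrix_mul_assoc)
  also have "\<dots> = (D ** C) ** A ** D" by (simp add: C(2)[symmetric] matrix_mul_assoc)
  also have "\<dots> = A ** D" by (simp add: D matrix_mul_lid)
  finally show ?thesis using D by (auto simp: conjugate_def)
qed

lemma conjugate_trans: "conjugate A B \<Longrightarrow> conjugate B C \<Longrightarrow> conjugate A C"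
  unfolding conjugate_def by (metis matrix_mul_assoc mult_mem)

lemma conjugate_refl: "conjugate A A"
  unfolding conjugate_def by (rule bexI[OF _ one_mem]) (simp add: matrix_mul_lid matrix_mul_rid)

lemma conj_classes_G_conjugate: "conj_classes (GL\<lparr>carrier := G\<rparr>) = (\<lambda>A. Collect (conjugate A)) ` G"
proof -
  let ?H = "GL\<lparr>carrier := G\<rparr>"
  interpret H: group ?H by (rule group_G)
  have "{C \<otimes>\<^bsub>?H\<^esub> A \<otimes>\<^bsub>?H\<^esub> inv\<^bsub>?H\<^esub> C | C. C \<in> carrier ?H} = Collect (conjugate A)" if A: "A \<in> G" for A
  proof (intro equalityI subsetI)
    fix D assume "D \<in> {C \<otimes>\<^bsub>?H\<^esub> A \<otimes>\<^bsub>?H\<^esub> inv\<^bsub>?H\<^esub> C | C. C \<in> carrier ?H}"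
    then obtain C where C: "C \<in> G" "D = C \<otimes>\<^bsub>?H\<^esub> A \<otimes>\<^bsub>?H\<^esub> inv\<^bsub>?H\<^esub> C" by auto
    have mem: "A \<in> carrier ?H" "C \<in> carrier ?H" using A C(1) by auto
    then have CA: "C \<otimes>\<^bsub>?H\<^esub> A \<in> carrier ?H" by (rule H.m_closed[rotated])
    then have "D \<in> carrier ?H" unfolding C(2) by (rule H.m_closed[OF _ H.inv_closed[OF mem(2)]])
    with CA have "C \<otimes>\<^bsub>?H\<^esub> A = D \<otimes>\<^bsub>?H\<^esub> C" using C(2) mem(2) H.inv_solve_right by blast
    then have "C ** A = D ** C" by (simp add: GL_def)
    then show "D \<in> Collect (conjugate A)" using C(1) by (auto simp: conjugate_def)
  next
    fix D assume "D \<in> Collect (conjugate A)"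
    then obtain C where C: "C \<in> G" "C ** A = D ** C" by (auto simp: conjugate_def)
    obtain B where B: "B \<in> G" "C ** B = mat 1" using inverse_mem[OF C(1)] by metis
    have "D = C ** A ** B" using B(2) C(2) by (metis matrix_mul_assoc matrix_mul_rid)
    then have "D \<in> G" using mult_mem A B(1) C(1) by simp
    then have mem: "A \<in> carrier ?H" "C \<in> carrier ?H" "D \<in> carrier ?H" using A C(1) by auto
    have "C \<otimes>\<^bsub>?H\<^esub> A = D \<otimes>\<^bsub>?H\<^esub> C" using C(2) by (simp add: GL_def)
    then have "D = C \<otimes>\<^bsub>?H\<^esub> A \<otimes>\<^bsub>?H\<^esub> inv\<^bsub>?H\<^esub> C"
      using H.inv_solve_right[OF mem(3) H.m_closed[OF mem(2,1)] mem(2)] by blast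
    then show "D \<in> {C \<otimes>\<^bsub>?H\<^esub> A \<otimes>\<^bsub>?H\<^esub> inv\<^bsub>?H\<^esub> C | C. C \<in> carrier ?H}" using mem(2) by blast
  qed
  then show ?thesis unfolding conj_classes_def by (simp cong: image_cong)
qed

end

context free_linear_group
begin

lemma action_inj_matrix:
  assumes "A *v z = B *v z" "z \<noteq> 0" "A \<in> G" "B \<in> G"
  shows "A = B"
proof -
  obtain B' where B': "B' \<in> G" "B ** B' = mat 1" "B' ** B = mat 1" using inverse_mem[OF assms(4)] by metis
  have "(B' ** A) *v z = z"
    using assms(1) B' by (metis matrix_vector_mul_assoc matrix_vector_mul_lid)
  then have "B' ** A = mat 1" using free[OF mult_mem[OF B'(1) assms(3)] assms(2)] by simp
  then show ?thesis using B' by (metis matrix_mul_assoc matrix_mul_lid matrix_mul_rid)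
qed

text \<open>Convexity of \<open>U\<close> gives simple and local path connectedness, so the map
  lifts through \<open>proj\<close> after composition with \<open>bdist\<close>; injectivity of
  \<open>bdist\<close> on orbits turns this into a lift through the orbit map.\<close>

lemma lift_to_cover:
  fixes f :: "'c::real_normed_vector \<Rightarrow> (complex^'n) set"
  assumes U: "convex U" "z \<in> U"
    and f: "continuous_map (top_of_set U) (top_of X) f" "\<And>y. y \<in> U \<Longrightarrow> f y \<noteq> orbit G 0"
    and a: "f z = orbit G a"
  obtains g where "continuous_on U g" "\<And>y. y \<in> U \<Longrightarrow> g y \<noteq> 0" "g z = a"
    "\<And>y. y \<in> U \<Longrightarrow> orbit G (g y) = f y"
proof -
  have f_orbit: "\<exists>w. w \<noteq> 0 \<and> f y = orbit G w" if "y \<in> U" for y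
  proof -
    have "f y \<in> range (orbit G)" using f(1) that by (auto simp: continuous_map_into_X_iff_on Pi_iff)
    then obtain w where "f y = orbit G w" by blast
    moreover from this have "w \<noteq> 0" using f(2)[OF that] by blast
    ultimately show ?thesis by blast
  qed
  have im: "(\<lambda>y. bdist (f y)) \<in> U \<rightarrow> proj ` (-{0})"
    using f_orbit by (fastforce simp: proj_def)
  have aY: "a \<in> -{0}" using f(2)[OF U(2)] a by auto
  have cont: "continuous_on U (\<lambda>y. bdist (f y))"
    using f(1) by (simp add: continuous_map_into_X_iff_on)
  have fz: "bdist (f z) = proj a" using a by (simp add: proj_def)
  have "\<exists>g. continuous_on U g \<and> g \<in> U \<rightarrow> -{0} \<and> g z = a \<and> (\<forall>y\<in>U. proj (g y) = bdist (f y))"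
    by (rule covering_space_lift_strong[OF covering_space_proj aY U(2) convex_imp_simply_connected[OF U(1)]
        convex_imp_locally_path_connected[OF U(1)] cont im fz]) blast
  then obtain g where g: "continuous_on U g" "g \<in> U \<rightarrow> -{0}" "g z = a" "\<forall>y\<in>U. proj (g y) = bdist (f y)"
    by blast
  have "orbit G (g y) = f y" if yU: "y \<in> U" for y
  proof -
    obtain w where w: "f y = orbit G w" using f_orbit[OF yU] by blast
    then have "bdist (orbit G (g y)) = bdist (orbit G w)"
      using bspec[OF g(4) yU] unfolding proj_def by (simp only:)
    then show ?thesis using w bdist_orbit_eq_iff by blast
  qed
  moreover have "g y \<noteq> 0" if "y \<in> U" for y using g(2) that by (auto simp: Pi_iff)
  ultimately show ?thesis using that g(1,3) by blast
qed

text \<open>At one point the lifts differ by some \<open>A\<close> in \<open>G\<close>. The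
  translate of \<open>g1\<close> by this \<open>A\<close> and \<open>g2\<close> lift the same map
  and agree there, hence everywhere on a connected set.\<close>

lemma lift_unique:
  assumes T: "connected T" and g1: "continuous_on T g1" "\<And>x. x \<in> T \<Longrightarrow> g1 x \<noteq> 0"
    and g2: "continuous_on T g2" and eq: "\<And>x. x \<in> T \<Longrightarrow> orbit G (g1 x) = orbit G (g2 x)"
  shows "\<exists>A\<in>G. \<forall>x\<in>T. g2 x = A *v g1 x"
proof (cases "T = {}")
  case True
  then show ?thesis using one_mem by blast
next
  case False
  then obtain a where a: "a \<in> T" by blast
  then obtain A where A: "A \<in> G" "g2 a = A *v g1 a" using eq orbit_eq_iff by metis
  have nz2: "g2 x \<noteq> 0" if "x \<in> T" for x
    using eq[OF that] g1(2)[OF that] by (metis orbit_eq_orbit_0_iff)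
  have "g2 x = A *v g1 x" if x: "x \<in> T" for x
  proof (rule covering_space_lift_unique[where c = "-{0}" and p = proj and S = "proj ` (-{0})"
        and f = "\<lambda>x. proj (g2 x)" and ?g1.0 = g2 and ?g2.0 = "\<lambda>x. A *v g1 x" and T = T and a = a])
    show "covering_space (-{0}) proj (proj ` (-{0}))" by (rule covering_space_proj)
    show "continuous_on T (\<lambda>x. proj (g2 x))"
      by (rule continuous_on_compose2[OF continuous_on_proj[of UNIV] g2]) simp
    show "(\<lambda>x. proj (g2 x)) \<in> T \<rightarrow> proj ` (-{0})" using nz2 by auto
    show "g2 \<in> T \<rightarrow> -{0}" using nz2 by auto
    show "continuous_on T (\<lambda>x. A *v g1 x)" by (intro continuous_intros g1)
    show "(\<lambda>x. A *v g1 x) \<in> T \<rightarrow> -{0}" using g1(2) A(1) by (auto simp: action_eq_0_iff)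
    show "proj (g2 x) = proj (A *v g1 x)" if "x \<in> T" for x
      using eq[OF that] A(1) by (simp add: proj_def)
  qed (use A g2 T a x in auto)
  then show ?thesis using A by blast
qed

text \<open>In a lift \<open>k\<close> of the homotopy, the edges \<open>k (s, 0)\<close> and
  \<open>k (s, 1)\<close> lift the same path, so they differ by one matrix \<open>D\<close>. At
  \<open>s = 0\<close> and at \<open>s = 1\<close> the given lift is a translate of \<open>k\<close>
  by some \<open>C\<close>, and comparing end points makes its monodromy conjugate to
  \<open>D\<close>.\<close>

lemma path_lift_homotopy_conjugate:
  assumes h: "continuous_map (top_of_set ({0..1} \<times> {0..1})) (top_of X) h"
    and nz: "\<And>y. y \<in> {0..1} \<times> {0..1} \<Longrightarrow> h y \<noteq> orbit G 0"
    and loop: "\<And>s. s \<in> {0..1::real} \<Longrightarrow> h (s, 0) = h (s, 1::real)"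
    and p: "path p" "\<And>t. t \<in> {0..1} \<Longrightarrow> orbit G (p t) = h (0, t)" "p 1 = A *v p 0"
    and q: "path q" "\<And>t. t \<in> {0..1} \<Longrightarrow> orbit G (q t) = h (1, t)" "q 1 = B *v q 0"
    and AB: "A \<in> G" "B \<in> G"
  shows "conjugate A B"
proof -
  let ?I = "{0..1} :: real set"
  have nz_of: "g t \<noteq> 0" if "orbit G (g t) = h y" "y \<in> ?I \<times> ?I" for g :: "real \<Rightarrow> complex^'n" and t y
    using that nz orbit_eq_orbit_0_iff by metis
  obtain k where k: "continuous_on (?I \<times> ?I) k" "\<And>y. y \<in> ?I \<times> ?I \<Longrightarrow> k y \<noteq> 0" "k (0, 0) = p 0"
    "\<And>y. y \<in> ?I \<times> ?I \<Longrightarrow> orbit G (k y) = h y"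
    by (rule lift_to_cover[of "?I \<times> ?I" "(0, 0)" h "p 0"]) (use h nz p(2)[of 0] in \<open>auto intro: convex_Times\<close>)
  have slice: "continuous_on ?I (\<lambda>s. k (f s))" if "continuous_on ?I f" "f ` ?I \<subseteq> ?I \<times> ?I" for f
    by (rule continuous_on_compose2[OF k(1) that(1)]) (use that in auto)
  have eq: "orbit G (k (s, 0)) = orbit G (k (s, 1))" if "s \<in> ?I" for s
    using k(4)[of "(s, 0)"] k(4)[of "(s, 1)"] loop[OF that] that by simp
  have "\<exists>D\<in>G. \<forall>s\<in>?I. k (s, 1) = D *v k (s, 0)"
    by (rule lift_unique[OF connected_Icc slice[of "\<lambda>s. (s, 0)"] _ slice[of "\<lambda>s. (s, 1)"] eq])
       (use k(2) in \<open>auto intro!: continuous_on_Pair\<close>)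
  then obtain D where D: "D \<in> G" "\<And>s. s \<in> ?I \<Longrightarrow> k (s, 1) = D *v k (s, 0)" by blast
  have conj: "conjugate D A" if pA: "A \<in> G" "path p" "p 1 = A *v p 0"
      "\<And>t. t \<in> ?I \<Longrightarrow> orbit G (p t) = h (s, t)" "s \<in> ?I" for A p s
  proof -
    have eq: "orbit G (k (s, t)) = orbit G (p t)" if "t \<in> ?I" for t
      using k(4)[of "(s, t)"] pA(4)[OF that] pA(5) that by simp
    have "\<exists>C\<in>G. \<forall>t\<in>?I. p t = C *v k (s, t)"
      by (rule lift_unique[OF connected_Icc slice[of "\<lambda>t. (s, t)"] _ _ eq])
         (use k(2) pA in \<open>auto intro!: continuous_on_Pair simp: path_def\<close>)
    then obtain C where C: "C \<in> G" "\<And>t. t \<in> ?I \<Longrightarrow> p t = C *v k (s, t)" by blast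
    have "C *v (D *v k (s, 0)) = A *v (C *v k (s, 0))"
      using C(2)[of 0] C(2)[of 1] D(2)[OF pA(5)] pA(3) by simp
    then have eq: "(C ** D) *v k (s, 0) = (A ** C) *v k (s, 0)" by (simp add: matrix_vector_mul_assoc)
    have mem: "C ** D \<in> G" "A ** C \<in> G" using C D pA mult_mem by auto
    have "C ** D = A ** C" using eq mem k(2)[of "(s, 0)"] pA(5) by (intro action_inj_matrix[where z = "k (s, 0)"]) auto
    then show ?thesis using C by (auto simp: conjugate_def)
  qed
  have "conjugate D A" by (rule conj[of A p 0]) (use p AB in auto)
  moreover have "conjugate D B" by (rule conj[of B q 1]) (use q AB in auto)
  ultimately show ?thesis using conjugate_sym conjugate_trans by blast
qed

end

locale isolated_quotient = free_linear_group G for G :: "(complex^'n^'n) set" +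
  assumes dim: "2 \<le> CARD('n)"
begin

text \<open>The real dimension is at least 4, and punctured Euclidean space is simply connected from
  dimension 3 on.\<close>

lemma simply_connected_punctured: "simply_connected (-{0 :: complex^'n})"
  using dim by (intro simply_connected_punctured_universe) simp

lemma punctured_homotopic_paths:
  assumes "path p" "path q" "path_image p \<subseteq> -{0 :: complex^'n}" "path_image q \<subseteq> -{0}"
    "pathstart q = pathstart p" "pathfinish q = pathfinish p"
  shows "homotopic_paths (-{0}) p q"
  using simply_connected_punctured assms unfolding simply_connected_eq_homotopic_paths by blast

lemma punctured_path:
  assumes "a \<noteq> 0" "b \<noteq> (0 :: complex^'n)"
  obtains \<gamma> where "path \<gamma>" "path_image \<gamma> \<subseteq> -{0}" "pathstart \<gamma> = a" "pathfinish \<gamma> = b"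
  using simply_connected_punctured assms unfolding simply_connected_eq_homotopic_paths path_connected_def
  by (metis ComplI singletonD)

text \<open>A path \<open>\<gamma>\<close> from \<open>p 0\<close> to \<open>q 0\<close> and its
  translate by \<open>A\<close> join the corresponding ends of \<open>p\<close> and
  \<open>q\<close>. Simple connectedness deforms \<open>p\<close> into the detour along these paths;
  downstairs \<open>\<gamma>\<close> and its translate coincide, so the detour is a conjugate of the
  second loop.\<close>

lemma freely_homotopic_of_lifts:
  assumes p: "path p" "\<And>t. t \<in> {0..1} \<Longrightarrow> p t \<noteq> 0" "p 1 = A *v p 0"
    and q: "path q" "\<And>t. t \<in> {0..1} \<Longrightarrow> q t \<noteq> 0" "q 1 = A *v q 0" and A: "A \<in> G"
    and p': "\<And>t. t \<in> {0..1} \<Longrightarrow> p' t = orbit G (p t)"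
    and q': "\<And>t. t \<in> {0..1} \<Longrightarrow> q' t = orbit G (q t)"
  shows "freely_homotopic (subtopology (top_of X) (topspace (top_of X) - {orbit G 0})) p' q'"
proof -
  let ?Y = "-{0} :: (complex^'n) set"
  obtain \<gamma> where \<gamma>: "path \<gamma>" "path_image \<gamma> \<subseteq> ?Y" "pathstart \<gamma> = p 0" "pathfinish \<gamma> = q 0"
    using punctured_path p(2)[of 0] q(2)[of 0] by auto
  define \<gamma>' where "\<gamma>' = (*v) A \<circ> \<gamma>"
  have \<gamma>': "path \<gamma>'" "path_image \<gamma>' \<subseteq> ?Y"
    using \<gamma> A unfolding \<gamma>'_def
    by (auto simp: path_image_compose action_eq_0_iff intro!: path_continuous_image continuous_intros)
  have im: "path_image p \<subseteq> ?Y" "path_image q \<subseteq> ?Y" using p(2) q(2) by (auto simp: path_image_def)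
  have ends: "pathstart \<gamma>' = A *v p 0" "pathfinish \<gamma>' = pathfinish q" "pathstart q = pathfinish \<gamma>"
    "pathstart p = p 0" "pathfinish p = A *v p 0"
    using \<gamma> p q by (auto simp: \<gamma>'_def pathstart_def pathfinish_def)
  have sub: "path_image (\<gamma> +++ q +++ reversepath \<gamma>') \<subseteq> ?Y"
    by (intro subset_path_image_join) (use \<gamma> \<gamma>' im in auto)
  have "homotopic_paths ?Y p (\<gamma> +++ q +++ reversepath \<gamma>')"
    by (rule punctured_homotopic_paths[OF _ _ im(1) sub]) (use p q \<gamma> \<gamma>' in \<open>simp_all add: ends\<close>)
  then have "homotopic_paths (proj ` ?Y) (proj \<circ> p) (proj \<circ> (\<gamma> +++ q +++ reversepath \<gamma>'))"
    by (rule homotopic_paths_continuous_image) (auto intro: continuous_on_proj)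
  also have "proj \<circ> (\<gamma> +++ q +++ reversepath \<gamma>') = (proj \<circ> \<gamma>) +++ (proj \<circ> q) +++ reversepath (proj \<circ> \<gamma>)"
    using A by (auto simp: fun_eq_iff joinpaths_def reversepath_def \<gamma>'_def)
  finally have "homotopic_loops (proj ` ?Y) (proj \<circ> p) ((proj \<circ> \<gamma>) +++ (proj \<circ> q) +++ reversepath (proj \<circ> \<gamma>))"
    by (rule homotopic_paths_imp_homotopic_loops)
       (use p q \<gamma> A in \<open>auto simp: pathstart_def pathfinish_def joinpaths_def reversepath_def\<close>)
  moreover have "homotopic_loops (proj ` ?Y) ((proj \<circ> \<gamma>) +++ (proj \<circ> q) +++ reversepath (proj \<circ> \<gamma>)) (proj \<circ> q)"
  proof (rule homotopic_loops_conjugate)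
    show "path (proj \<circ> \<gamma>)" "path (proj \<circ> q)"
      using \<gamma> q by (auto intro!: path_continuous_image continuous_on_proj)
    show "path_image (proj \<circ> \<gamma>) \<subseteq> proj ` ?Y" "path_image (proj \<circ> q) \<subseteq> proj ` ?Y"
      using \<gamma> im by (auto simp: path_image_compose)
    show "pathfinish (proj \<circ> \<gamma>) = pathstart (proj \<circ> q)" "pathfinish (proj \<circ> q) = pathstart (proj \<circ> q)"
      using \<gamma> q A by (auto simp: pathstart_def pathfinish_def)
  qed
  ultimately have hl: "homotopic_loops (proj ` ?Y) (proj \<circ> p) (proj \<circ> q)"
    by (rule homotopic_loops_trans)
  let ?T = "subtopology (top_of X) (topspace (top_of X) - {orbit G 0})"
  \<comment> \<open>An inverse of \<open>bdist\<close> on orbits, carrying the homotopy from the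
    normed space back to the orbit space.\<close>
  define r where "r y = orbit G (SOME z. proj z = y)" for y
  have r_proj: "r (proj z) = orbit G z" for z
  proof -
    have "proj (SOME w. proj w = proj z) = proj z" by (rule someI) simp
    then show ?thesis by (simp add: r_def proj_def bdist_orbit_eq_iff)
  qed
  have r_cont: "continuous_map (top_of_set (proj ` ?Y)) ?T r"
    unfolding continuous_map_in_subtopology continuous_map_into_X_iff_on
  proof (intro conjI)
    have "continuous_on (proj ` ?Y) (\<lambda>y. y)" by (rule continuous_on_id)
    then show "continuous_on (proj ` ?Y) (\<lambda>y. bdist (r y))"
      by (rule continuous_on_eq) (auto simp: r_proj, simp add: proj_def)
  qed (auto simp: r_proj topspace_quotient_cspace orbit_eq_orbit_0_iff)
  have "homotopic_with (\<lambda>r. r 0 = r 1) (top_of_set {0..1}) ?T (r \<circ> (proj \<circ> p)) (r \<circ> (proj \<circ> q))"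
    by (rule homotopic_with_compose_continuous_map_left[OF hl[unfolded homotopic_loops_def] r_cont])
       (auto simp: pathstart_def pathfinish_def)
  then show ?thesis
    unfolding freely_homotopic_def
    by (rule homotopic_with_eq) (auto simp: r_proj p' q')
qed

text \<open>For the converse, translating \<open>p\<close> by the conjugating element leaves the
  loop of orbits unchanged and changes the monodromy of the lift from \<open>A\<close> to
  \<open>B\<close>.\<close>

lemma freely_homotopic_iff_conjugate:
  assumes p: "path p" "\<And>t. t \<in> {0..1} \<Longrightarrow> p t \<noteq> 0" "p 1 = A *v p 0"
    and q: "path q" "\<And>t. t \<in> {0..1} \<Longrightarrow> q t \<noteq> 0" "q 1 = B *v q 0" and AB: "A \<in> G" "B \<in> G"
    and p': "\<And>t. t \<in> {0..1} \<Longrightarrow> p' t = orbit G (p t)"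
    and q': "\<And>t. t \<in> {0..1} \<Longrightarrow> q' t = orbit G (q t)"
  shows "freely_homotopic (subtopology (top_of X) (topspace (top_of X) - {orbit G 0})) p' q' \<longleftrightarrow> conjugate A B"
    (is "?F \<longleftrightarrow> _")
proof
  assume ?F
  then obtain h where "continuous_map (prod_topology (top_of_set {0..1::real}) (top_of_set {0..1::real}))
        (subtopology (top_of X) (topspace (top_of X) - {orbit G 0})) h \<and>
      (\<forall>x. h (0, x) = p' x) \<and> (\<forall>x. h (1, x) = q' x) \<and> (\<forall>t\<in>{0..1}. h (t, 0) = h (t, 1 :: real))"
    unfolding freely_homotopic_def homotopic_with_def by (rule exE)
  then have h: "continuous_map (top_of_set ({0..1} \<times> {0..1})) (subtopology (top_of X) (topspace (top_of X) - {orbit G 0})) h"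
    "\<And>x. h (0, x) = p' x" "\<And>x. h (1, x) = q' x" "\<And>t. t \<in> {0..1} \<Longrightarrow> h (t, 0) = h (t, 1 :: real)"
    unfolding prod_topology_subtopology_eu by simp_all
  show "conjugate A B"
  proof (rule path_lift_homotopy_conjugate[of h])
    show "continuous_map (top_of_set ({0..1} \<times> {0..1})) (top_of X) h"
      using h(1) by (simp add: continuous_map_in_subtopology)
    show "h y \<noteq> orbit G 0" if "y \<in> {0..1} \<times> {0..1}" for y
      using h(1) that by (auto simp: continuous_map_in_subtopology Pi_iff)
  qed (use p q AB h p' q' in auto)
next
  assume "conjugate A B"
  then obtain C where C: "C \<in> G" "C ** A = B ** C" by (auto simp: conjugate_def)
  show ?F
  proof (rule freely_homotopic_of_lifts[of "\<lambda>t. C *v p t" B q])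
    show "path (\<lambda>t. C *v p t)" using p(1) unfolding path_def by (intro continuous_intros)
    show "C *v p 1 = B *v (C *v p 0)" using p(3) C(2) by (simp add: matrix_vector_mul_assoc)
    show "p' t = orbit G (C *v p t)" if "t \<in> {0..1}" for t using p'[OF that] C(1) by simp
  qed (use p q AB q' C in \<open>auto simp: action_eq_0_iff\<close>)
qed

end

section \<open>The invariant norm and the fundamental group of the link\<close>

lemma action_scaleR: "A *v (c *\<^sub>R z) = c *\<^sub>R (A *v (z :: complex^'n))"
  using linear_scale[OF matrix_vector_mul_linear[of A]] .

definition inv_norm :: "(complex^'n^'n) set \<Rightarrow> complex^'n \<Rightarrow> real" where
  "inv_norm G z = sqrt (\<Sum>A\<in>G. (norm (A *v z))\<^sup>2)"

context finite_linear_group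
begin

lemma inv_norm_action [simp]: "A \<in> G \<Longrightarrow> inv_norm G (A *v z) = inv_norm G z"
proof -
  assume A: "A \<in> G"
  have inj: "inj_on (\<lambda>B. B ** A) G"
    by (rule inj_onI) (metis A inverse_mem matrix_mul_assoc matrix_mul_rid)
  have "(\<Sum>B\<in>G. (norm (B *v (A *v z)))\<^sup>2) = (\<Sum>B\<in>(\<lambda>B. B ** A) ` G. (norm (B *v z))\<^sup>2)"
    by (simp add: sum.reindex[OF inj] matrix_vector_mul_assoc)
  then show ?thesis by (simp add: inv_norm_def right_mult_image A)
qed

lemma inv_norm_pos: "z \<noteq> 0 \<Longrightarrow> inv_norm G z > 0"
proof -
  assume "z \<noteq> 0"
  then have "0 < (norm (mat 1 *v z))\<^sup>2" by simp
  also have "\<dots> \<le> (\<Sum>A\<in>G. (norm (A *v z))\<^sup>2)"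
    by (rule member_le_sum[OF one_mem]) (auto simp: finite)
  finally show ?thesis by (simp add: inv_norm_def)
qed

lemma inv_norm_scaleR: "c \<ge> 0 \<Longrightarrow> inv_norm G (c *\<^sub>R z) = c * inv_norm G z"
  by (simp add: inv_norm_def action_scaleR power_mult_distrib sum_distrib_left[symmetric] real_sqrt_mult)

lemma continuous_on_inv_norm: "continuous_on S (inv_norm G)"
  unfolding inv_norm_def by (intro continuous_intros)

lemma link_cover_iff: "\<epsilon> > 0 \<Longrightarrow> z \<in> link_cover G \<epsilon> \<longleftrightarrow> inv_norm G z = \<epsilon>"
  unfolding link_cover_def inv_norm_def
  by (metis (mono_tags, lifting) abs_of_pos mem_Collect_eq real_sqrt_abs real_sqrt_eq_iff)

end

locale link_setup = isolated_quotient G for G :: "(complex^'n^'n) set" +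
  fixes \<epsilon> :: real and z0 :: "complex^'n"
  assumes \<epsilon>: "\<epsilon> > 0" and z0: "z0 \<in> link_cover G \<epsilon>"
begin

abbreviation T where "T \<equiv> subtopology (top_of X) (link G \<epsilon>)"
abbreviation b where "b \<equiv> orbit G z0"
abbreviation P where "P \<equiv> fundamental_group T b"

lemma inv_norm_z0: "inv_norm G z0 = \<epsilon>" using z0 link_cover_iff \<epsilon> by blast

lemma z0_nz: "z0 \<noteq> 0" using inv_norm_z0 \<epsilon> by (auto simp: inv_norm_def)

lemma orbit_link_iff: "orbit G z \<in> link G \<epsilon> \<longleftrightarrow> inv_norm G z = \<epsilon>"
proof
  assume "orbit G z \<in> link G \<epsilon>"
  then obtain w where "w \<in> link_cover G \<epsilon>" "orbit G w = orbit G z" by (auto simp: link_def)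
  then show "inv_norm G z = \<epsilon>" by (metis \<epsilon> inv_norm_action link_cover_iff orbit_eq_iff)
qed (use \<epsilon> link_cover_iff in \<open>auto simp: link_def\<close>)

lemma link_nz: "x \<in> link G \<epsilon> \<Longrightarrow> x \<noteq> orbit G 0"
  using orbit_link_iff[of 0] \<epsilon> by (auto simp: inv_norm_def)

text \<open>Radial retraction onto the sphere of the averaged norm. It commutes with
  \<open>G\<close>, so homotopies can be built in the simply connected punctured space and then
  pushed to the link.\<close>

definition retr :: "complex^'n \<Rightarrow> complex^'n" where
  "retr z = (\<epsilon> / inv_norm G z) *\<^sub>R z"

lemma retr_in: "z \<noteq> 0 \<Longrightarrow> inv_norm G (retr z) = \<epsilon>"
  using inv_norm_pos[of z] \<epsilon> by (simp add: retr_def inv_norm_scaleR)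

lemma retr_id: "inv_norm G z = \<epsilon> \<Longrightarrow> retr z = z"
  using \<epsilon> by (simp add: retr_def)

lemma retr_action: "A \<in> G \<Longrightarrow> retr (A *v z) = A *v retr z"
  by (simp add: retr_def action_scaleR)

lemma continuous_on_retr: "continuous_on (-{0}) retr"
  unfolding retr_def
  by (intro continuous_intros continuous_on_inv_norm) (use inv_norm_pos in force)

lemma continuous_map_retr: "continuous_map (top_of_set (-{0})) T (\<lambda>z. orbit G (retr z))"
  unfolding continuous_map_in_subtopology
  by (auto intro!: continuous_map_orbit_comp continuous_on_retr simp: orbit_link_iff retr_in)

lemma loops_iff: "p \<in> loops_at T b \<longleftrightarrow> continuous_map (top_of_set {0..1}) (top_of X) p \<and>
    p \<in> {0..1} \<rightarrow> link G \<epsilon> \<and> p 0 = b \<and> p 1 = b"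
  by (auto simp: loops_at_def pathin_def continuous_map_in_subtopology)

text \<open>Monodromy as a relation on single loops; it allows existence, uniqueness and homotopy
  invariance to be settled before the definite description in \<open>monodromy\<close> is
  evaluated.\<close>

definition lifts_to :: "(real \<Rightarrow> (complex^'n) set) \<Rightarrow> complex^'n^'n \<Rightarrow> bool" where
  "lifts_to p A \<longleftrightarrow> (\<exists>q. path q \<and> q 0 = z0 \<and> q 1 = A *v z0 \<and> (\<forall>t\<in>{0..1}. orbit G (q t) = p t))"

lemma lifts_to_exists:
  assumes "p \<in> loops_at T b"
  obtains A where "A \<in> G" "lifts_to p A"
proof -
  have p: "continuous_map (top_of_set {0..1}) (top_of X) p" "p \<in> {0..1} \<rightarrow> link G \<epsilon>" "p 0 = b" "p 1 = b"
    using assms loops_iff by auto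
  obtain q where q: "continuous_on {0..1} q" "q 0 = z0" "\<And>t. t \<in> {0..1} \<Longrightarrow> orbit G (q t) = p t"
    by (rule lift_to_cover[of "{0..1}" 0 p z0]) (use p link_nz in \<open>auto simp: Pi_iff\<close>)
  obtain A where A: "A \<in> G" "q 1 = A *v z0" using q(3)[of 1] p(4) orbit_eq_iff[of z0 "q 1"] by auto
  then have "lifts_to p A"
    unfolding lifts_to_def path_def using q by (intro exI[of _ q]) simp
  then show ?thesis using that A(1) by blast
qed

lemma lifts_to_unique:
  assumes p: "p \<in> {0..1} \<rightarrow> link G \<epsilon>" and A: "A \<in> G" "lifts_to p A" and B: "B \<in> G" "lifts_to p B"
  shows "A = B"
proof -
  obtain q where q: "path q" "q 0 = z0" "q 1 = A *v z0" "\<And>t. t \<in> {0..1} \<Longrightarrow> orbit G (q t) = p t"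
    using A by (auto simp: lifts_to_def)
  obtain r where r: "path r" "r 0 = z0" "r 1 = B *v z0" "\<And>t. t \<in> {0..1} \<Longrightarrow> orbit G (r t) = p t"
    using B by (auto simp: lifts_to_def)
  have nz: "q t \<noteq> 0" if "t \<in> {0..1}" for t
    using q(4)[OF that] p link_nz that by (metis Pi_iff)
  have eq: "orbit G (q t) = orbit G (r t)" if "t \<in> {0..1}" for t
    using q(4)[OF that] r(4)[OF that] by simp
  obtain C where C: "C \<in> G" "\<And>t. t \<in> {0..1} \<Longrightarrow> r t = C *v q t"
    using lift_unique[OF connected_Icc q(1)[unfolded path_def] nz r(1)[unfolded path_def] eq] by blast
  have "C *v z0 = z0" using C(2)[of 0] q r by simp
  then have "C = mat 1" using free C(1) z0_nz by blast
  then have "A *v z0 = B *v z0" using C(2)[of 1] q r by simp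
  then show ?thesis using action_inj_matrix z0_nz A B by blast
qed

lemma lifts_to_of_path:
  assumes "path q" "q 0 = z0" "q 1 = A *v z0" "A \<in> G" "\<And>t. t \<in> {0..1} \<Longrightarrow> inv_norm G (q t) = \<epsilon>"
  shows "(\<lambda>t. orbit G (q t)) \<in> loops_at T b" "lifts_to (\<lambda>t. orbit G (q t)) A"
  using assms unfolding loops_iff lifts_to_def
  by (auto simp: path_def orbit_link_iff intro!: continuous_map_orbit_comp)

lemma loop_class_imp_loop:
  assumes "q \<in> loop_class T b p"
  shows "q \<in> loops_at T b" "p \<in> loops_at T b"
proof -
  have hom: "homotopic_with (\<lambda>r. r 0 = b \<and> r 1 = b) (top_of_set {0..1}) T p q"
    using assms by (simp add: loop_class_def)
  show "q \<in> loops_at T b" "p \<in> loops_at T b"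
    using homotopic_with_imp_continuous_maps[OF hom] homotopic_with_imp_property[OF hom]
    by (simp_all add: loops_at_def pathin_def)
qed

text \<open>In a lift of the homotopy the two edges over the base point lift constant paths, hence
  are constant, so the lifted paths at both ends of the homotopy share their end points.\<close>

lemma loop_class_lifts_to:
  assumes q: "q \<in> loop_class T b p" and A: "A \<in> G" "lifts_to p A"
  shows "lifts_to q A"
proof -
  let ?I = "{0..1} :: real set"
  from q have "homotopic_with (\<lambda>r. r 0 = b \<and> r 1 = b) (top_of_set ?I) T p q" by (simp add: loop_class_def)
  then obtain h where "continuous_map (prod_topology (top_of_set {0..1}) (top_of_set {0..1})) T h \<and>
      (\<forall>x. h (0, x) = p x) \<and> (\<forall>x. h (1, x) = q x) \<and> (\<forall>t\<in>?I. h (t, 0) = b \<and> h (t, 1 :: real) = b)"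
    unfolding homotopic_with_def by (rule exE)
  then have h: "continuous_map (top_of_set (?I \<times> ?I)) T h"
    "\<And>x. h (0, x) = p x" "\<And>x. h (1, x) = q x" "\<And>t. t \<in> ?I \<Longrightarrow> h (t, 0) = b" "\<And>t. t \<in> ?I \<Longrightarrow> h (t, 1) = b"
    unfolding prod_topology_subtopology_eu by simp_all
  have hL: "h y \<in> link G \<epsilon>" if "y \<in> ?I \<times> ?I" for y
    using h(1) that by (auto simp: continuous_map_in_subtopology Pi_iff)
  obtain k where k: "continuous_on (?I \<times> ?I) k" "\<And>y. y \<in> ?I \<times> ?I \<Longrightarrow> k y \<noteq> 0" "k (0, 0) = z0"
    "\<And>y. y \<in> ?I \<times> ?I \<Longrightarrow> orbit G (k y) = h y"
  proof (rule lift_to_cover[of "?I \<times> ?I" "(0, 0)" h z0])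
    show "convex (?I \<times> ?I)" by (intro convex_Times) auto
    show "continuous_map (top_of_set (?I \<times> ?I)) (top_of X) h"
      using h(1) by (simp add: continuous_map_in_subtopology)
    show "h y \<noteq> orbit G 0" if "y \<in> ?I \<times> ?I" for y using hL[OF that] link_nz by blast
    show "h (0, 0) = orbit G z0" by (rule h(4)) simp
  qed (simp, rule that)
  have slice: "continuous_on ?I (\<lambda>s. k (f s))" if "continuous_on ?I f" "f ` ?I \<subseteq> ?I \<times> ?I" for f
    by (rule continuous_on_compose2[OF k(1) that(1)]) (use that in auto)
  have const: "k (s, e) = k (0, e)" if se: "s \<in> ?I" "e \<in> {0, 1}" for s e
  proof -
    have cont: "continuous_on ?I (\<lambda>s. k (s, e))"
      by (rule slice[of "\<lambda>s. (s, e)"]) (use se in \<open>auto intro!: continuous_on_Pair\<close>)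
    have nz: "k (0, e) \<noteq> 0" using k(2)[of "(0, e)"] se by auto
    have eq: "orbit G (k (0, e)) = orbit G (k (s, e))" if "s \<in> ?I" for s
    proof -
      have "h (0, e) = b" "h (s, e) = b" using se(2) h(4,5) that by auto
      moreover have "orbit G (k (0, e)) = h (0, e)" "orbit G (k (s, e)) = h (s, e)"
        using se(2) that by (intro k(4); force)+
      ultimately show ?thesis by (simp only:)
    qed
    obtain C where C: "C \<in> G" "\<And>s. s \<in> ?I \<Longrightarrow> k (s, e) = C *v k (0, e)"
      using lift_unique[OF connected_Icc continuous_on_const nz cont eq] by blast
    have "C = mat 1" using C(2)[of 0] by (intro free[OF C(1) nz]) simp
    then show ?thesis using C(2)[OF se(1)] by simp
  qed
  obtain p' where p': "path p'" "p' 0 = z0" "p' 1 = A *v z0" "\<And>t. t \<in> ?I \<Longrightarrow> orbit G (p' t) = p t"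
    using A by (auto simp: lifts_to_def)
  have cont0: "continuous_on ?I (\<lambda>t. k (0, t))"
    by (rule slice[of "\<lambda>t. (0, t)"]) (auto intro!: continuous_on_Pair)
  have eq0: "orbit G (k (0, t)) = orbit G (p' t)" if "t \<in> ?I" for t
  proof -
    have "orbit G (k (0, t)) = h (0, t)" using that by (intro k(4)) auto
    then show ?thesis by (simp only: h(2) p'(4)[OF that])
  qed
  obtain C where C: "C \<in> G" "\<And>t. t \<in> ?I \<Longrightarrow> p' t = C *v k (0, t)"
    using lift_unique[OF connected_Icc cont0 _ p'(1)[unfolded path_def] eq0] k(2) by auto
  have "C = mat 1" using C(2)[of 0] k(3) p'(2) free[OF C(1) z0_nz] by simp
  then have "k (0, 1) = A *v z0" using C(2)[of 1] p' by simp
  then have "k (1, 1) = A *v z0" "k (1, 0) = z0" using const[of 1 1] const[of 1 0] k(3) by auto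
  moreover have "path (\<lambda>t. k (1, t))" unfolding path_def
    by (rule slice[of "\<lambda>t. (1, t)"]) (auto intro!: continuous_on_Pair)
  moreover have "\<forall>t\<in>?I. orbit G (k (1, t)) = q t" using k(4) h(3) by auto
  ultimately show ?thesis unfolding lifts_to_def by blast
qed

text \<open>Lifts with common end points are homotopic in the punctured space. Applying
  \<open>retr\<close> and the orbit map puts the homotopy into the link without moving the given
  loops.\<close>

lemma lifts_to_imp_loop_class:
  assumes p: "p \<in> loops_at T b" "lifts_to p A" and q: "q \<in> loops_at T b" "lifts_to q A" and A: "A \<in> G"
  shows "q \<in> loop_class T b p"
proof -
  obtain p' where p': "path p'" "p' 0 = z0" "p' 1 = A *v z0" "\<And>t. t \<in> {0..1} \<Longrightarrow> orbit G (p' t) = p t"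
    using p by (auto simp: lifts_to_def)
  obtain q' where q': "path q'" "q' 0 = z0" "q' 1 = A *v z0" "\<And>t. t \<in> {0..1} \<Longrightarrow> orbit G (q' t) = q t"
    using q by (auto simp: lifts_to_def)
  have np: "inv_norm G (p' t) = \<epsilon>" if "t \<in> {0..1}" for t
    using p'(4)[OF that] p(1) that unfolding loops_iff by (metis Pi_iff orbit_link_iff)
  have nq: "inv_norm G (q' t) = \<epsilon>" if "t \<in> {0..1}" for t
    using q'(4)[OF that] q(1) that unfolding loops_iff by (metis Pi_iff orbit_link_iff)
  have nz: "z \<noteq> 0" if "inv_norm G z = \<epsilon>" for z using that \<epsilon> by (auto simp: inv_norm_def)
  have "homotopic_paths (-{0}) p' q'"
    by (rule punctured_homotopic_paths)
       (use p' q' np nq nz in \<open>auto simp: path_image_def pathstart_def pathfinish_def\<close>)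
  then have "homotopic_with (\<lambda>r. r 0 = b \<and> r 1 = b) (top_of_set {0..1}) T
      ((\<lambda>z. orbit G (retr z)) \<circ> p') ((\<lambda>z. orbit G (retr z)) \<circ> q')"
    unfolding homotopic_paths_def
    by (rule homotopic_with_compose_continuous_map_left[OF _ continuous_map_retr])
       (use p' A retr_id inv_norm_z0 in \<open>auto simp: pathstart_def pathfinish_def retr_action\<close>)
  then have "homotopic_with (\<lambda>r. r 0 = b \<and> r 1 = b) (top_of_set {0..1}) T p q"
    by (rule homotopic_with_eq) (use p' q' np nq in \<open>auto simp: retr_id\<close>)
  then show ?thesis by (simp add: loop_class_def)
qed

lemma lifts_to_surj:
  assumes "A \<in> G"
  obtains p where "p \<in> loops_at T b" "lifts_to p A"
proof -
  obtain \<gamma> where \<gamma>: "path \<gamma>" "path_image \<gamma> \<subseteq> -{0}" "pathstart \<gamma> = z0" "pathfinish \<gamma> = A *v z0"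
    using punctured_path[of z0 "A *v z0"] z0_nz assms by (auto simp: action_eq_0_iff)
  have nz: "\<gamma> t \<noteq> 0" if "t \<in> {0..1}" for t using \<gamma>(2) that by (auto simp: path_image_def)
  define q where "q t = retr (\<gamma> t)" for t
  have "path q" unfolding q_def path_def
    by (rule continuous_on_compose2[OF continuous_on_retr]) (use \<gamma> nz in \<open>auto simp: path_def\<close>)
  moreover have "q 0 = z0" "q 1 = A *v z0"
    using \<gamma>(3,4) assms by (auto simp: q_def pathstart_def pathfinish_def retr_action retr_id inv_norm_z0)
  moreover have "inv_norm G (q t) = \<epsilon>" if "t \<in> {0..1}" for t using retr_in nz that by (simp add: q_def)
  ultimately show ?thesis using lifts_to_of_path[of q A] assms that by blast
qed

text \<open>The lift of the second loop has to be translated by \<open>A\<close> to start where the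
  first ends; it then ends at \<open>A *v (B *v z0)\<close>. This order of factors makes monodromy a
  homomorphism rather than an antihomomorphism.\<close>

lemma lifts_to_join:
  assumes "lifts_to p A" "lifts_to q B" "A \<in> G"
  shows "lifts_to (join_loops p q) (A ** B)"
proof -
  obtain p' where p': "path p'" "p' 0 = z0" "p' 1 = A *v z0" "\<And>t. t \<in> {0..1} \<Longrightarrow> orbit G (p' t) = p t"
    using assms by (auto simp: lifts_to_def)
  obtain q' where q': "path q'" "q' 0 = z0" "q' 1 = B *v z0" "\<And>t. t \<in> {0..1} \<Longrightarrow> orbit G (q' t) = q t"
    using assms by (auto simp: lifts_to_def)
  define r where "r = p' +++ (\<lambda>t. A *v q' t)"
  have "path (\<lambda>t. A *v q' t)" using q'(1) unfolding path_def by (intro continuous_intros)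
  then have "path r" unfolding r_def
    using p' q' by (intro path_join_imp) (auto simp: pathstart_def pathfinish_def)
  moreover have "r 0 = z0" "r 1 = (A ** B) *v z0"
    using p' q' by (auto simp: r_def joinpaths_def matrix_vector_mul_assoc)
  moreover have "orbit G (r t) = join_loops p q t" if "t \<in> {0..1}" for t
    using p'(4)[of "2 * t"] q'(4)[of "2 * t - 1"] that assms(3)
    by (auto simp: r_def joinpaths_def join_loops_def)
  ultimately show ?thesis unfolding lifts_to_def by blast
qed

lemma join_loops_loop:
  assumes p: "p \<in> loops_at T b" and q: "q \<in> loops_at T b"
  shows "join_loops p q \<in> loops_at T b"
proof -
  obtain A where A: "A \<in> G" "lifts_to p A" using lifts_to_exists[OF p] .
  obtain B where B: "B \<in> G" "lifts_to q B" using lifts_to_exists[OF q] .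
  obtain r where r: "path r" "r 0 = z0" "r 1 = (A ** B) *v z0" "\<And>t. t \<in> {0..1} \<Longrightarrow> orbit G (r t) = join_loops p q t"
    using lifts_to_join[OF A(2) B(2) A(1)] by (auto simp: lifts_to_def)
  have im: "join_loops p q \<in> {0..1} \<rightarrow> link G \<epsilon>"
    using p q unfolding loops_iff by (auto simp: join_loops_def Pi_iff)
  have "continuous_map (top_of_set {0..1}) (top_of X) (\<lambda>t. orbit G (r t))"
    using r(1) by (intro continuous_map_orbit_comp) (simp add: path_def)
  then have "continuous_map (top_of_set {0..1}) (top_of X) (join_loops p q)"
    by (rule continuous_map_eq) (use r in auto)
  then show ?thesis using p q im unfolding loops_iff by (auto simp: join_loops_def)
qed

lemma monodromy_loop_class:
  assumes p: "p \<in> loops_at T b" and A: "A \<in> G" "lifts_to p A"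
  shows "monodromy G z0 (loop_class T b p) = A"
  unfolding monodromy_def
proof (rule the_equality)
  obtain q where q: "path q" "q 0 = z0" "q 1 = A *v z0" "\<And>t. t \<in> {0..1} \<Longrightarrow> orbit G (q t) = p t"
    using A by (auto simp: lifts_to_def)
  have "inv_norm G (q t) = \<epsilon>" if "t \<in> {0..1}" for t
    using q(4)[OF that] p that unfolding loops_iff by (metis Pi_iff orbit_link_iff)
  then have "(\<lambda>t. orbit G (q t)) \<in> loop_class T b p"
    using lifts_to_imp_loop_class[OF p A(2) _ _ A(1)] lifts_to_of_path[OF q(1-3) A(1)] by blast
  then show "A \<in> G \<and> (\<exists>q. path q \<and> q 0 = z0 \<and> q 1 = A *v z0 \<and> (\<lambda>t. orbit G (q t)) \<in> loop_class T b p)"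
    using A q by blast
next
  fix B assume B: "B \<in> G \<and> (\<exists>q. path q \<and> q 0 = z0 \<and> q 1 = B *v z0 \<and> (\<lambda>t. orbit G (q t)) \<in> loop_class T b p)"
  then obtain q where q: "path q" "q 0 = z0" "q 1 = B *v z0" "(\<lambda>t. orbit G (q t)) \<in> loop_class T b p" by blast
  have "lifts_to (\<lambda>t. orbit G (q t)) B" using q by (auto simp: lifts_to_def)
  moreover have "lifts_to (\<lambda>t. orbit G (q t)) A" using loop_class_lifts_to[OF q(4) A] .
  moreover have "(\<lambda>t. orbit G (q t)) \<in> {0..1} \<rightarrow> link G \<epsilon>"
    using loop_class_imp_loop[OF q(4)] unfolding loops_iff by blast
  ultimately show "B = A" using lifts_to_unique A(1) B by blast
qed

lemma monodromy_props:
  assumes p: "p \<in> loops_at T b"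
  shows "monodromy G z0 (loop_class T b p) \<in> G" "lifts_to p (monodromy G z0 (loop_class T b p))"
  using lifts_to_exists[OF p] monodromy_loop_class[OF p] by metis+

lemma mem_loop_class_iff:
  assumes "p \<in> loops_at T b"
  shows "r \<in> loop_class T b p \<longleftrightarrow> r \<in> loops_at T b \<and> lifts_to r (monodromy G z0 (loop_class T b p))"
  using loop_class_imp_loop loop_class_lifts_to monodromy_props[OF assms] lifts_to_imp_loop_class assms by blast

lemma loop_class_eq_iff:
  assumes p: "p \<in> loops_at T b" and q: "q \<in> loops_at T b"
  shows "loop_class T b p = loop_class T b q \<longleftrightarrow>
    monodromy G z0 (loop_class T b p) = monodromy G z0 (loop_class T b q)"
proof
  assume eq: "monodromy G z0 (loop_class T b p) = monodromy G z0 (loop_class T b q)"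
  show "loop_class T b p = loop_class T b q"
    using mem_loop_class_iff[OF p] mem_loop_class_iff[OF q] eq by auto
qed simp

text \<open>The product is a union over all pairs of representatives. All their joins have the same
  monodromy, so the union collapses to a single class.\<close>

lemma mult_P:
  assumes p: "p \<in> loops_at T b" and q: "q \<in> loops_at T b"
  shows "loop_class T b p \<otimes>\<^bsub>P\<^esub> loop_class T b q = loop_class T b (join_loops p q)"
proof -
  let ?A = "monodromy G z0 (loop_class T b p)" and ?B = "monodromy G z0 (loop_class T b q)"
  have "loop_class T b (join_loops r s) = loop_class T b (join_loops p q)"
    if rs: "r \<in> loop_class T b p" "s \<in> loop_class T b q" for r s
  proof -
    have r: "r \<in> loops_at T b" "lifts_to r ?A" and s: "s \<in> loops_at T b" "lifts_to s ?B"
      using rs mem_loop_class_iff p q by auto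
    have "monodromy G z0 (loop_class T b (join_loops r s)) = ?A ** ?B"
      using r s monodromy_props[OF p] monodromy_props[OF q]
      by (intro monodromy_loop_class join_loops_loop lifts_to_join mult_mem) auto
    moreover have "monodromy G z0 (loop_class T b (join_loops p q)) = ?A ** ?B"
      using p q monodromy_props[OF p] monodromy_props[OF q]
      by (intro monodromy_loop_class join_loops_loop lifts_to_join mult_mem) auto
    ultimately show ?thesis using loop_class_eq_iff join_loops_loop p q r s by metis
  qed
  then have "(\<Union>r\<in>loop_class T b p. \<Union>s\<in>loop_class T b q. loop_class T b (join_loops r s)) =
      (\<Union>r\<in>loop_class T b p. \<Union>s\<in>loop_class T b q. loop_class T b (join_loops p q))"
    by (intro SUP_cong refl)
  moreover have "p \<in> loop_class T b p" "q \<in> loop_class T b q"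
    using mem_loop_class_iff p q monodromy_props by blast+
  ultimately show ?thesis unfolding fundamental_group_def monoid.simps by blast
qed

lemma monodromy_mult:
  assumes p: "p \<in> loops_at T b" and q: "q \<in> loops_at T b"
  shows "monodromy G z0 (loop_class T b p \<otimes>\<^bsub>P\<^esub> loop_class T b q) =
    monodromy G z0 (loop_class T b p) ** monodromy G z0 (loop_class T b q)"
  unfolding mult_P[OF p q]
  using p q monodromy_props[OF p] monodromy_props[OF q]
  by (intro monodromy_loop_class join_loops_loop lifts_to_join mult_mem) auto

lemma carrier_P: "carrier P = loop_class T b ` loops_at T b"
  by (simp add: fundamental_group_def)

lemma monodromy_iso: "monodromy G z0 \<in> iso P (GL\<lparr>carrier := G\<rparr>)"
proof -
  have "monodromy G z0 \<in> hom P (GL\<lparr>carrier := G\<rparr>)"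
    by (rule homI) (auto simp: carrier_P GL_def monodromy_props monodromy_mult[simplified])
  moreover have "bij_betw (monodromy G z0) (carrier P) G"
    unfolding bij_betw_def
  proof
    show "inj_on (monodromy G z0) (carrier P)"
      by (auto simp: inj_on_def carrier_P loop_class_eq_iff)
    show "monodromy G z0 ` carrier P = G"
    proof (intro equalityI subsetI)
      fix A assume A: "A \<in> G"
      then obtain p where "p \<in> loops_at T b" "lifts_to p A" using lifts_to_surj by metis
      then show "A \<in> monodromy G z0 ` carrier P" using monodromy_loop_class A by (auto simp: carrier_P image_iff)
    qed (auto simp: carrier_P monodromy_props)
  qed
  ultimately show ?thesis by (simp add: iso_def)
qed

text \<open>The axioms are pulled back from \<open>G\<close> along the injective multiplicative map
  \<open>monodromy G z0\<close>, so no reparametrization homotopies have to be constructed.\<close>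

lemma group_P: "group P"
proof -
  let ?m = "monodromy G z0"
  have bij: "bij_betw ?m (carrier P) G" using monodromy_iso by (simp add: iso_def)
  have mult: "x \<otimes>\<^bsub>P\<^esub> y \<in> carrier P" "?m (x \<otimes>\<^bsub>P\<^esub> y) = ?m x ** ?m y" if "x \<in> carrier P" "y \<in> carrier P" for x y
    using that mult_P monodromy_mult join_loops_loop by (auto simp: carrier_P)
  have inj: "x = y" if "?m x = ?m y" "x \<in> carrier P" "y \<in> carrier P" for x y
    using bij that by (meson bij_betw_def inj_onD)
  have in_G: "?m x \<in> G" if "x \<in> carrier P" for x using bij that by (meson bij_betwE)
  have const: "(\<lambda>_. b) \<in> loops_at T b" "lifts_to (\<lambda>_. b) (mat 1)"
    using lifts_to_of_path[of "\<lambda>_. z0" "mat 1"] one_mem inv_norm_z0 by (auto simp: path_def)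
  then have one: "\<one>\<^bsub>P\<^esub> \<in> carrier P" "?m \<one>\<^bsub>P\<^esub> = mat 1"
    using monodromy_loop_class[OF const(1) one_mem const(2)] by (auto simp: fundamental_group_def)
  show ?thesis
  proof (rule groupI)
    fix x assume x: "x \<in> carrier P"
    show "\<one>\<^bsub>P\<^esub> \<otimes>\<^bsub>P\<^esub> x = x"
      by (rule inj) (use x one mult in \<open>auto simp: matrix_mul_lid\<close>)
    obtain B where B: "B \<in> G" "B ** ?m x = mat 1" using inverse_mem[OF in_G[OF x]] by metis
    then obtain y where y: "y \<in> carrier P" "?m y = B" using bij by (metis bij_betw_def imageE)
    have "y \<otimes>\<^bsub>P\<^esub> x = \<one>\<^bsub>P\<^esub>" by (rule inj) (use x y B one mult in auto)
    then show "\<exists>y\<in>carrier P. y \<otimes>\<^bsub>P\<^esub> x = \<one>\<^bsub>P\<^esub>" using y by blast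
  next
    fix x y z assume "x \<in> carrier P" "y \<in> carrier P" "z \<in> carrier P"
    then show "x \<otimes>\<^bsub>P\<^esub> y \<otimes>\<^bsub>P\<^esub> z = x \<otimes>\<^bsub>P\<^esub> (y \<otimes>\<^bsub>P\<^esub> z)"
      by (intro inj) (auto simp: mult matrix_mul_assoc)
  qed (use mult one in auto)
qed

end

section \<open>Conjugacy classes and winding classes\<close>

lemma conj_classes_iso:
  assumes "group H" "group K" and f: "f \<in> iso H K"
  shows "bij_betw (image f) (conj_classes H) (conj_classes K)"
proof -
  interpret H: group H by fact
  interpret K: group K by fact
  have hom: "f \<in> hom H K" and bij: "bij_betw f (carrier H) (carrier K)" using f by (auto simp: iso_def)
  interpret group_hom H K f by unfold_locales (rule hom)
  let ?c = "\<lambda>H a. {g \<otimes>\<^bsub>H\<^esub> a \<otimes>\<^bsub>H\<^esub> inv\<^bsub>H\<^esub> g | g. g \<in> carrier H}"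
  have im: "f ` ?c H a = ?c K (f a)" if a: "a \<in> carrier H" for a
  proof -
    have "f ` ?c H a = {f (g \<otimes>\<^bsub>H\<^esub> a \<otimes>\<^bsub>H\<^esub> inv\<^bsub>H\<^esub> g) | g. g \<in> carrier H}" by auto
    also have "\<dots> = {f g \<otimes>\<^bsub>K\<^esub> f a \<otimes>\<^bsub>K\<^esub> inv\<^bsub>K\<^esub> f g | g. g \<in> carrier H}"
    proof -
      have "f (g \<otimes>\<^bsub>H\<^esub> a \<otimes>\<^bsub>H\<^esub> inv\<^bsub>H\<^esub> g) = f g \<otimes>\<^bsub>K\<^esub> f a \<otimes>\<^bsub>K\<^esub> inv\<^bsub>K\<^esub> f g" if "g \<in> carrier H" for g
        using a that by simp
      then show ?thesis by (metis (no_types, lifting))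
    qed
    also have "\<dots> = {h \<otimes>\<^bsub>K\<^esub> f a \<otimes>\<^bsub>K\<^esub> inv\<^bsub>K\<^esub> h | h. h \<in> f ` carrier H}" by blast
    also have "f ` carrier H = carrier K" using bij by (simp add: bij_betw_def)
    finally show ?thesis .
  qed
  have "(image f) ` conj_classes H = (\<lambda>a. ?c K (f a)) ` carrier H"
    unfolding conj_classes_def image_image by (rule image_cong[OF refl im])
  also have "\<dots> = (\<lambda>a. ?c K a) ` (f ` carrier H)" by (simp only: image_image)
  also have "\<dots> = conj_classes K" using bij unfolding conj_classes_def bij_betw_def by simp
  finally have "(image f) ` conj_classes H = conj_classes K" .
  moreover have "inj_on (image f) (conj_classes H)"
  proof (rule inj_on_subset[OF inj_on_image_Pow])
    show "inj_on f (carrier H)" using bij by (simp add: bij_betw_def)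
    show "conj_classes H \<subseteq> Pow (carrier H)" by (auto simp: conj_classes_def)
  qed
  ultimately show ?thesis by (simp add: bij_betw_def)
qed

context link_setup
begin

text \<open>Every loop in the class \<open>a\<close> has a lift with monodromy
  \<open>monodromy G z0 a\<close>, so free homotopy with the circle reduces to conjugacy with
  \<open>B\<close>.\<close>

lemma winding_class_eq:
  assumes q: "path q" "\<And>t. t \<in> {0..1} \<Longrightarrow> q t \<noteq> 0" "q 1 = B *v q 0" and B: "B \<in> G"
    and \<phi>: "\<And>t. t \<in> {0..1} \<Longrightarrow> \<phi> (cis (2 * pi * t)) = orbit G (q t)"
  shows "winding_class X (orbit G 0) (link G \<epsilon>) b \<phi> = {a \<in> carrier P. conjugate B (monodromy G z0 a)}"
proof -
  let ?Fr = "freely_homotopic (subtopology (top_of X) (topspace (top_of X) - {orbit G 0}))"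
  have "(\<exists>p\<in>a. ?Fr p (\<lambda>t. \<phi> (cis (2 * pi * t)))) \<longleftrightarrow> conjugate B (monodromy G z0 a)" if a: "a \<in> carrier P" for a
  proof -
    obtain p0 where p0: "p0 \<in> loops_at T b" "a = loop_class T b p0" using a by (auto simp: carrier_P)
    have key: "?Fr p (\<lambda>t. \<phi> (cis (2 * pi * t))) \<longleftrightarrow> conjugate (monodromy G z0 a) B" if p: "p \<in> a" for p
    proof -
      have lp: "p \<in> loops_at T b" "lifts_to p (monodromy G z0 a)"
        using p p0 mem_loop_class_iff by auto
      then obtain p' where p': "path p'" "p' 0 = z0" "p' 1 = monodromy G z0 a *v z0"
          "\<And>t. t \<in> {0..1} \<Longrightarrow> orbit G (p' t) = p t" by (auto simp: lifts_to_def)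
      have "p' t \<noteq> 0" if "t \<in> {0..1}" for t
        using p'(4)[OF that] lp(1) link_nz that unfolding loops_iff by (metis Pi_iff)
      then show ?thesis
        using p' q B \<phi> monodromy_props[OF p0(1)] p0(2)
        by (intro freely_homotopic_iff_conjugate[of p' _ q]) auto
    qed
    have "p0 \<in> a" using p0 mem_loop_class_iff monodromy_props by blast
    then show ?thesis using key conjugate_sym by blast
  qed
  then show ?thesis unfolding winding_class_def by blast
qed

lemma conj_classes_P:
  "conj_classes P = (\<lambda>B. {a \<in> carrier P. conjugate B (monodromy G z0 a)}) ` G"
proof -
  let ?m = "monodromy G z0"
  have bij: "bij_betw ?m (carrier P) G" using monodromy_iso by (simp add: iso_def)
  have bij2: "bij_betw (image ?m) (conj_classes P) ((\<lambda>A. Collect (conjugate A)) ` G)"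
    using conj_classes_iso[OF group_P group_G monodromy_iso] conj_classes_G_conjugate by simp
  have sub: "c \<subseteq> carrier P" if "c \<in> conj_classes P" for c
  proof -
    interpret group P by (rule group_P)
    show ?thesis using that by (auto simp: conj_classes_def)
  qed
  have cG: "Collect (conjugate A) \<subseteq> G" if "A \<in> G" for A
  proof
    fix B assume "B \<in> Collect (conjugate A)"
    then obtain C where C: "C \<in> G" "C ** A = B ** C" by (auto simp: conjugate_def)
    obtain D where D: "D \<in> G" "C ** D = mat 1" using inverse_mem[OF C(1)] by metis
    have "B = C ** A ** D" by (metis C(2) D(2) matrix_mul_assoc matrix_mul_rid)
    moreover have "C ** A ** D \<in> G" by (intro mult_mem C D that)
    ultimately show "B \<in> G" by (simp only:)
  qed
  have inv: "{a \<in> carrier P. ?m a \<in> ?m ` c} = c" if "c \<in> conj_classes P" for c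
    using sub[OF that] bij unfolding bij_betw_def inj_on_def by blast
  have "conj_classes P = (\<lambda>D. {a \<in> carrier P. ?m a \<in> D}) ` (image ?m ` conj_classes P)"
    unfolding image_image using inv by (auto simp: image_iff)
  also have "image ?m ` conj_classes P = (\<lambda>A. Collect (conjugate A)) ` G"
    using bij2 by (simp add: bij_betw_def)
  finally show ?thesis by (simp add: image_image)
qed

end

section \<open>Arcs and equivariant maps of half planes\<close>

abbreviation half_plane :: "real \<Rightarrow> complex set" where
  "half_plane c \<equiv> {s. Re s < c}"

abbreviation period :: complex where
  "period \<equiv> 2 * of_real pi * \<i>"

lemma open_half_plane: "open (half_plane c)"
  by (rule open_halfspace_Re_lt)

lemma convex_half_plane: "convex (half_plane c)"
  using convex_halfspace_Re_lt by blast

text \<open>Pulling a short arc back along \<open>exp\<close> and lifting it to \<open>complex^'n\<close> gives a map of this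
  kind on a half plane; translation by the period acts through the monodromy \<open>A\<close>.\<close>

definition equiv_lift :: "real \<Rightarrow> complex^'n^'n \<Rightarrow> (complex \<Rightarrow> complex^'n) \<Rightarrow> bool" where
  "equiv_lift c A \<Phi> \<longleftrightarrow> c > 0 \<and> (\<forall>i. (\<lambda>s. \<Phi> s $ i) holomorphic_on half_plane c) \<and>
     (\<forall>s. Re s < c \<longrightarrow> \<Phi> s \<noteq> 0) \<and> (\<forall>s. Re s < c \<longrightarrow> \<Phi> (s + period) = A *v \<Phi> s) \<and>
     (\<forall>e>0. \<exists>b. \<forall>s. Re s < b \<longrightarrow> norm (\<Phi> s) < e)"

lemma continuous_on_vec_componentwise:
  fixes f :: "'a::topological_space \<Rightarrow> complex^'n"
  shows "(\<And>i. continuous_on S (\<lambda>x. f x $ i)) \<Longrightarrow> continuous_on S f"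
  using continuous_on_vec_lambda[of S "\<lambda>i x. f x $ i"] by simp

lemma equiv_liftD:
  assumes "equiv_lift c A \<Phi>"
  shows "c > 0" "(\<lambda>s. \<Phi> s $ i) holomorphic_on half_plane c"
    "Re s < c \<Longrightarrow> \<Phi> s \<noteq> 0" "Re s < c \<Longrightarrow> \<Phi> (s + period) = A *v \<Phi> s"
    "e > 0 \<Longrightarrow> \<exists>b. \<forall>s. Re s < b \<longrightarrow> norm (\<Phi> s) < e"
  using assms unfolding equiv_lift_def by simp_all

lemma equiv_lift_continuous: "equiv_lift c A \<Phi> \<Longrightarrow> continuous_on (half_plane c) \<Phi>"
  unfolding equiv_lift_def
  by (intro continuous_on_vec_componentwise) (auto intro: holomorphic_on_imp_continuous_on)

text \<open>Two arcs may extend over discs of different radii; this brings their lifts to a common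
  half plane.\<close>

lemma equiv_lift_mono: "equiv_lift c A \<Phi> \<Longrightarrow> 0 < d \<Longrightarrow> d \<le> c \<Longrightarrow> equiv_lift d A \<Phi>"
  unfolding equiv_lift_def by (auto intro: holomorphic_on_subset)

lemma cball_subset_ball_exp: "c > 0 \<Longrightarrow> cball 0 1 \<subseteq> ball (0 :: complex) (exp c)"
  by (rule subsetI) (simp add: le_less_trans[of _ 1])

text \<open>Dividing by \<open>t0\<close> moves the half plane around \<open>t0\<close> away from
  the cut of \<open>Ln\<close>, so a branch exists near every nonzero point.\<close>

lemma log_branch:
  assumes "t0 \<noteq> 0" "norm t0 < exp c"
  shows "\<exists>N \<sigma>. open N \<and> t0 \<in> N \<and> N \<subseteq> ball 0 (exp c) - {0} \<and> \<sigma> holomorphic_on N \<and>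
    (\<forall>t\<in>N. exp (\<sigma> t) = t \<and> Re (\<sigma> t) < c)"
proof (intro exI conjI ballI)
  let ?N = "{t. 0 < Re (t / t0)} \<inter> ball 0 (exp c)" and ?\<sigma> = "\<lambda>t. Ln t0 + Ln (t / t0)"
  show "open ?N"
    by (intro open_Int open_ball open_Collect_less continuous_intros) (use assms in auto)
  show "t0 \<in> ?N" "?N \<subseteq> ball 0 (exp c) - {0}" using assms by auto
  show "?\<sigma> holomorphic_on ?N"
    using assms by (auto intro!: holomorphic_intros simp: complex_nonpos_Reals_iff)
  fix t assume t: "t \<in> ?N"
  then have "t \<noteq> 0" by auto
  then show e: "exp (?\<sigma> t) = t" using assms by (simp add: exp_add)
  have "exp (Re (?\<sigma> t)) = norm t" using e by (metis norm_exp_eq_Re)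
  also have "\<dots> < exp c" using t by simp
  finally show "Re (?\<sigma> t) < c" by simp
qed

section \<open>Descent of equivariant maps to arcs\<close>

context finite_linear_group
begin

text \<open>Points with the same exponential differ by a multiple of the period, and each period
  acts by \<open>A\<close>. A negative multiple is treated by exchanging the two points.\<close>

lemma orbit_period:
  assumes A: "A \<in> G" and per: "\<And>s. Re s < c \<Longrightarrow> f (s + period) = A *v f s"
    and s: "Re s < c" and eq: "exp s = exp s'"
  shows "orbit G (f s) = orbit G (f s')"
proof -
  have nat: "orbit G (f (s + of_nat n * period)) = orbit G (f s)" if "Re s < c" for s n
  proof (induction n)
    case (Suc n)
    have "s + of_nat (Suc n) * period = (s + of_nat n * period) + period" by (simp add: algebra_simps)
    then have "f (s + of_nat (Suc n) * period) = A *v f (s + of_nat n * period)"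
      using per[of "s + of_nat n * period"] that by (simp only:) simp
    then show ?case using Suc A by (simp only: orbit_action)
  qed simp
  obtain k :: int where k: "s = s' + (of_int (2 * k) * pi) * \<i>" using eq exp_eq by blast
  show ?thesis
  proof (cases "k \<ge> 0")
    case True
    then have "s = s' + of_nat (nat k) * period" using k by (simp add: algebra_simps)
    then show ?thesis using nat[of s' "nat k"] s by simp
  next
    case False
    then have "s' = s + of_nat (nat (-k)) * period" using k by (simp add: algebra_simps)
    then show ?thesis using nat[of s "nat (-k)"] s by simp
  qed
qed

text \<open>The parameter \<open>x\<close> is what later yields paths of arcs. Away from 0 the
  principal logarithm may be replaced by a local branch without changing the orbit; at 0 decay
  uniform in \<open>x\<close> gives continuity.\<close>

lemma continuous_on_exp_descent:
  fixes \<Phi> :: "'a::metric_space \<Rightarrow> complex \<Rightarrow> complex^'n"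
  assumes A: "A \<in> G" and cont: "continuous_on (I \<times> half_plane c) (\<lambda>(x, s). \<Phi> x s)"
    and per: "\<And>x s. x \<in> I \<Longrightarrow> Re s < c \<Longrightarrow> \<Phi> x (s + period) = A *v \<Phi> x s"
    and decay: "\<And>e. e > 0 \<Longrightarrow> \<exists>b. \<forall>x\<in>I. \<forall>s. Re s < b \<longrightarrow> norm (\<Phi> x s) < e"
  shows "continuous_on (I \<times> ball 0 (exp c)) (\<lambda>(x, t). proj (if t = 0 then 0 else \<Phi> x (Ln t)))"
    (is "continuous_on ?D ?F")
  unfolding continuous_on_eq_continuous_within
proof
  fix p assume p: "p \<in> ?D"
  then obtain x0 t0 where p0: "p = (x0, t0)" "x0 \<in> I" "norm t0 < exp c" by auto
  show "continuous (at p within ?D) ?F"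
  proof (cases "t0 = 0")
    case False
    obtain N \<sigma> where N: "open N" "t0 \<in> N" "N \<subseteq> ball 0 (exp c) - {0}" and \<sigma>hol: "\<sigma> holomorphic_on N"
      and \<sigma>: "\<forall>t\<in>N. exp (\<sigma> t) = t \<and> Re (\<sigma> t) < c"
      using log_branch[of t0 c] False p0(3) by blast
    have N0: "t \<noteq> 0" and exp_\<sigma>: "exp (\<sigma> t) = t" and re_\<sigma>: "Re (\<sigma> t) < c" if "t \<in> N" for t
      using N(3) \<sigma> that by auto
    have "continuous_on (I \<times> N) (\<lambda>y. (fst y, \<sigma> (snd y)))"
      by (intro continuous_on_Pair continuous_on_compose2[OF holomorphic_on_imp_continuous_on[OF \<sigma>hol]]
          continuous_intros) auto
    then have "continuous_on (I \<times> N) ((\<lambda>(x, s). \<Phi> x s) \<circ> (\<lambda>y. (fst y, \<sigma> (snd y))))"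
      by (rule continuous_on_compose) (rule continuous_on_subset[OF cont], use re_\<sigma> in auto)
    then have "continuous_on (I \<times> N) (proj \<circ> (\<lambda>y. \<Phi> (fst y) (\<sigma> (snd y))))"
      by (intro continuous_on_compose continuous_on_proj) (simp add: o_def)
    then have c1: "continuous_on (I \<times> N) ?F"
    proof (rule continuous_on_eq)
      fix y assume y: "y \<in> I \<times> N"
      then obtain x t where xt: "y = (x, t)" "x \<in> I" "t \<in> N" by auto
      have "orbit G (\<Phi> x (\<sigma> t)) = orbit G (\<Phi> x (Ln t))"
        using orbit_period[OF A, of c "\<Phi> x" "\<sigma> t" "Ln t"] per[OF xt(2)] re_\<sigma>[OF xt(3)]
          exp_\<sigma>[OF xt(3)] N0[OF xt(3)] by simp
      then show "(proj \<circ> (\<lambda>y. \<Phi> (fst y) (\<sigma> (snd y)))) y = ?F y"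
        using xt N0 by (simp add: proj_def)
    qed
    have "openin (top_of_set ?D) (I \<times> N)" "p \<in> I \<times> N"
      using p0 N by (auto simp: openin_open intro!: exI[of _ "UNIV \<times> N"] open_Times)
    moreover have "continuous (at p within I \<times> N) ?F"
      using continuous_on_eq_continuous_within[THEN iffD1, OF c1, rule_format] \<open>p \<in> I \<times> N\<close> .
    moreover have "at p within (I \<times> N) = at p within ?D"
    proof -
      have "open (UNIV \<times> N :: ('a \<times> complex) set)" using N(1) by (intro open_Times) auto
      then show ?thesis
        using \<open>p \<in> I \<times> N\<close> N(3) by (intro at_within_nhd[of p "UNIV \<times> N"]) auto
    qed
    ultimately show ?thesis by metis
  next
    case True
    have "continuous (at p within ?D) (\<lambda>(x, t). if t = 0 then 0 else \<Phi> x (Ln t))"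
      unfolding continuous_within_eps_delta
    proof (intro allI impI)
      fix e :: real assume "e > 0"
      then obtain b where b: "\<And>x s. x \<in> I \<Longrightarrow> Re s < b \<Longrightarrow> norm (\<Phi> x s) < e" using decay by blast
      show "\<exists>d>0. \<forall>y\<in>?D. dist y p < d \<longrightarrow>
          dist ((\<lambda>(x, t). if t = 0 then 0 else \<Phi> x (Ln t)) y) ((\<lambda>(x, t). if t = 0 then 0 else \<Phi> x (Ln t)) p) < e"
      \<comment> \<open>Since \<open>Re (Ln t)\<close> is the logarithm of \<open>norm t\<close>,
        the disc of radius \<open>exp b\<close> corresponds to the half plane on which the map is
        small.\<close>
      proof (intro exI[of _ "exp b"] conjI ballI impI)
        fix y assume y: "y \<in> ?D" "dist y p < exp b"
        obtain x t where xt: "y = (x, t)" "x \<in> I" using y by auto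
        have "norm t \<le> dist y p" using dist_snd_le[of y p] by (simp add: xt p0 True dist_norm)
        then have t: "norm t < exp b" using y by simp
        have "norm (\<Phi> x (Ln t)) < e" if "t \<noteq> 0"
          using b[OF xt(2), of "Ln t"] t that ln_less_cancel_iff[of "norm t" "exp b"] by simp
        then show "dist ((\<lambda>(x, t). if t = 0 then 0 else \<Phi> x (Ln t)) y) ((\<lambda>(x, t). if t = 0 then 0 else \<Phi> x (Ln t)) p) < e"
          using \<open>e > 0\<close> by (simp add: xt p0 True)
      qed simp
    qed
    then have "continuous (at p within ?D) (\<lambda>y. proj ((\<lambda>(x, t). if t = 0 then 0 else \<Phi> x (Ln t)) y))"
      by (rule continuous_within_compose3[rotated])
         (use continuous_on_proj[of UNIV] in \<open>simp add: continuous_on_eq_continuous_at\<close>)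
    then show ?thesis by (simp add: case_prod_unfold)
  qed
qed

text \<open>The principal branch is an arbitrary choice: its jump across the negative axis is one
  period, which does not change the orbit for an equivariant map.\<close>

definition ext_arc :: "(complex \<Rightarrow> complex^'n) \<Rightarrow> complex \<Rightarrow> (complex^'n) set" where
  "ext_arc \<Phi> t = orbit G (if t = 0 then 0 else \<Phi> (Ln t))"

definition arc_of :: "(complex \<Rightarrow> complex^'n) \<Rightarrow> complex \<Rightarrow> (complex^'n) set" where
  "arc_of \<Phi> = restrict (ext_arc \<Phi>) (cball 0 1)"

lemma equiv_lift_orbit_eq:
  assumes "A \<in> G" "equiv_lift c A \<Phi>" "Re s < c" "exp s = exp s'"
  shows "orbit G (\<Phi> s) = orbit G (\<Phi> s')"
  using orbit_period[of A c \<Phi>, OF assms(1) equiv_liftD(4)[OF assms(2)] assms(3,4)] by simp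

lemma ext_arc_exp:
  assumes "A \<in> G" "equiv_lift c A \<Phi>" "Re s < c"
  shows "ext_arc \<Phi> (exp s) = orbit G (\<Phi> s)"
  unfolding ext_arc_def using equiv_lift_orbit_eq[OF assms, of "Ln (exp s)"] by simp

lemma arc_of_exp:
  assumes "A \<in> G" "equiv_lift c A \<Phi>" "Re s \<le> 0"
  shows "arc_of \<Phi> (exp s) = orbit G (\<Phi> s)"
proof -
  have "Re s < c" using assms by (auto simp: equiv_lift_def)
  then show ?thesis using ext_arc_exp[OF assms(1,2)] assms(3) by (simp add: arc_of_def)
qed

lemma top_of_open_subspace_plane: "top_of (open_subspace complex_plane W) = top_of_set W"
  by (simp add: open_subspace_def complex_plane_def)

lemma continuous_map_ext_arc:
  assumes A: "A \<in> G" and \<Phi>: "equiv_lift c A \<Phi>"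
  shows "continuous_map (top_of_set (ball 0 (exp c))) (top_of X) (ext_arc \<Phi>)"
proof -
  have "continuous_on ({0::real} \<times> ball 0 (exp c)) (\<lambda>(x, t). proj (if t = 0 then 0 else \<Phi> (Ln t)))"
  proof (rule continuous_on_exp_descent[OF A])
    have "continuous_on ({0::real} \<times> half_plane c) (\<lambda>y. \<Phi> (snd y))"
      by (rule continuous_on_compose2[OF equiv_lift_continuous[OF \<Phi>]]) (auto intro!: continuous_intros)
    then show "continuous_on ({0::real} \<times> half_plane c) (\<lambda>(x, s). \<Phi> s)" by (simp add: case_prod_unfold)
  qed (use \<Phi> in \<open>auto simp: equiv_lift_def\<close>)
  then have "continuous_on (ball 0 (exp c)) (\<lambda>t. (\<lambda>(x, t). proj (if t = 0 then 0 else \<Phi> (Ln t))) (0 :: real, t))"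
    by (rule continuous_on_compose2) (auto intro!: continuous_on_Pair)
  then show ?thesis
    by (simp add: continuous_map_into_X_iff_on ext_arc_def proj_def)
qed

text \<open>Off 0 a local logarithm makes the pullback of a section holomorphic; at 0 it is
  continuous, so the singularity is removable.\<close>

lemma holomorphic_map_ext_arc:
  assumes A: "A \<in> G" and \<Phi>: "equiv_lift c A \<Phi>"
  shows "holomorphic_map (open_subspace complex_plane (ball 0 (exp c))) X (ext_arc \<Phi>)"
  unfolding holomorphic_map_def top_of_open_subspace_plane
proof (intro conjI allI impI)
  let ?W = "ball 0 (exp c) :: complex set"
  show cont: "continuous_map (top_of_set ?W) (top_of X) (ext_arc \<Phi>)"
    by (rule continuous_map_ext_arc[OF A \<Phi>])
  fix V f assume Vf: "openin (top_of X) V \<and> f \<in> sections X V"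
  define S where "S = {t \<in> topspace (top_of_set ?W). ext_arc \<Phi> t \<in> V}"
  have S: "open S"
    using openin_continuous_map_preimage[OF cont, of V] Vf by (simp add: S_def openin_open_eq)
  define V' where "V' = {z. orbit G z \<in> V}"
  have V': "open V'" "holomorphic_vec_on (\<lambda>z. f (orbit G z)) V'"
    using Vf unfolding V'_def openin_quotient_cspace by (auto simp: quotient_cspace_def)
  have hol: "\<exists>D. ((\<lambda>t. f (ext_arc \<Phi> t)) has_field_derivative D) (at t0)" if t0: "t0 \<in> S" "t0 \<noteq> 0" for t0
  proof -
    obtain N' \<sigma> where N': "open N'" "t0 \<in> N'" and \<sigma>hol': "\<sigma> holomorphic_on N'"
      and \<sigma>: "\<forall>t\<in>N'. exp (\<sigma> t) = t \<and> Re (\<sigma> t) < c"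
      using log_branch[of t0 c] t0 by (auto simp: S_def)
    define N where "N = N' \<inter> S"
    have N: "open N" "t0 \<in> N" using N' S t0 by (auto simp: N_def)
    have \<sigma>hol: "\<sigma> holomorphic_on N" using holomorphic_on_subset[OF \<sigma>hol'] by (simp add: N_def)
    have exp_\<sigma>: "exp (\<sigma> t) = t" and re_\<sigma>: "Re (\<sigma> t) < c" if "t \<in> N" for t
      using \<sigma> that by (auto simp: N_def)
    have arc: "ext_arc \<Phi> t = orbit G (\<Phi> (\<sigma> t))" if "t \<in> N" for t
      using ext_arc_exp[OF A \<Phi> re_\<sigma>[OF that]] exp_\<sigma>[OF that] by simp
    have "(\<lambda>t. f (orbit G (\<Phi> (\<sigma> t)))) holomorphic_on N"
    proof (rule holomorphic_vec_on_compose[OF V'(2) _ N(1)])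
      show "(\<lambda>t. \<Phi> (\<sigma> t) $ i) holomorphic_on N" for i
      proof -
        have "(\<lambda>s. \<Phi> s $ i) holomorphic_on half_plane c" by (rule equiv_liftD(2)[OF \<Phi>])
        moreover have "\<sigma> ` N \<subseteq> half_plane c" using re_\<sigma> by blast
        ultimately have "((\<lambda>s. \<Phi> s $ i) \<circ> \<sigma>) holomorphic_on N"
          by (rule holomorphic_on_compose_gen[OF \<sigma>hol])
        then show ?thesis by (simp add: o_def)
      qed
      show "\<Phi> (\<sigma> t) \<in> V'" if "t \<in> N" for t
      proof -
        have "ext_arc \<Phi> t \<in> V" using that unfolding N_def S_def by blast
        then show ?thesis unfolding V'_def arc[OF that] by simp
      qed
    qed
    then have "(\<lambda>t. f (ext_arc \<Phi> t)) holomorphic_on N"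
      by (rule holomorphic_transform) (simp add: arc)
    then show ?thesis using N by (meson holomorphic_derivI)
  qed
  have cont0: "continuous (at 0) (\<lambda>t. f (ext_arc \<Phi> t))" if "0 \<in> S"
  proof -
    let ?g = "\<lambda>t. if t = 0 then 0 else \<Phi> (Ln t)"
    have "continuous (at 0) ?g"
      unfolding continuous_at_eps_delta
    proof (intro allI impI)
      fix e :: real assume "e > 0"
      then obtain b where b: "\<And>s. Re s < b \<Longrightarrow> norm (\<Phi> s) < e" using equiv_liftD(5)[OF \<Phi>] by metis
      have "norm (\<Phi> (Ln t)) < e" if "t \<noteq> 0" "norm t < exp b" for t
        using b[of "Ln t"] that ln_less_cancel_iff[of "norm t" "exp b"] by simp
      then show "\<exists>d>0. \<forall>t. dist t 0 < d \<longrightarrow> dist (?g t) (?g 0) < e"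
        using \<open>e > 0\<close> by (intro exI[of _ "exp b"]) auto
    qed
    moreover have "continuous (at (?g 0)) (\<lambda>z. f (orbit G z))"
    proof -
      have "0 \<in> V'" using that by (simp add: V'_def S_def ext_arc_def)
      then show ?thesis
        using holomorphic_vec_on_imp_continuous_on[OF V'(2)] V'(1) by (simp add: continuous_on_eq_continuous_at)
    qed
    ultimately have "continuous (at 0) ((\<lambda>z. f (orbit G z)) \<circ> ?g)" by (rule continuous_at_compose)
    then show ?thesis by (simp add: o_def ext_arc_def)
  qed
  have "(\<lambda>t. f (ext_arc \<Phi> t)) holomorphic_on S"
  proof (rule no_isolated_singularity[OF _ _ S])
    show "continuous_on S (\<lambda>t. f (ext_arc \<Phi> t))"
    proof (rule continuous_at_imp_continuous_on, rule ballI)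
      fix t assume "t \<in> S"
      then show "isCont (\<lambda>t. f (ext_arc \<Phi> t)) t"
        using hol[of t] cont0 by (cases "t = 0") (auto intro: DERIV_isCont)
    qed
    show "(\<lambda>t. f (ext_arc \<Phi> t)) holomorphic_on S - {0}"
      using hol S by (subst holomorphic_on_open) auto
  qed simp
  then show "(\<lambda>t. f (ext_arc \<Phi> t)) \<in> sections (open_subspace complex_plane ?W)
      {t \<in> topspace (top_of_set ?W). ext_arc \<Phi> t \<in> V}"
    by (simp add: S_def open_subspace_def complex_plane_def)
qed

lemma arc_of_short_arc:
  assumes A: "A \<in> G" and \<Phi>: "equiv_lift c A \<Phi>"
  shows "arc_of \<Phi> \<in> short_arcs X (orbit G 0)"
proof -
  have c: "c > 0" using \<Phi> by (simp add: equiv_lift_def)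
  have "arc_of \<Phi> \<in> arcs X"
    unfolding arcs_def
  proof (intro CollectI conjI exI)
    show "arc_of \<Phi> \<in> extensional (cball 0 1)" by (simp add: arc_of_def)
    show "holomorphic_map (open_subspace complex_plane (ball 0 (exp c))) X (ext_arc \<Phi>)"
      by (rule holomorphic_map_ext_arc[OF A \<Phi>])
    show "cball 0 1 \<subseteq> ball (0::complex) (exp c)" by (rule cball_subset_ball_exp[OF c])
    show "\<forall>t\<in>cball 0 1. arc_of \<Phi> t = ext_arc \<Phi> t" by (simp add: arc_of_def)
  qed simp
  moreover have "\<Phi> (Ln t) \<noteq> 0" if "t \<noteq> 0" "norm t \<le> 1" for t
  proof -
    have "Re (Ln t) < c" using that c by (simp add: order.strict_trans1[of "ln (norm t)" 0 c])
    then show ?thesis using \<Phi> by (simp add: equiv_lift_def)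
  qed
  ultimately show ?thesis
    by (auto simp: short_arcs_def arc_of_def ext_arc_def orbit_eq_orbit_0_iff split: if_splits)
qed

end

section \<open>Lifting short arcs to equivariant maps\<close>

context free_linear_group
begin

text \<open>Near each point a continuous lift equals the local inverse \<open>lsec B\<close> applied
  to the arc, and the components of that inverse are sections of the structure sheaf.\<close>

lemma holomorphic_lift:
  assumes \<psi>: "holomorphic_map (open_subspace complex_plane W) X \<psi>" and W: "open W"
    and H: "open H" "e holomorphic_on H" "e ` H \<subseteq> W"
    and \<Phi>: "continuous_on H \<Phi>" "\<And>s. s \<in> H \<Longrightarrow> \<Phi> s \<noteq> 0" "\<And>s. s \<in> H \<Longrightarrow> orbit G (\<Phi> s) = \<psi> (e s)"
  shows "(\<lambda>s. \<Phi> s $ i) holomorphic_on H"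
proof -
  have "\<exists>D. ((\<lambda>s. \<Phi> s $ i) has_field_derivative D) (at s0)" if s0: "s0 \<in> H" for s0
  proof -
    obtain \<delta> where \<delta>: "\<delta> > 0" "evenly (ball (\<Phi> s0) \<delta>)"
      using evenly_ball[OF \<Phi>(2)[OF s0]] by metis
    define B where "B = ball (\<Phi> s0) \<delta>"
    have B: "evenly B" "open B" "\<Phi> s0 \<in> B" using \<delta> by (auto simp: B_def)
    define S where "S = {t \<in> topspace (top_of (open_subspace complex_plane W)). \<psi> t \<in> orbit G ` B}"
    have hol: "(\<lambda>t. lsec B (\<psi> t) $ i) holomorphic_on S"
    proof -
      have "(\<lambda>t. lsec B (\<psi> t) $ i) \<in> sections (open_subspace complex_plane W) S"
        using \<psi> openin_orbit_image[OF B(2)] lsec_sections[OF B(1), of i]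
        unfolding holomorphic_map_def S_def by blast
      then show ?thesis by (simp add: open_subspace_def complex_plane_def)
    qed
    define N where "N = H \<inter> \<Phi> -` B"
    have N: "open N" "s0 \<in> N" "N \<subseteq> H"
      using continuous_open_preimage[OF \<Phi>(1) H(1) B(2)] B(3) s0 by (auto simp: N_def)
    have eN: "e ` N \<subseteq> S"
    proof
      fix t assume "t \<in> e ` N"
      then obtain s where s: "s \<in> H" "\<Phi> s \<in> B" "t = e s" by (auto simp: N_def)
      then have "\<psi> t = orbit G (\<Phi> s)" "t \<in> W" using \<Phi>(3) H(3) by auto
      then show "t \<in> S" using s(2) by (simp add: S_def top_of_open_subspace_plane)
    qed
    have comp: "((\<lambda>t. lsec B (\<psi> t) $ i) \<circ> e) holomorphic_on N"
      by (rule holomorphic_on_compose_gen[OF holomorphic_on_subset[OF H(2) N(3)] hol eN])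
    have "((\<lambda>t. lsec B (\<psi> t) $ i) \<circ> e) s = \<Phi> s $ i" if "s \<in> N" for s
    proof -
      have "\<psi> (e s) = orbit G (\<Phi> s)" "\<Phi> s \<in> B" using that \<Phi>(3)[of s] by (auto simp: N_def)
      then show ?thesis using lsec_orbit[OF B(1)] by simp
    qed
    then have "(\<lambda>s. \<Phi> s $ i) holomorphic_on N" by (rule holomorphic_transform[OF comp])
    then show ?thesis using N by (meson holomorphic_derivI)
  qed
  then show ?thesis using H(1) by (simp add: holomorphic_on_open)
qed

lemma short_arc_lift:
  assumes \<phi>: "\<phi> \<in> short_arcs X (orbit G 0)"
  shows "\<exists>A\<in>G. \<exists>c \<Phi>. equiv_lift c A \<Phi> \<and> \<phi> = arc_of \<Phi>"
proof -
  obtain W \<psi> where ext: "\<phi> \<in> extensional (cball 0 1)" and W: "open W" "cball 0 1 \<subseteq> W"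
    and \<psi>: "holomorphic_map (open_subspace complex_plane W) X \<psi>" "\<And>t. t \<in> cball 0 1 \<Longrightarrow> \<phi> t = \<psi> t"
    and zero: "{t \<in> cball 0 1. \<phi> t = orbit G 0} = {0}"
    using \<phi> unfolding short_arcs_def arcs_def by blast
  have cont: "continuous_map (top_of_set W) (top_of X) \<psi>"
    using \<psi>(1) by (simp add: holomorphic_map_def top_of_open_subspace_plane)
  have zero_iff: "\<psi> t = orbit G 0 \<longleftrightarrow> t = 0" if "t \<in> cball 0 1" for t
    using zero \<psi>(2)[OF that] that by auto
  have "openin (top_of X) (orbit G ` (-{0}))" by (rule openin_orbit_image) (simp add: open_Compl)
  then have "openin (top_of_set W) {t \<in> topspace (top_of_set W). \<psi> t \<in> orbit G ` (-{0})}"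
    by (rule openin_continuous_map_preimage[OF cont])
  then have U: "open {t \<in> W. \<psi> t \<in> orbit G ` (-{0})}" using W(1) by (simp add: openin_open_eq)
  have range: "\<psi> t \<in> range (orbit G)" if "t \<in> W" for t
    using cont that by (auto simp: continuous_map_into_X_iff_on Pi_iff)
  have nz: "\<psi> t \<in> orbit G ` (-{0}) \<longleftrightarrow> \<psi> t \<noteq> orbit G 0" if "t \<in> W" for t
    using range[OF that] orbit_eq_orbit_0_iff by (metis ComplD ComplI image_iff rangeE singletonD singletonI)
  \<comment> \<open>Outside the closed disc the extension may return to the singular point. Such
    points are discarded, while the open unit disc keeps the one legitimate zero.\<close>
  define W' where "W' = {t \<in> W. \<psi> t \<in> orbit G ` (-{0})} \<union> ball 0 1"
  have W': "open W'" "cball 0 1 \<subseteq> W'" "W' \<subseteq> W"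
  proof -
    show "open W'" using U by (auto simp: W'_def)
    show "W' \<subseteq> W" using W(2) by (auto simp: W'_def)
    show "cball 0 1 \<subseteq> W'"
    proof
      fix t :: complex assume t: "t \<in> cball 0 1"
      then have "t \<in> W" using W(2) by blast
      then have "t = 0 \<or> t \<in> {t \<in> W. \<psi> t \<in> orbit G ` (-{0})}" using nz[of t] zero_iff[OF t] by blast
      then show "t \<in> W'" by (auto simp: W'_def)
    qed
  qed
  have W'0: "t = 0" if t: "t \<in> W'" "\<psi> t = orbit G 0" for t
  proof -
    consider "t \<in> cball 0 1" | "t \<in> W" "\<psi> t \<in> orbit G ` (-{0})"
      using t(1) by (auto simp: W'_def)
    then show ?thesis
    proof cases
      case 1
      then show ?thesis using zero_iff t(2) by blast
    next
      case 2
      then show ?thesis using nz t(2) by blast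
    qed
  qed
  obtain e where e: "e > 0" "(\<Union>x\<in>cball 0 1. ball x e) \<subseteq> W'"
    using compact_subset_open_imp_ball_epsilon_subset[OF compact_cball W'(1,2)] by metis
  \<comment> \<open>With this choice \<open>exp\<close> maps the half plane into the
    \<open>e\<close>-neighbourhood of the closed unit disc, hence into \<open>W'\<close>.\<close>
  define c where "c = ln (1 + e)"
  have c: "c > 0" "exp c = 1 + e" using e(1) by (auto simp: c_def)
  have ball: "t \<in> W'" if "norm t < exp c" for t
  proof (cases "norm t \<le> 1")
    case True
    then show ?thesis using W'(2) by auto
  next
    case False
    then have "t \<noteq> 0" by auto
    have "norm (t / norm t - t) = norm (t * (1 / norm t - 1))" by (simp add: algebra_simps)
    also have "\<dots> = norm t * \<bar>1 / norm t - 1\<bar>"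
      by (metis norm_mult norm_of_real of_real_1 of_real_diff of_real_divide)
    also have "\<dots> = norm t - 1" using False \<open>t \<noteq> 0\<close> by (simp add: abs_if field_simps)
    also have "\<dots> < e" using that c by simp
    finally have "t \<in> ball (t / norm t) e" by (simp add: dist_norm)
    moreover have "t / norm t \<in> cball 0 1" using False by (cases "t = 0") (simp_all add: norm_divide)
    ultimately show ?thesis using e(2) by blast
  qed
  have expW: "exp s \<in> W'" if "s \<in> half_plane c" for s using ball[of "exp s"] that by simp
  have cont_exp: "continuous_map (top_of_set (half_plane c)) (top_of X) (\<lambda>s. \<psi> (exp s))"
  proof -
    have "continuous_map (top_of_set (half_plane c)) (top_of_set W) exp"
      using expW W'(3) by (auto intro!: continuous_intros simp: image_subset_iff)
    from continuous_map_compose[OF this cont] show ?thesis by (simp add: o_def)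
  qed
  have "1 \<in> W" by (rule subsetD[OF W(2)]) simp
  then obtain a where a: "\<psi> 1 = orbit G a" using range[of 1] by blast
  obtain \<Phi> where \<Phi>: "continuous_on (half_plane c) \<Phi>" "\<And>s. s \<in> half_plane c \<Longrightarrow> \<Phi> s \<noteq> 0"
    "\<And>s. s \<in> half_plane c \<Longrightarrow> orbit G (\<Phi> s) = \<psi> (exp s)"
  proof (rule lift_to_cover[of "half_plane c" 0 "\<lambda>s. \<psi> (exp s)" a])
    show "\<psi> (exp s) \<noteq> orbit G 0" if "s \<in> half_plane c" for s using W'0[OF expW[OF that]] by auto
    fix g assume g: "continuous_on (half_plane c) g" "\<And>s. s \<in> half_plane c \<Longrightarrow> g s \<noteq> 0" "g 0 = a"
      "\<And>s. s \<in> half_plane c \<Longrightarrow> orbit G (g s) = \<psi> (exp s)"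
    show thesis by (rule that[OF g(1,2,4)])
  qed (use convex_half_plane cont_exp c a in simp_all)
  have hol: "(\<lambda>s. \<Phi> s $ i) holomorphic_on half_plane c" for i
    by (rule holomorphic_lift[OF \<psi>(1) W(1) open_half_plane _ _ \<Phi>])
       (use expW W'(3) in \<open>auto intro: holomorphic_on_exp\<close>)
  have shift: "s + period \<in> half_plane c \<longleftrightarrow> s \<in> half_plane c" for s by simp
  have exp_shift: "exp (s + period) = exp s" for s by (simp add: exp_add)
  \<comment> \<open>Both the lift and its translate by the period lie over the same map, so they
    differ by one element of \<open>G\<close>: the monodromy.\<close>
  have "\<exists>A\<in>G. \<forall>s\<in>half_plane c. \<Phi> (s + period) = A *v \<Phi> s"
  proof (rule lift_unique[OF convex_connected[OF convex_half_plane] \<Phi>(1,2)])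
    show "continuous_on (half_plane c) (\<lambda>s. \<Phi> (s + period))"
      by (rule continuous_on_compose2[OF \<Phi>(1)]) (auto intro!: continuous_intros)
    show "orbit G (\<Phi> s) = orbit G (\<Phi> (s + period))" if "s \<in> half_plane c" for s
      using \<Phi>(3)[OF that] \<Phi>(3)[of "s + period"] shift[of s] exp_shift[of s] that by metis
  qed
  then obtain A where A: "A \<in> G" "\<And>s. s \<in> half_plane c \<Longrightarrow> \<Phi> (s + period) = A *v \<Phi> s" by blast
  \<comment> \<open>Continuity at 0 only makes some point of the orbit small; the factor
    \<open>op_bound\<close> in the radius makes every point of the orbit small, including the
    lift.\<close>
  have decay: "\<exists>b. \<forall>s. Re s < b \<longrightarrow> norm (\<Phi> s) < \<eta>" if \<eta>: "\<eta> > 0" for \<eta>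
  proof -
    define V where "V = orbit G ` ball 0 (\<eta> / op_bound)"
    have pos: "\<eta> / op_bound > 0" using \<eta> op_bound_ge_1 by simp
    have "openin (top_of X) V" unfolding V_def by (rule openin_orbit_image) simp
    then have "openin (top_of_set W) {t \<in> topspace (top_of_set W). \<psi> t \<in> V}"
      by (rule openin_continuous_map_preimage[OF cont])
    then have "open {t \<in> W. \<psi> t \<in> V}" using W(1) by (simp add: openin_open_eq)
    moreover have "0 \<in> {t \<in> W. \<psi> t \<in> V}"
      using W(2) zero_iff[of 0] pos by (auto simp: V_def)
    ultimately obtain d where d: "d > 0" "ball 0 d \<subseteq> {t \<in> W. \<psi> t \<in> V}" using openE by blast
    have "norm (\<Phi> s) < \<eta>" if s: "Re s < min c (ln d)" for s
    proof -
      have "norm (exp s) < d" using s d(1) by (simp add: exp_less_cancel_iff[of "Re s" "ln d", symmetric] del: exp_less_cancel_iff)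
      then have "exp s \<in> ball 0 d" by simp
      then have "\<psi> (exp s) \<in> V" using d(2) by blast
      then obtain w where w: "norm w < \<eta> / op_bound" "orbit G (\<Phi> s) = orbit G w"
        using \<Phi>(3)[of s] s by (auto simp: V_def)
      then obtain B where B: "B \<in> G" "\<Phi> s = B *v w" using orbit_eq_iff[of w "\<Phi> s"] by auto
      have "norm (\<Phi> s) \<le> op_bound * norm w" unfolding B(2) by (rule norm_action_le[OF B(1)])
      also have "\<dots> < \<eta>" using w(1) op_bound_ge_1 by (simp add: field_simps)
      finally show ?thesis .
    qed
    then show ?thesis by blast
  qed
  have lift: "equiv_lift c A \<Phi>"
    unfolding equiv_lift_def using c(1) hol \<Phi>(2) A(2) decay by simp
  have "\<phi> t = arc_of \<Phi> t" for t
  proof (cases "t \<in> cball 0 1")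
    case True
    show ?thesis
    proof (cases "t = 0")
      case True
      then show ?thesis using \<psi>(2)[of 0] zero_iff[of 0] by (simp add: arc_of_def ext_arc_def)
    next
      case False
      have "Re (Ln t) < c" using True c(1) False
        by (simp add: order.strict_trans1[of "ln (norm t)" 0 c])
      then have "orbit G (\<Phi> (Ln t)) = \<psi> (exp (Ln t))" by (intro \<Phi>(3)) simp
      then show ?thesis using True False \<psi>(2)[of t] by (simp add: arc_of_def ext_arc_def)
    qed
  next
    case False
    then show ?thesis using ext by (simp add: arc_of_def extensional_def)
  qed
  then show ?thesis using A(1) lift by blast
qed

end

section \<open>The model lift with given monodromy\<close>

locale finite_order_matrix =
  fixes A :: "complex^'n^'n" and r :: nat
  assumes r: "r > 0" and order: "((**) A ^^ r) (mat 1) = mat 1"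
begin

definition pw :: "nat \<Rightarrow> complex^'n^'n" where
  "pw j = ((**) A ^^ j) (mat 1)"

definition rt :: "nat \<Rightarrow> complex" where
  "rt k = exp (2 * of_real pi * \<i> * of_nat k / of_nat r)"

text \<open>The projection onto the eigenspace of \<open>A\<close> for the eigenvalue \<open>rt k\<close>.\<close>

definition Pr :: "nat \<Rightarrow> complex^'n \<Rightarrow> complex^'n" where
  "Pr k w = (\<Sum>j<r. (inverse (rt k) ^ j / of_nat r) *s (pw j *v w))"

lemma rt_nz: "rt k \<noteq> 0" by (simp add: rt_def)

lemma rt_power: "rt k = rt 1 ^ k"
  unfolding rt_def exp_of_nat_mult[symmetric] by (simp add: field_simps)

lemma rt_root: "rt k ^ r = 1"
proof -
  have "rt k ^ r = exp (of_nat r * (2 * of_real pi * \<i> * of_nat k / of_nat r))"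
    unfolding rt_def by (rule exp_of_nat_mult[symmetric])
  also have "of_nat r * (2 * of_real pi * \<i> * of_nat k / of_nat r) = (2 * of_nat k * of_real pi) * \<i>"
    using r by (simp add: field_simps)
  also have "exp \<dots> = 1" using exp_2pi_1_nat[of k] by (simp add: ac_simps)
  finally show ?thesis .
qed

lemma rt_eq_iff: "rt j = rt k \<longleftrightarrow> j mod r = k mod r"
  unfolding rt_def using r by (intro complex_root_unity_eq) simp

lemma sum_root: "x ^ r = 1 \<Longrightarrow> (\<Sum>j<r. x ^ j) = (if x = 1 then of_nat r else (0 :: complex))"
  by (simp add: geometric_sum)

lemma pw_Suc: "A *v (pw j *v w) = pw (Suc j) *v w"
  by (simp add: pw_def matrix_vector_mul_assoc)

lemma pw_r: "pw r = mat 1" and pw_0: "pw 0 = mat 1"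
  by (simp_all add: pw_def order)

lemma action_sum: "B *v (\<Sum>j\<in>S. f j) = (\<Sum>j\<in>S. B *v (f j :: complex^'n))"
  using linear_sum[OF matrix_vector_mul_linear[of B]] .

lemma action_smult: "B *v (c *s v) = c *s (B *v (v :: complex^'n))"
  by (simp add: vector_scalar_commute)

lemma Pr_sum: "Pr k (\<Sum>l\<in>S. f l) = (\<Sum>l\<in>S. Pr k (f l))"
  by (simp add: Pr_def action_sum vec.scale_sum_right) (rule sum.swap)

lemma Pr_smult: "Pr k (c *s v) = c *s Pr k v"
  by (simp add: Pr_def action_smult vec.scale_sum_right vec.scale_left_commute mult.commute)

text \<open>Applying \<open>A\<close> shifts the summation index; the terms for 0 and
  \<open>r\<close> agree because both \<open>pw r\<close> and \<open>rt k ^ r\<close> are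
  trivial.\<close>

lemma A_Pr: "A *v Pr k w = rt k *s Pr k w"
proof -
  let ?f = "\<lambda>j. (inverse (rt k) ^ j / of_nat r) *s (pw j *v w)"
  have "rt k * (inverse (rt k) ^ Suc j / of_nat r) = inverse (rt k) ^ j / of_nat r" for j
    using rt_nz[of k] by (simp add: field_simps)
  then have "rt k *s ?f (Suc j) = (inverse (rt k) ^ j / of_nat r) *s (pw (Suc j) *v w)" for j
    by (simp only: vec.scale_scale)
  then have "A *v Pr k w = (\<Sum>j<r. rt k *s ?f (Suc j))"
    by (simp only: Pr_def action_sum action_smult pw_Suc)
  also have "\<dots> = rt k *s (\<Sum>j<r. ?f (Suc j))" by (simp only: vec.scale_sum_right)
  also have "(\<Sum>j<r. ?f (Suc j)) = (\<Sum>j<r. ?f j)"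
  proof -
    have "(\<Sum>j<Suc r. ?f j) = ?f 0 + (\<Sum>j<r. ?f (Suc j))" by (rule sum.lessThan_Suc_shift)
    moreover have "(\<Sum>j<Suc r. ?f j) = (\<Sum>j<r. ?f j) + ?f r" by simp
    moreover have "?f r = ?f 0" by (simp add: pw_r pw_0 power_inverse rt_root)
    ultimately show ?thesis by simp
  qed
  finally show ?thesis by (simp add: Pr_def)
qed

lemma pw_Pr: "pw j *v Pr k w = (rt k ^ j) *s Pr k w"
  by (induction j) (simp_all add: pw_0 pw_Suc[symmetric] action_smult A_Pr mult.commute)

text \<open>Orthogonality of the characters of a cyclic group: on the image of \<open>Pr l\<close>
  the projection \<open>Pr k\<close> multiplies by an average of powers of
  \<open>rt l / rt k\<close>.\<close>

lemma Pr_Pr: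
  assumes "k \<in> {1..r}" "l \<in> {1..r}"
  shows "Pr k (Pr l w) = (if k = l then Pr l w else 0)"
proof -
  have "Pr k (Pr l w) = (\<Sum>j<r. (inverse (rt k) * rt l) ^ j / of_nat r) *s Pr l w"
    unfolding Pr_def[of k] by (simp add: pw_Pr vec.scale_sum_left power_mult_distrib)
  also have "(\<Sum>j<r. (inverse (rt k) * rt l) ^ j / of_nat r) = (if inverse (rt k) * rt l = 1 then 1 else 0)"
  proof -
    have "(inverse (rt k) * rt l) ^ r = 1" by (simp add: power_mult_distrib power_inverse rt_root)
    then show ?thesis using r by (simp only: sum_divide_distrib[symmetric] sum_root) simp
  qed
  also have "inverse (rt k) * rt l = 1 \<longleftrightarrow> rt l = rt k" using rt_nz[of k] by (simp add: field_simps)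
  also have "\<dots> \<longleftrightarrow> k = l"
  proof -
    have "l mod r = k mod r \<longleftrightarrow> k = l"
      using assms by (cases "l = r"; cases "k = r") auto
    then show ?thesis by (simp add: rt_eq_iff)
  qed
  finally show ?thesis by simp
qed

lemma sum_Pr: "(\<Sum>k\<in>{1..r}. Pr k w) = w"
proof -
  have coeff: "(\<Sum>k\<in>{1..r}. inverse (rt k) ^ j / of_nat r) = (if j = 0 then 1 else 0)" if "j < r" for j
  proof -
    let ?y = "inverse (rt j)"
    have "inverse (rt k) ^ j = ?y ^ k" for k
      by (simp add: rt_power[of k] rt_power[of j] power_inverse power_mult[symmetric] mult.commute)
    then have "(\<Sum>k\<in>{1..r}. inverse (rt k) ^ j / of_nat r) = (\<Sum>k\<in>{1..r}. ?y ^ k) / of_nat r"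
      by (simp add: sum_divide_distrib)
    also have "(\<Sum>k\<in>{1..r}. ?y ^ k) = (\<Sum>k<r. ?y ^ Suc k)"
      by (rule sum.reindex_bij_witness[of _ Suc "\<lambda>k. k - 1"]) auto
    also have "\<dots> = ?y * (\<Sum>k<r. ?y ^ k)" by (simp add: sum_distrib_left)
    also have "(\<Sum>k<r. ?y ^ k) = (if ?y = 1 then of_nat r else 0)"
      by (rule sum_root) (simp add: power_inverse rt_root)
    also have "?y = 1 \<longleftrightarrow> j = 0"
      using rt_eq_iff[of j 0] that by (simp add: rt_def)
    finally show ?thesis using r by (simp add: rt_def)
  qed
  have "(\<Sum>k\<in>{1..r}. Pr k w) = (\<Sum>j<r. \<Sum>k\<in>{1..r}. (inverse (rt k) ^ j / of_nat r) *s (pw j *v w))"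
    unfolding Pr_def by (rule sum.swap)
  also have "\<dots> = (\<Sum>j<r. (if j = 0 then 1 else 0) *s (pw j *v w))"
    by (intro sum.cong refl) (simp only: vec.scale_sum_left[symmetric] coeff lessThan_iff)
  also have "\<dots> = (\<Sum>j<r. if j = 0 then pw j *v w else 0)" by (intro sum.cong refl) auto
  also have "\<dots> = w" using r by (simp add: pw_0)
  finally show ?thesis .
qed

text \<open>The one-parameter group acting on the eigenspace for \<open>rt k\<close> with exponent
  \<open>k / r\<close>. Taking \<open>k\<close> from 1 to \<open>r\<close> instead of 0 to
  \<open>r - 1\<close> makes all exponents positive, which is what forces decay; the eigenvalue 1
  gets exponent 1.\<close>

definition M :: "complex \<Rightarrow> complex^'n \<Rightarrow> complex^'n" where
  "M s w = (\<Sum>k\<in>{1..r}. exp (of_nat k * s / of_nat r) *s Pr k w)"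

lemma Pr_M: "k \<in> {1..r} \<Longrightarrow> Pr k (M s w) = exp (of_nat k * s / of_nat r) *s Pr k w"
proof -
  assume k: "k \<in> {1..r}"
  have "Pr k (M s w) = (\<Sum>l\<in>{1..r}. exp (of_nat l * s / of_nat r) *s Pr k (Pr l w))"
    by (simp add: M_def Pr_sum Pr_smult)
  also have "\<dots> = (\<Sum>l\<in>{1..r}. if k = l then exp (of_nat l * s / of_nat r) *s Pr l w else 0)"
    by (intro sum.cong refl) (use k Pr_Pr in auto)
  also have "\<dots> = exp (of_nat k * s / of_nat r) *s Pr k w" using k by simp
  finally show ?thesis .
qed

lemma M_inverse: "M (-s) (M s w) = w"
proof -
  have "M (-s) (M s w) = (\<Sum>k\<in>{1..r}. Pr k w)"
    unfolding M_def[of "-s"]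
    by (intro sum.cong refl) (simp add: Pr_M exp_minus)
  then show ?thesis by (simp only: sum_Pr)
qed

lemma M_period: "M (s + period) w = A *v M s w"
proof -
  have "exp (of_nat k * (s + period) / of_nat r) = exp (of_nat k * s / of_nat r) * rt k" for k
    by (simp add: rt_def exp_add[symmetric] algebra_simps add_divide_distrib)
  then show ?thesis by (simp add: M_def action_sum action_smult A_Pr)
qed

lemma M_smult: "M s (c *s w) = c *s M s w"
  by (simp add: M_def Pr_smult vec.scale_sum_right vec.scale_left_commute mult.commute)

lemma M_0: "M s 0 = 0" using M_smult[of s 0 0] by simp

lemma M_nz: "w \<noteq> 0 \<Longrightarrow> M s w \<noteq> 0"
  by (metis M_0 M_inverse)

lemma M_holomorphic:
  assumes "f holomorphic_on S" "\<And>i. (\<lambda>s. h s $ i) holomorphic_on S"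
  shows "(\<lambda>s. M (f s) (h s) $ i) holomorphic_on S"
  unfolding M_def Pr_def matrix_vector_mult_def
  using assms r by (auto intro!: holomorphic_intros simp: rt_nz)

lemma M_decay:
  assumes "e > 0"
  shows "\<exists>b. \<forall>s. Re s < b \<longrightarrow> norm (M s w) < e"
proof -
  define K where "K = (\<Sum>k\<in>{1..r}. norm (Pr k w)) + 1"
  have K: "K > 0" unfolding K_def by (smt (verit) sum_nonneg norm_ge_zero)
  \<comment> \<open>For negative \<open>Re s\<close> the slowest term is the one with
    \<open>k = 1\<close>, so everything is bounded by \<open>exp (Re s / r) * K\<close>; the second
    bound on \<open>Re s\<close> makes this less than \<open>e\<close>.\<close>
  have "norm (M s w) < e" if s: "Re s < min 0 (r * ln (e / K))" for s
  proof -
    have "norm (M s w) \<le> (\<Sum>k\<in>{1..r}. norm (exp (of_nat k * s / of_nat r) *s Pr k w))"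
      unfolding M_def by (rule norm_sum)
    also have "\<dots> \<le> (\<Sum>k\<in>{1..r}. exp (Re s / r) * norm (Pr k w))"
    proof (rule sum_mono)
      fix k assume k: "k \<in> {1..r}"
      have "real k * Re s \<le> Re s" using mult_right_mono_neg[of 1 "real k" "Re s"] k s by simp
      then have "norm (exp (of_nat k * s / of_nat r)) \<le> exp (Re s / r)"
        using r by (simp add: divide_right_mono Re_divide_of_nat)
      then show "norm (exp (of_nat k * s / of_nat r) *s Pr k w) \<le> exp (Re s / r) * norm (Pr k w)"
        by (simp add: norm_smult_vec mult_right_mono del: norm_exp_eq_Re)
    qed
    also have "\<dots> \<le> exp (Re s / r) * K" by (simp add: K_def sum_distrib_left[symmetric])
    also have "\<dots> < (e / K) * K"
    proof (rule mult_strict_right_mono[OF _ K])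
      have "Re s / r < ln (e / K)" using s r by (simp add: field_simps)
      then have "exp (Re s / r) < exp (ln (e / K))" by simp
      then show "exp (Re s / r) < e / K" using assms K by simp
    qed
    also have "\<dots> = e" using K by simp
    finally show ?thesis .
  qed
  then show ?thesis by blast
qed

lemma M_equiv_lift: "w \<noteq> 0 \<Longrightarrow> c > 0 \<Longrightarrow> equiv_lift c A (\<lambda>s. M s w)"
  unfolding equiv_lift_def
  using M_nz M_period M_decay M_holomorphic[of "\<lambda>s. s" _ "\<lambda>s. w"]
  by (auto intro: holomorphic_on_const holomorphic_on_ident)

text \<open>These are the \<open>w\<close> for which \<open>M s w\<close> is a real multiple of \<open>\<Phi> s\<close> for some \<open>s\<close>. They form
  the image of a real three-dimensional domain, whence the dimension assumption.\<close>

lemma negligible_multiples: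
  assumes dim: "2 \<le> CARD('n)" and \<Phi>: "\<And>i. (\<lambda>s. \<Phi> s $ i) holomorphic_on half_plane c"
  shows "negligible ((\<lambda>(s, \<kappa>). \<kappa> *\<^sub>R M (-s) (\<Phi> s :: complex^'n)) ` (half_plane c \<times> (UNIV :: real set)))"
proof (rule negligible_differentiable_image_lowdim)
  show "DIM(complex \<times> real) < DIM(complex^'n)" using dim by simp
  show "(\<lambda>(s, \<kappa>). \<kappa> *\<^sub>R M (-s) (\<Phi> s)) differentiable_on half_plane c \<times> (UNIV :: real set)"
    unfolding differentiable_on_def
  proof
    fix p assume "p \<in> half_plane c \<times> (UNIV :: real set)"
    then obtain s0 \<kappa>0 where p: "p = (s0, \<kappa>0)" "s0 \<in> half_plane c" by auto
    let ?h = "\<lambda>s. M (-s) (\<Phi> s)"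
    have hol: "(\<lambda>s. ?h s $ i) holomorphic_on half_plane c" for i
      by (rule M_holomorphic) (auto intro!: holomorphic_intros \<Phi>)
    have "((\<lambda>s. ?h s $ i) has_derivative (\<lambda>v. deriv (\<lambda>s. ?h s $ i) s0 * v)) (at s0)" for i
      using holomorphic_derivI[OF hol[of i] open_half_plane p(2)] by (simp add: has_field_derivative_def)
    then have "(?h has_derivative (\<lambda>v. \<chi> i. deriv (\<lambda>s. ?h s $ i) s0 * v)) (at s0)"
      by (rule has_derivative_vec)
    then have "?h differentiable at (fst p)" using p(1) by (auto simp: differentiable_def)
    then have "(\<lambda>x. ?h (fst x)) differentiable at p"
      by (rule differentiable_chain_at[of fst p, unfolded o_def, rotated])
         (auto intro!: bounded_linear_imp_differentiable bounded_linear_fst)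
    then have "(\<lambda>x. snd x *\<^sub>R ?h (fst x)) differentiable at p"
      by (intro differentiable_scaleR) (auto intro!: bounded_linear_imp_differentiable bounded_linear_snd)
    then have "(\<lambda>(s, \<kappa>). \<kappa> *\<^sub>R M (-s) (\<Phi> s)) differentiable at p" by (simp add: case_prod_unfold)
    then show "(\<lambda>(s, \<kappa>). \<kappa> *\<^sub>R M (-s) (\<Phi> s)) differentiable at p within half_plane c \<times> UNIV"
      by (rule differentiable_at_withinI)
  qed
qed

end

text \<open>Two powers of \<open>A\<close> coincide since \<open>G\<close> is finite, and cancelling
  the lower one gives a period.\<close>

lemma (in finite_linear_group) finite_order:
  assumes A: "A \<in> G"
  shows "\<exists>r. finite_order_matrix A r"
proof -
  let ?p = "\<lambda>j. ((**) A ^^ j) (mat 1)"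
  have mem: "?p j \<in> G" for j by (induction j) (auto simp: one_mem mult_mem A)
  have "\<not> inj ?p"
  proof
    assume "inj ?p"
    moreover have "range ?p \<subseteq> G" using mem by auto
    ultimately show False using finite_subset[OF _ finite] finite_imageD by blast
  qed
  then obtain i j where ij: "i < j" "?p i = ?p j" by (metis (no_types, lifting) injI nat_neq_iff)
  have add: "?p (i + k) = ?p i ** ?p k" for i k
    by (induction i) (simp_all add: matrix_mul_lid matrix_mul_assoc)
  obtain B where B: "B ** ?p i = mat 1" using inverse_mem[OF mem[of i]] by metis
  have "?p j = ?p i ** ?p (j - i)" using add[of i "j - i"] ij(1) by simp
  then have "B ** ?p i = (B ** ?p i) ** ?p (j - i)" using ij(2) by (simp add: matrix_mul_assoc[symmetric])
  then have "?p (j - i) = mat 1" using B by (simp add: matrix_mul_lid)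
  then show ?thesis using ij(1) by (intro exI[of _ "j - i"]) (simp add: finite_order_matrix_def)
qed

section \<open>Paths of short arcs\<close>

lemma continuous_map_mtopology_of_iff:
  fixes S :: "'a::metric_space set"
  shows "continuous_map (top_of_set S) (mtopology_of m) f \<longleftrightarrow>
    f \<in> S \<rightarrow> mspace m \<and> (\<forall>x\<in>S. \<forall>e>0. \<exists>d>0. \<forall>y\<in>S. dist y x < d \<longrightarrow> mdist m (f x) (f y) < e)"
proof -
  interpret Metric_space "mspace m" "mdist m" by simp
  show ?thesis
    unfolding mtopology_of_def continuous_map_to_metric
  proof (intro iffI conjI ballI allI impI; (elim conjE)?)
    assume L: "\<forall>x\<in>topspace (top_of_set S). \<forall>e>0. \<exists>U. openin (top_of_set S) U \<and> x \<in> U \<and> (\<forall>y\<in>U. f y \<in> mball (f x) e)"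
    show "f \<in> S \<rightarrow> mspace m"
    proof
      fix x assume "x \<in> S"
      then show "f x \<in> mspace m" using L[rule_format, of x 1] by auto
    qed
    fix x :: 'a and e :: real assume "x \<in> S" "e > 0"
    then obtain U where U: "openin (top_of_set S) U" "x \<in> U" "\<forall>y\<in>U. f y \<in> mball (f x) e"
      using L[rule_format, of x e] by auto
    then show "\<exists>d>0. \<forall>y\<in>S. dist y x < d \<longrightarrow> mdist m (f x) (f y) < e"
      unfolding openin_euclidean_subtopology_iff by (metis in_mball)
  next
    fix x :: 'a and e :: real
    assume R: "f \<in> S \<rightarrow> mspace m" "\<forall>x\<in>S. \<forall>e>0. \<exists>d>0. \<forall>y\<in>S. dist y x < d \<longrightarrow> mdist m (f x) (f y) < e"
      and x: "x \<in> topspace (top_of_set S)" and "e > 0"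
    from x have "x \<in> S" by simp
    then obtain d where d: "d > 0" "\<forall>y\<in>S. dist y x < d \<longrightarrow> mdist m (f x) (f y) < e"
      using R(2) \<open>e > 0\<close> by blast
    show "\<exists>U. openin (top_of_set S) U \<and> x \<in> U \<and> (\<forall>y\<in>U. f y \<in> mball (f x) e)"
      by (intro exI[of _ "S \<inter> ball x d"] conjI)
         (use d R(1) x in \<open>auto simp: openin_open dist_commute\<close>)
  qed
qed

lemma continuous_on_mdist:
  fixes S :: "'a::metric_space set"
  assumes f: "continuous_map (top_of_set S) (mtopology_of m) f"
    and g: "continuous_map (top_of_set S) (mtopology_of m) g"
  shows "continuous_on S (\<lambda>x. mdist m (f x) (g x))"
  unfolding continuous_on_iff
proof (intro ballI allI impI)
  fix x and e :: real assume x: "x \<in> S" and e: "e > 0"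
  have F: "f \<in> S \<rightarrow> mspace m" "g \<in> S \<rightarrow> mspace m" using f g by (auto simp: continuous_map_mtopology_of_iff)
  obtain d1 where d1: "d1 > 0" "\<forall>y\<in>S. dist y x < d1 \<longrightarrow> mdist m (f x) (f y) < e / 2"
    using f x e unfolding continuous_map_mtopology_of_iff by (meson half_gt_zero)
  obtain d2 where d2: "d2 > 0" "\<forall>y\<in>S. dist y x < d2 \<longrightarrow> mdist m (g x) (g y) < e / 2"
    using g x e unfolding continuous_map_mtopology_of_iff by (meson half_gt_zero)
  have "dist (mdist m (f y) (g y)) (mdist m (f x) (g x)) < e" if y: "y \<in> S" "dist y x < min d1 d2" for y
  proof -
    have mem: "f x \<in> mspace m" "f y \<in> mspace m" "g x \<in> mspace m" "g y \<in> mspace m" using F x y by auto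
    have "mdist m (f x) (f y) < e / 2" "mdist m (g x) (g y) < e / 2" using d1 d2 y by auto
    moreover have "mdist m (f y) (g y) \<le> mdist m (f x) (f y) + mdist m (f x) (g x) + mdist m (g x) (g y)"
      using mdist_triangle[of "f y" m "f x" "g y"] mdist_triangle[of "f x" m "g x" "g y"] mem
      by (simp add: mdist_commute[of m "f y" "f x"])
    moreover have "mdist m (f x) (g x) \<le> mdist m (f x) (f y) + mdist m (f y) (g y) + mdist m (g x) (g y)"
      using mdist_triangle[of "f x" m "f y" "g x"] mdist_triangle[of "f y" m "g y" "g x"] mem
      by (simp add: mdist_commute[of m "g y" "g x"])
    ultimately show ?thesis by (simp add: dist_real_def)
  qed
  then show "\<exists>d>0. \<forall>y\<in>S. dist y x < d \<longrightarrow> dist (mdist m (f y) (g y)) (mdist m (f x) (g x)) < e"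
    using d1 d2 by (intro exI[of _ "min d1 d2"]) auto
qed

text \<open>A jointly continuous family over compact sets is a continuous path in the supremum
  metric. The proof uses uniform continuity of the real function \<open>D\<close>, the distance to
  the member at \<open>x0\<close>, which vanishes at \<open>x0\<close>.\<close>

lemma continuous_map_into_cfunspace:
  fixes F :: "'a::metric_space \<Rightarrow> 'b::metric_space \<Rightarrow> 'c"
  assumes F: "continuous_map (top_of_set (I \<times> K)) (mtopology_of m) (\<lambda>(x, t). F x t)"
    and I: "compact I" and K: "compact K"
  shows "continuous_map (top_of_set I) (mtopology_of (cfunspace (top_of_set K) m)) (\<lambda>x. restrict (F x) K)"
proof -
  have slice: "continuous_map (top_of_set K) (mtopology_of m) (F x)" if x: "x \<in> I" for x
  proof -
    have "continuous_map (top_of_set K) (top_of_set (I \<times> K)) (\<lambda>t. (x, t))"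
      using x by (auto intro!: continuous_intros)
    from continuous_map_compose[OF this F] show ?thesis by (simp add: o_def)
  qed
  have mem: "restrict (F x) K \<in> mspace (cfunspace (top_of_set K) m)" if x: "x \<in> I" for x
  proof -
    have "continuous_map (top_of_set K) (mtopology_of m) (restrict (F x) K)"
      by (rule continuous_map_eq[OF slice[OF x]]) auto
    moreover have "F x t \<in> mspace m" if "t \<in> K" for t
      using slice[OF x] that unfolding continuous_map_mtopology_of_iff by auto
    moreover have "compactin (top_of_set K) (topspace (top_of_set K))" using K by simp
    ultimately show ?thesis unfolding compactin_mspace_cfunspace[OF \<open>compactin _ _\<close>] by auto
  qed
  show ?thesis
    unfolding continuous_map_mtopology_of_iff[of I "cfunspace (top_of_set K) m"]
  proof (intro conjI ballI allI impI)
    show "(\<lambda>x. restrict (F x) K) \<in> I \<rightarrow> mspace (cfunspace (top_of_set K) m)" using mem by blast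
    fix x0 and e :: real assume x0: "x0 \<in> I" and e: "e > 0"
    define D where "D = (\<lambda>(x, t). mdist m (F x t) (F x0 t))"
    have "continuous_map (top_of_set (I \<times> K)) (top_of_set K) snd"
      by (auto intro!: continuous_intros)
    from continuous_map_compose[OF this slice[OF x0]]
    have "continuous_map (top_of_set (I \<times> K)) (mtopology_of m) (\<lambda>y. F x0 (snd y))" by (simp add: o_def)
    from continuous_on_mdist[OF F this] have "continuous_on (I \<times> K) D"
      by (simp add: D_def case_prod_unfold)
    then have "uniformly_continuous_on (I \<times> K) D"
      using I K by (intro compact_uniformly_continuous compact_Times)
    then obtain d where d: "d > 0" "\<And>y y'. y \<in> I \<times> K \<Longrightarrow> y' \<in> I \<times> K \<Longrightarrow> dist y' y < d \<Longrightarrow> dist (D y') (D y) < e / 2"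
      using e unfolding uniformly_continuous_on_def by (meson half_gt_zero)
    have F_mem: "F x t \<in> mspace m" if "x \<in> I" "t \<in> K" for x t
      using slice[OF that(1)] that(2) unfolding continuous_map_mtopology_of_iff by auto
    have "mdist (cfunspace (top_of_set K) m) (restrict (F x0) K) (restrict (F x) K) < e"
      if x: "x \<in> I" "dist x x0 < d" for x
    proof -
      have "mdist m (restrict (F x0) K t) (restrict (F x) K t) \<le> e / 2" if t: "t \<in> topspace (top_of_set K)" for t
      proof -
        have "dist (D (x, t)) (D (x0, t)) < e / 2"
          using x x0 t by (intro d(2)) (auto simp: dist_Pair_Pair)
        moreover have "D (x0, t) = 0" using F_mem[OF x0] t by (simp add: D_def)
        ultimately have "mdist m (F x t) (F x0 t) < e / 2" by (simp add: D_def dist_real_def)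
        then show ?thesis using t by (simp add: mdist_commute[of m "F x0 t"])
      qed
      then have "mdist (cfunspace (top_of_set K) m) (restrict (F x0) K) (restrict (F x) K) \<le> e / 2"
        using e by (intro mdist_cfunspace_le) auto
      then show ?thesis using e by simp
    qed
    then show "\<exists>d>0. \<forall>x\<in>I. dist x x0 < d \<longrightarrow>
        mdist (cfunspace (top_of_set K) m) (restrict (F x0) K) (restrict (F x) K) < e"
      using d(1) by blast
  qed
qed

section \<open>Strata of short arcs with given monodromy\<close>

context isolated_quotient
begin

definition stratum :: "complex^'n^'n \<Rightarrow> (complex \<Rightarrow> (complex^'n) set) set" where
  "stratum A = {arc_of \<Phi> | c \<Phi>. equiv_lift c A \<Phi>}"

abbreviation Sh where "Sh m \<equiv> ShArc X (orbit G 0) m"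

lemma short_arcs_eq_strata: "short_arcs X (orbit G 0) = (\<Union>A\<in>G. stratum A)"
proof (intro equalityI subsetI)
  fix \<phi> assume "\<phi> \<in> short_arcs X (orbit G 0)"
  from short_arc_lift[OF this] show "\<phi> \<in> (\<Union>A\<in>G. stratum A)" by (auto simp: stratum_def)
next
  fix \<phi> assume "\<phi> \<in> (\<Union>A\<in>G. stratum A)"
  then obtain A c \<Phi> where "A \<in> G" "equiv_lift c A \<Phi>" "\<phi> = arc_of \<Phi>" by (auto simp: stratum_def)
  then show "\<phi> \<in> short_arcs X (orbit G 0)" using arc_of_short_arc by simp
qed

text \<open>Translating a lift by the conjugating element changes its monodromy from
  \<open>A\<close> to \<open>B\<close> but not the arc below.\<close>

lemma stratum_conjugate:
  assumes AB: "A \<in> G" "B \<in> G" "conjugate A B"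
  shows "stratum A \<subseteq> stratum B"
proof
  fix \<phi> assume "\<phi> \<in> stratum A"
  then obtain c \<Phi> where \<Phi>: "equiv_lift c A \<Phi>" "\<phi> = arc_of \<Phi>" by (auto simp: stratum_def)
  obtain C where C: "C \<in> G" "C ** A = B ** C" using AB by (auto simp: conjugate_def)
  have "equiv_lift c B (\<lambda>s. C *v \<Phi> s)"
    unfolding equiv_lift_def
  proof (intro conjI allI impI)
    show "c > 0" using equiv_liftD(1)[OF \<Phi>(1)] .
    show "(\<lambda>s. (C *v \<Phi> s) $ i) holomorphic_on half_plane c" for i
      unfolding matrix_vector_mult_def using equiv_liftD(2)[OF \<Phi>(1)] by (auto intro!: holomorphic_intros)
    show "C *v \<Phi> s \<noteq> 0" if "Re s < c" for s using equiv_liftD(3)[OF \<Phi>(1) that] C(1) by (simp add: action_eq_0_iff)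
    show "C *v \<Phi> (s + period) = B *v (C *v \<Phi> s)" if "Re s < c" for s
      by (simp add: equiv_liftD(4)[OF \<Phi>(1) that] matrix_vector_mul_assoc C(2))
    fix e :: real assume "e > 0"
    then have "e / op_bound > 0" using op_bound_ge_1 by simp
    then obtain b where b: "\<forall>s. Re s < b \<longrightarrow> norm (\<Phi> s) < e / op_bound" using equiv_liftD(5)[OF \<Phi>(1)] by blast
    have "norm (C *v \<Phi> s) < e" if "Re s < b" for s
    proof -
      have "norm (C *v \<Phi> s) \<le> op_bound * norm (\<Phi> s)" by (rule norm_action_le[OF C(1)])
      also have "\<dots> < e" using b that op_bound_ge_1 by (simp add: field_simps)
      finally show ?thesis .
    qed
    then show "\<exists>b. \<forall>s. Re s < b \<longrightarrow> norm (C *v \<Phi> s) < e" by blast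
  qed
  moreover have "arc_of (\<lambda>s. C *v \<Phi> s) = \<phi>"
    using C(1) orbit_action[OF C(1), of 0] unfolding \<Phi>(2) arc_of_def ext_arc_def
    by (intro restrict_ext) (auto simp del: orbit_action simp: orbit_action[OF C(1)])
  ultimately show "\<phi> \<in> stratum B" by (auto simp: stratum_def)
qed

lemma stratum_eq: "A \<in> G \<Longrightarrow> B \<in> G \<Longrightarrow> conjugate A B \<Longrightarrow> stratum A = stratum B"
  using stratum_conjugate conjugate_sym by blast

text \<open>Two lifts of one arc differ by a constant \<open>C\<close> on the closed left half
  plane, where the arc determines the orbits. Comparing at 0 and at the period gives
  \<open>C ** A = B ** C\<close>.\<close>

lemma strata_meet_imp_conjugate:
  assumes AB: "A \<in> G" "B \<in> G" and \<phi>: "\<phi> \<in> stratum A" "\<phi> \<in> stratum B"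
  shows "conjugate A B"
proof -
  obtain c \<Phi> where \<Phi>: "equiv_lift c A \<Phi>" "\<phi> = arc_of \<Phi>" using \<phi>(1) by (auto simp: stratum_def)
  obtain d \<Psi> where \<Psi>: "equiv_lift d B \<Psi>" "\<phi> = arc_of \<Psi>" using \<phi>(2) by (auto simp: stratum_def)
  have cd: "c > 0" "d > 0" using equiv_liftD(1) \<Phi>(1) \<Psi>(1) by auto
  let ?H = "{s. Re s \<le> 0}"
  have "\<exists>C\<in>G. \<forall>s\<in>?H. \<Psi> s = C *v \<Phi> s"
  proof (rule lift_unique)
    show "connected ?H" using convex_connected[OF convex_halfspace_Re_le] .
    show "continuous_on ?H \<Phi>"
      by (rule continuous_on_subset[OF equiv_lift_continuous[OF \<Phi>(1)]]) (use cd in auto)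
    show "continuous_on ?H \<Psi>"
      by (rule continuous_on_subset[OF equiv_lift_continuous[OF \<Psi>(1)]]) (use cd in auto)
    show "\<Phi> s \<noteq> 0" if "s \<in> ?H" for s using equiv_liftD(3)[OF \<Phi>(1), of s] cd that by simp
    show "orbit G (\<Phi> s) = orbit G (\<Psi> s)" if "s \<in> ?H" for s
      using arc_of_exp[OF AB(1) \<Phi>(1), of s] arc_of_exp[OF AB(2) \<Psi>(1), of s] \<Phi>(2) \<Psi>(2) that by simp
  qed
  then obtain C where C: "C \<in> G" "\<forall>s\<in>?H. \<Psi> s = C *v \<Phi> s" by blast
  have "\<Psi> period = C *v \<Phi> period" "\<Psi> 0 = C *v \<Phi> 0" using C(2) by auto
  moreover have "\<Psi> period = B *v \<Psi> 0" "\<Phi> period = A *v \<Phi> 0"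
    using equiv_liftD(4)[OF \<Psi>(1), of 0] equiv_liftD(4)[OF \<Phi>(1), of 0] cd by auto
  ultimately have "(C ** A) *v \<Phi> 0 = (B ** C) *v \<Phi> 0" by (simp add: matrix_vector_mul_assoc[symmetric])
  then have "C ** A = B ** C"
    by (rule action_inj_matrix) (use equiv_liftD(3)[OF \<Phi>(1), of 0] cd C AB mult_mem in auto)
  then show ?thesis using C(1) by (auto simp: conjugate_def)
qed

lemma short_arc_in_cfunspace:
  assumes m: "mtopology_of m = top_of X" and \<phi>: "\<phi> \<in> short_arcs X (orbit G 0)"
  shows "\<phi> \<in> mspace (cfunspace (top_of_set (cball 0 1)) m)"
proof -
  obtain A c \<Phi> where A: "A \<in> G" and \<Phi>: "equiv_lift c A \<Phi>" "\<phi> = arc_of \<Phi>" using short_arc_lift[OF \<phi>] by blast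
  have "cball 0 1 \<subseteq> ball (0::complex) (exp c)" by (rule cball_subset_ball_exp[OF equiv_liftD(1)[OF \<Phi>(1)]])
  then have "continuous_map (top_of_set (cball 0 1)) (top_of X) (ext_arc \<Phi>)"
    by (rule continuous_map_from_subtopology_mono[OF continuous_map_ext_arc[OF A \<Phi>(1)]])
  then have "continuous_map (top_of_set (cball 0 1)) (mtopology_of m) \<phi>"
    unfolding m \<Phi>(2) arc_of_def by (rule continuous_map_eq) auto
  moreover have "compactin (top_of_set (cball 0 1)) (topspace (top_of_set (cball (0::complex) 1)))" by simp
  moreover have "\<phi> \<in> extensional (cball 0 1)" by (simp add: \<Phi>(2) arc_of_def)
  ultimately show ?thesis
    unfolding compactin_mspace_cfunspace[OF \<open>compactin _ _\<close>]
    by (auto simp: continuous_map_mtopology_of_iff)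
qed

lemma topspace_Sh: "mtopology_of m = top_of X \<Longrightarrow> topspace (Sh m) = short_arcs X (orbit G 0)"
  unfolding ShArc_def topspace_subtopology topspace_mtopology_of using short_arc_in_cfunspace by blast

text \<open>Convex combinations inherit holomorphy, equivariance and uniform decay, so with zeros
  excluded every member is again a lift; continuity in the supremum metric follows by descent along
  \<open>exp\<close>.\<close>

lemma segment_connected:
  assumes m: "mtopology_of m = top_of X" and A: "A \<in> G"
    and \<Phi>0: "equiv_lift c A \<Phi>0" and \<Phi>1: "equiv_lift c A \<Phi>1"
    and nz: "\<And>x s. x \<in> {0..1} \<Longrightarrow> Re s < c \<Longrightarrow> (1 - x) *\<^sub>R \<Phi>0 s + x *\<^sub>R \<Phi>1 s \<noteq> 0"
  shows "\<exists>K. connectedin (Sh m) K \<and> K \<subseteq> stratum A \<and> arc_of \<Phi>0 \<in> K \<and> arc_of \<Phi>1 \<in> K"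
proof -
  define \<Phi> where "\<Phi> x s = (1 - x) *\<^sub>R \<Phi>0 s + x *\<^sub>R \<Phi>1 s" for x :: real and s
  let ?I = "{0..1} :: real set"
  have c: "c > 0" using equiv_liftD(1)[OF \<Phi>0] .
  have per: "\<Phi> x (s + period) = A *v \<Phi> x s" if "Re s < c" for x s
    using equiv_liftD(4)[OF \<Phi>0 that] equiv_liftD(4)[OF \<Phi>1 that]
    by (simp add: \<Phi>_def matrix_vector_right_distrib action_scaleR)
  have decay: "\<exists>b. \<forall>x\<in>?I. \<forall>s. Re s < b \<longrightarrow> norm (\<Phi> x s) < e" if "e > 0" for e
  proof -
    obtain b0 where b0: "\<forall>s. Re s < b0 \<longrightarrow> norm (\<Phi>0 s) < e / 2"
      using equiv_liftD(5)[OF \<Phi>0, of "e / 2"] \<open>e > 0\<close> by auto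
    obtain b1 where b1: "\<forall>s. Re s < b1 \<longrightarrow> norm (\<Phi>1 s) < e / 2"
      using equiv_liftD(5)[OF \<Phi>1, of "e / 2"] \<open>e > 0\<close> by auto
    have "norm (\<Phi> x s) < e" if x: "x \<in> ?I" and s: "Re s < min b0 b1" for x s
    proof -
      have "norm (\<Phi> x s) \<le> norm ((1 - x) *\<^sub>R \<Phi>0 s) + norm (x *\<^sub>R \<Phi>1 s)"
        unfolding \<Phi>_def by (rule norm_triangle_ineq)
      also have "\<dots> \<le> norm (\<Phi>0 s) + norm (\<Phi>1 s)"
        using x by (intro add_mono) (auto intro: mult_left_le_one_le)
      also have "\<dots> < e / 2 + e / 2" using b0 b1 s by (intro add_strict_mono) auto
      finally show ?thesis by simp
    qed
    then show ?thesis by blast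
  qed
  have lift: "equiv_lift c A (\<Phi> x)" if x: "x \<in> ?I" for x
    unfolding equiv_lift_def
  proof (intro conjI allI impI)
    show "(\<lambda>s. \<Phi> x s $ i) holomorphic_on half_plane c" for i
      using equiv_liftD(2)[OF \<Phi>0] equiv_liftD(2)[OF \<Phi>1]
      by (auto simp: \<Phi>_def scaleR_conv_of_real intro!: holomorphic_intros)
    show "\<Phi> x s \<noteq> 0" if "Re s < c" for s using nz[OF x that] by (simp add: \<Phi>_def)
    show "\<exists>b. \<forall>s. Re s < b \<longrightarrow> norm (\<Phi> x s) < e" if "e > 0" for e using decay[OF that] x by blast
  qed (use c per in auto)
  have "continuous_on (?I \<times> half_plane c) (\<lambda>y. \<Phi> (fst y) (snd y))"
    unfolding \<Phi>_def
    by (intro continuous_intros continuous_on_compose2[OF equiv_lift_continuous[OF \<Phi>0]]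
        continuous_on_compose2[OF equiv_lift_continuous[OF \<Phi>1]]) auto
  then have "continuous_on (?I \<times> half_plane c) (\<lambda>(x, s). \<Phi> x s)" by (simp add: case_prod_unfold)
  from continuous_on_exp_descent[OF A this per decay]
  have desc: "continuous_on (?I \<times> ball 0 (exp c)) (\<lambda>(x, t). proj (if t = 0 then 0 else \<Phi> x (Ln t)))" by blast
  have "continuous_on (?I \<times> cball 0 1) (\<lambda>(x, t). proj (if t = 0 then 0 else \<Phi> x (Ln t)))"
    by (rule continuous_on_subset[OF desc]) (use cball_subset_ball_exp[OF c] in auto)
  then have "continuous_map (top_of_set (?I \<times> cball 0 1)) (mtopology_of m) (\<lambda>(x, t). ext_arc (\<Phi> x) t)"
    unfolding m continuous_map_into_X_iff_on by (auto simp: case_prod_unfold ext_arc_def proj_def)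
  from continuous_map_into_cfunspace[OF this compact_Icc compact_cball]
  have cont: "continuous_map (top_of_set ?I) (mtopology_of (cfunspace (top_of_set (cball 0 1)) m)) (\<lambda>x. arc_of (\<Phi> x))"
    by (simp add: arc_of_def)
  have "continuous_map (top_of_set ?I) (Sh m) (\<lambda>x. arc_of (\<Phi> x))"
    unfolding ShArc_def continuous_map_in_subtopology
    using cont arc_of_short_arc[OF A lift] by auto
  then have "connectedin (Sh m) ((\<lambda>x. arc_of (\<Phi> x)) ` ?I)"
    by (rule connectedin_continuous_map_image) (simp add: connectedin_subtopology)
  moreover have "(\<lambda>x. arc_of (\<Phi> x)) ` ?I \<subseteq> stratum A" using lift unfolding stratum_def by blast
  moreover have "arc_of \<Phi>0 = arc_of (\<Phi> 0)" "arc_of \<Phi>1 = arc_of (\<Phi> 1)" by (simp_all add: \<Phi>_def[abs_def])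
  ultimately show ?thesis by (intro exI[of _ "(\<lambda>x. arc_of (\<Phi> x)) ` ?I"]) auto
qed

lemma stratum_pair_connected:
  assumes m: "mtopology_of m = top_of X" and A: "A \<in> G" and \<phi>: "\<phi>0 \<in> stratum A" "\<phi>1 \<in> stratum A"
  shows "\<exists>K. connectedin (Sh m) K \<and> K \<subseteq> stratum A \<and> \<phi>0 \<in> K \<and> \<phi>1 \<in> K"
proof -
  obtain c0 \<Phi>0 where \<Phi>0: "equiv_lift c0 A \<Phi>0" "\<phi>0 = arc_of \<Phi>0" using \<phi>(1) by (auto simp: stratum_def)
  obtain c1 \<Phi>1 where \<Phi>1: "equiv_lift c1 A \<Phi>1" "\<phi>1 = arc_of \<Phi>1" using \<phi>(2) by (auto simp: stratum_def)
  define c where "c = min c0 c1"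
  have c: "c > 0" using equiv_liftD(1)[OF \<Phi>0(1)] equiv_liftD(1)[OF \<Phi>1(1)] by (simp add: c_def)
  have lift0: "equiv_lift c A \<Phi>0" and lift1: "equiv_lift c A \<Phi>1"
    using equiv_lift_mono[OF \<Phi>0(1) c] equiv_lift_mono[OF \<Phi>1(1) c] by (simp_all add: c_def)
  obtain r where "finite_order_matrix A r" using finite_order[OF A] by blast
  then interpret finite_order_matrix A r .
  let ?bad = "\<lambda>\<Phi>. (\<lambda>(s, \<kappa>). \<kappa> *\<^sub>R M (-s) (\<Phi> s :: complex^'n)) ` (half_plane c \<times> (UNIV :: real set))"
  have "negligible (?bad \<Phi>0 \<union> ?bad \<Phi>1)"
    using negligible_multiples[OF dim equiv_liftD(2)[OF lift0]] negligible_multiples[OF dim equiv_liftD(2)[OF lift1]]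
    by (rule negligible_Un)
  then have "?bad \<Phi>0 \<union> ?bad \<Phi>1 \<noteq> UNIV" using non_negligible_UNIV by metis
  then obtain w where w: "w \<notin> ?bad \<Phi>0" "w \<notin> ?bad \<Phi>1" by blast
  \<comment> \<open>The coefficient \<open>\<kappa> = 0\<close> puts 0 into the bad set, so avoiding
    that set already makes \<open>w\<close> nonzero.\<close>
  have "w \<noteq> 0"
  proof
    assume "w = 0"
    then have "w = (\<lambda>(s, \<kappa>). \<kappa> *\<^sub>R M (-s) (\<Phi>0 s)) (0, 0)" by simp
    then show False using w(1) c by (metis (no_types, lifting) UNIV_I image_eqI mem_Collect_eq mem_Sigma_iff zero_complex.sel(1))
  qed
  have liftM: "equiv_lift c A (\<lambda>s. M s w)" by (rule M_equiv_lift[OF \<open>w \<noteq> 0\<close> c])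
  have nz: "(1 - x) *\<^sub>R \<Phi> s + x *\<^sub>R M s w \<noteq> 0"
    if lift: "equiv_lift c A \<Phi>" and bad: "w \<notin> ?bad \<Phi>" and x: "x \<in> {0..1}" and s: "Re s < c" for \<Phi> x s
  proof
    assume eq: "(1 - x) *\<^sub>R \<Phi> s + x *\<^sub>R M s w = 0"
    have "x \<noteq> 0" using eq equiv_liftD(3)[OF lift s] by auto
    \<comment> \<open>Solving for \<open>M s w\<close> at a zero of the segment gives this real
      multiple of \<open>\<Phi> s\<close>, and inverting \<open>M s\<close> places \<open>w\<close>
      in the bad set.\<close>
    define \<kappa> where "\<kappa> = - (1 - x) / x"
    have "x *\<^sub>R M s w = - ((1 - x) *\<^sub>R \<Phi> s)" using eq by (simp add: add_eq_0_iff)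
    moreover have "M s w = (1 / x) *\<^sub>R (x *\<^sub>R M s w)" using \<open>x \<noteq> 0\<close> by simp
    ultimately have "M s w = (1 / x) *\<^sub>R (- ((1 - x) *\<^sub>R \<Phi> s))" by simp
    also have "\<dots> = (- ((1 - x) / x)) *\<^sub>R \<Phi> s"
      unfolding scaleR_minus_right scaleR_minus_left scaleR_scaleR by simp
    also have "- ((1 - x) / x) = \<kappa>" by (simp add: \<kappa>_def diff_divide_distrib)
    finally have "M s w = \<kappa> *\<^sub>R \<Phi> s" .
    then have "w = M (-s) (\<kappa> *\<^sub>R \<Phi> s)" by (metis M_inverse)
    also have "\<kappa> *\<^sub>R \<Phi> s = complex_of_real \<kappa> *s \<Phi> s"
      by (simp add: vec_eq_iff) (simp add: scaleR_conv_of_real)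
    also have "M (-s) (complex_of_real \<kappa> *s \<Phi> s) = complex_of_real \<kappa> *s M (-s) (\<Phi> s)" by (rule M_smult)
    also have "\<dots> = \<kappa> *\<^sub>R M (-s) (\<Phi> s)"
      by (simp add: vec_eq_iff) (simp add: scaleR_conv_of_real)
    finally have "w = (\<lambda>(s, \<kappa>). \<kappa> *\<^sub>R M (-s) (\<Phi> s)) (s, \<kappa>)" by simp
    then show False using bad s by blast
  qed
  obtain K0 where K0: "connectedin (Sh m) K0" "K0 \<subseteq> stratum A" "arc_of \<Phi>0 \<in> K0" "arc_of (\<lambda>s. M s w) \<in> K0"
    using segment_connected[OF m A lift0 liftM nz[OF lift0 w(1)]] by blast
  obtain K1 where K1: "connectedin (Sh m) K1" "K1 \<subseteq> stratum A" "arc_of \<Phi>1 \<in> K1" "arc_of (\<lambda>s. M s w) \<in> K1"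
    using segment_connected[OF m A lift1 liftM nz[OF lift1 w(2)]] by blast
  have "connectedin (Sh m) (K0 \<union> K1)"
    by (rule connectedin_Un[OF K0(1) K1(1)]) (use K0 K1 in blast)
  then show ?thesis using K0 K1 \<Phi>0(2) \<Phi>1(2) by blast
qed

lemma stratum_nonempty:
  assumes A: "A \<in> G"
  shows "stratum A \<noteq> {}"
proof -
  obtain r where "finite_order_matrix A r" using finite_order[OF A] by blast
  then interpret finite_order_matrix A r .
  have "equiv_lift 1 A (\<lambda>s. M s (axis undefined 1))"
    by (rule M_equiv_lift) (auto simp: axis_eq_0_iff)
  then show ?thesis by (auto simp: stratum_def)
qed

lemma stratum_connected:
  assumes m: "mtopology_of m = top_of X" and A: "A \<in> G"
  shows "connectedin (Sh m) (stratum A)"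
proof -
  obtain \<phi>0 where \<phi>0: "\<phi>0 \<in> stratum A" using stratum_nonempty[OF A] by blast
  let ?U = "{K. connectedin (Sh m) K \<and> K \<subseteq> stratum A \<and> \<phi>0 \<in> K}"
  have "stratum A = \<Union>?U" using stratum_pair_connected[OF m A \<phi>0] by blast
  moreover have "connectedin (Sh m) (\<Union>?U)" by (rule connectedin_Union) auto
  ultimately show ?thesis by simp
qed

end

section \<open>Connected components of the space of short arcs\<close>

text \<open>A uniform version of the continuity of \<open>f\<close> along a compact curve: it compares the metric
  \<open>m\<close> of the space with the one induced by \<open>f\<close>.\<close>

lemma uniform_continuity_along_compact:
  fixes f :: "'a \<Rightarrow> 'b::metric_space" and \<gamma> :: "real \<Rightarrow> 'a"
  assumes f: "continuous_map (mtopology_of m) euclidean f"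
    and \<gamma>: "continuous_map (top_of_set S) (mtopology_of m) \<gamma>" and S: "compact S" and d: "\<delta> > 0"
  shows "\<exists>\<eta>>0. \<forall>y\<in>S. \<forall>x\<in>mspace m. mdist m (\<gamma> y) x < \<eta> \<longrightarrow> dist (f (\<gamma> y)) (f x) < \<delta>"
proof (rule ccontr)
  interpret Metric_space "mspace m" "mdist m" by simp
  assume "\<not> ?thesis"
  then have "\<forall>n::nat. \<exists>y x. y \<in> S \<and> x \<in> mspace m \<and> mdist m (\<gamma> y) x < inverse (Suc n) \<and> \<delta> \<le> dist (f (\<gamma> y)) (f x)"
    by (metis inverse_positive_iff_positive of_nat_0_less_iff not_le zero_less_Suc)
  then obtain y x where yx: "\<And>n::nat. y n \<in> S" "\<And>n. x n \<in> mspace m"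
    "\<And>n. mdist m (\<gamma> (y n)) (x n) < inverse (Suc n)" "\<And>n. \<delta> \<le> dist (f (\<gamma> (y n))) (f (x n))"
    by metis
  obtain l r where l: "l \<in> S" "strict_mono r" "(y \<circ> r) \<longlonglongrightarrow> l"
    using S yx(1) unfolding compact_def by metis
  have \<gamma>S: "\<gamma> t \<in> mspace m" if "t \<in> S" for t
    using \<gamma> that by (auto simp: continuous_map_mtopology_of_iff)
  have "openin mtopology {x \<in> topspace mtopology. f x \<in> ball (f (\<gamma> l)) (\<delta> / 2)}"
    using f by (intro openin_continuous_map_preimage) (auto simp: mtopology_of_def)
  moreover have "\<gamma> l \<in> {x \<in> topspace mtopology. f x \<in> ball (f (\<gamma> l)) (\<delta> / 2)}" using \<gamma>S l(1) d by simp
  ultimately obtain \<rho> where \<rho>: "\<rho> > 0" "mball (\<gamma> l) \<rho> \<subseteq> {x \<in> topspace mtopology. f x \<in> ball (f (\<gamma> l)) (\<delta> / 2)}"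
    unfolding openin_mtopology by blast
  have near: "dist (f (\<gamma> l)) (f z) < \<delta> / 2" if "z \<in> mspace m" "mdist m (\<gamma> l) z < \<rho>" for z
    using \<rho>(2) that \<gamma>S l(1) by (auto simp: subset_iff)
  obtain e where e: "e > 0" "\<forall>t\<in>S. dist t l < e \<longrightarrow> mdist m (\<gamma> l) (\<gamma> t) < \<rho> / 2"
    using \<gamma> l(1) \<rho>(1) unfolding continuous_map_mtopology_of_iff by (meson half_gt_zero)
  obtain N where N: "\<forall>n\<ge>N. dist ((y \<circ> r) n) l < e" using l(3) e(1) unfolding lim_sequentially by blast
  obtain k where k: "inverse (real (Suc k)) < \<rho> / 2" using reals_Archimedean[of "\<rho> / 2"] \<rho>(1) by auto
  define n where "n = r (max N k)"
  have "max N k \<le> n" unfolding n_def by (rule seq_suble[OF l(2)])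
  then have "inverse (real (Suc n)) \<le> inverse (real (Suc k))" by (intro le_imp_inverse_le) auto
  then have d1: "mdist m (\<gamma> (y n)) (x n) < \<rho> / 2" using yx(3)[of n] k by linarith
  have "dist (y n) l < e" using N by (auto simp: n_def)
  then have d2: "mdist m (\<gamma> l) (\<gamma> (y n)) < \<rho> / 2" using e(2) yx(1) by blast
  have "mdist m (\<gamma> l) (x n) < \<rho>"
    using mdist_triangle[OF \<gamma>S[OF l(1)] \<gamma>S[OF yx(1)] yx(2), of n n] d1 d2 by linarith
  then have "dist (f (\<gamma> l)) (f (x n)) < \<delta> / 2" using near yx(2) by blast
  moreover have "dist (f (\<gamma> l)) (f (\<gamma> (y n))) < \<delta> / 2" using near \<gamma>S[OF yx(1)] d2 \<rho>(1) by auto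
  ultimately have "dist (f (\<gamma> (y n))) (f (x n)) < \<delta>"
    using dist_triangle3[of "f (\<gamma> (y n))" "f (x n)" "f (\<gamma> l)"] by linarith
  then show False using yx(4)[of n] by simp
qed

text \<open>Each member is also closed, its complement being the union of the others; a component
  meeting it therefore lies inside it, and contains it by maximality.\<close>

lemma connected_components_of_clopen_partition:
  assumes cover: "topspace T = \<Union>U" and conn: "\<And>S. S \<in> U \<Longrightarrow> connectedin T S"
    and op: "\<And>S. S \<in> U \<Longrightarrow> openin T S" and ne: "{} \<notin> U" and disj: "pairwise disjnt U"
  shows "connected_components_of T = U"
proof -
  have clo: "closedin T S" if S: "S \<in> U" for S
  proof -
    have "S \<inter> S' = {}" if "S' \<in> U - {S}" for S'
      using pairwiseD[OF disj S, of S'] that by (auto simp: disjnt_def)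
    then have "topspace T - S = \<Union>(U - {S})" unfolding cover using S by auto
    moreover have "openin T (\<Union>(U - {S}))" using op by blast
    moreover have "S \<subseteq> topspace T" using cover S by blast
    ultimately show ?thesis by (simp add: closedin_def)
  qed
  have eq: "C = S" if C: "C \<in> connected_components_of T" and S: "S \<in> U" and meet: "\<not> disjnt C S" for C S
  proof
    show "S \<subseteq> C" using connected_components_of_maximal[OF C conn[OF S] meet] .
    show "C \<subseteq> S"
      using connectedin_clopen_cases[OF connectedin_connected_components_of[OF C] clo[OF S] op[OF S]] meet by blast
  qed
  show ?thesis
  proof (intro equalityI subsetI)
    fix C assume C: "C \<in> connected_components_of T"
    then have "C \<noteq> {}" "C \<subseteq> \<Union>U"
      using nonempty_connected_components_of connected_components_of_subset cover by metis+
    then obtain x S where "x \<in> C" "x \<in> S" "S \<in> U" by blast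
    then show "C \<in> U" using eq[OF C, of S] by (auto simp: disjnt_iff)
  next
    fix S assume S: "S \<in> U"
    then have "S \<noteq> {}" using ne by metis
    then obtain x where x: "x \<in> S" by blast
    then have "x \<in> topspace T" using cover S by blast
    then have "x \<in> \<Union>(connected_components_of T)" by (simp add: Union_connected_components_of)
    then obtain C where "C \<in> connected_components_of T" "x \<in> C" by blast
    then show "S \<in> connected_components_of T" using eq[OF _ S] x by (metis disjnt_iff)
  qed
qed

context isolated_quotient
begin

text \<open>Compactness gives a positive minimal displacement for each nontrivial element, and
  finiteness of \<open>G\<close> gives a common one.\<close>

lemma uniform_separation:
  assumes q: "continuous_on S q" "\<And>y. y \<in> S \<Longrightarrow> q y \<noteq> 0" and S: "compact S"
  shows "\<exists>d>0. \<forall>B\<in>G. \<forall>y\<in>S. B \<noteq> mat 1 \<longrightarrow> d \<le> norm (q y - B *v q y)"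
proof -
  have "\<exists>d>0. \<forall>y\<in>S. d \<le> norm (q y - B *v q y)" if B: "B \<in> G - {mat 1}" for B
  proof (cases "S = {}")
    case False
    have "continuous_on S (\<lambda>y. norm (q y - B *v q y))" by (intro continuous_intros q)
    then obtain y0 where y0: "y0 \<in> S" "\<forall>y\<in>S. norm (q y0 - B *v q y0) \<le> norm (q y - B *v q y)"
      using continuous_attains_inf[OF S False] by blast
    have "q y0 \<noteq> B *v q y0"
    proof
      assume "q y0 = B *v q y0"
      then have "B = mat 1" using B by (intro free[OF _ q(2)[OF y0(1)]]) auto
      then show False using B by blast
    qed
    then show ?thesis using y0 by (intro exI[of _ "norm (q y0 - B *v q y0)"]) auto
  qed (auto intro: exI[of _ 1])
  then obtain d where d: "\<And>B. B \<in> G - {mat 1} \<Longrightarrow> d B > 0"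
    "\<And>B y. B \<in> G - {mat 1} \<Longrightarrow> y \<in> S \<Longrightarrow> d B \<le> norm (q y - B *v q y)" by metis
  \<comment> \<open>The inserted 1 keeps the set nonempty when \<open>G\<close> is trivial.\<close>
  define e where "e = Min (insert 1 (d ` (G - {mat 1})))"
  have "e > 0" using d(1) finite by (auto simp: e_def)
  moreover have "e \<le> norm (q y - B *v q y)" if "B \<in> G" "B \<noteq> mat 1" "y \<in> S" for B y
  proof -
    have "e \<le> d B" unfolding e_def using finite that by (intro Min_le) auto
    then show ?thesis using d(2)[of B y] that by simp
  qed
  ultimately show ?thesis by blast
qed

text \<open>At each time exactly one translate of \<open>q'\<close> is close to \<open>q\<close>; it
  is given by a locally constant, hence constant, element \<open>C\<close>. The ends then force
  \<open>C ** B = A ** C\<close>. Uniqueness of \<open>C\<close> needs displacements of at least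
  \<open>(1 + op_bound) * \<delta>\<close>; the extra factor \<open>op_bound\<close> pays for
  applying the inverse of \<open>A\<close> at the end.\<close>

lemma close_lifts_conjugate:
  fixes q q' :: "real \<Rightarrow> complex^'n"
  assumes A: "A \<in> G" and B: "B \<in> G"
    and q: "continuous_on {0..1} q" "q 1 = A *v q 0" and q': "continuous_on {0..1} q'" "q' 1 = B *v q' 0"
    and sep: "\<And>C y. C \<in> G \<Longrightarrow> y \<in> {0..1} \<Longrightarrow> C \<noteq> mat 1 \<Longrightarrow> op_bound * (1 + op_bound) * \<delta> \<le> norm (q y - C *v q y)"
    and close: "\<And>y. y \<in> {0..1} \<Longrightarrow> \<exists>C\<in>G. norm (q y - C *v q' y) < \<delta>"
  shows "conjugate A B"
proof -
  let ?I = "{0..1} :: real set"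
  have "(0::real) \<in> ?I" by simp
  from close[OF this] obtain C0 where "norm (q 0 - C0 *v q' 0) < \<delta>" by blast
  then have \<delta>: "\<delta> > 0" using norm_ge_zero le_less_trans by blast
  have ob: "op_bound \<ge> 1" by (rule op_bound_ge_1)
  have trivial: "C = mat 1" if "C \<in> G" "y \<in> ?I" "norm (q y - C *v q y) < op_bound * (1 + op_bound) * \<delta>" for C y
    using sep[OF that(1,2)] that(3) by fastforce
  have bound1: "(1 + op_bound) * \<delta> \<le> op_bound * (1 + op_bound) * \<delta>"
    using ob \<delta> by (simp add: mult_right_mono mult_le_cancel_right1)
  have unique: "C = D" if C: "C \<in> G" "norm (q y - C *v q' y) < \<delta>" and D: "D \<in> G" "norm (q y - D *v q' y) < \<delta>"
    and y: "y \<in> ?I" for C D y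
  proof -
    obtain C' where C': "C' \<in> G" "C ** C' = mat 1" "C' ** C = mat 1" using inverse_mem[OF C(1)] by metis
    have mem: "D ** C' \<in> G" using mult_mem D C' by blast
    have "(D ** C') *v (C *v q' y) = D *v q' y"
      by (metis C'(3) matrix_mul_assoc matrix_mul_rid matrix_vector_mul_assoc)
    then have "norm (D *v q' y - (D ** C') *v q y) \<le> op_bound * norm (C *v q' y - q y)"
      using norm_action_diff_le[OF mem, of "C *v q' y" "q y"] by simp
    also have "\<dots> < op_bound * \<delta>" using C(2) ob by (simp add: norm_minus_commute)
    finally have "norm (D *v q' y - (D ** C') *v q y) < op_bound * \<delta>" .
    moreover have "norm (q y - (D ** C') *v q y) \<le> norm (q y - D *v q' y) + norm (D *v q' y - (D ** C') *v q y)"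
      using norm_triangle_ineq[of "q y - D *v q' y" "D *v q' y - (D ** C') *v q y"] by simp
    ultimately have "norm (q y - (D ** C') *v q y) < (1 + op_bound) * \<delta>"
      using D(2) by (simp add: distrib_right)
    then have "D ** C' = mat 1" using trivial[OF mem y] bound1 by simp
    then show ?thesis using C' by (metis matrix_mul_assoc matrix_mul_lid matrix_mul_rid)
  qed
  define g where "g y = (SOME C. C \<in> G \<and> norm (q y - C *v q' y) < \<delta>)" for y
  have g: "g y \<in> G" "norm (q y - g y *v q' y) < \<delta>" if "y \<in> ?I" for y
    using someI_ex[of "\<lambda>C. C \<in> G \<and> norm (q y - C *v q' y) < \<delta>"] close[OF that] unfolding g_def by blast+
  have "g 0 = g 1"
  proof (rule connected_local_const[where A = ?I])
    show "\<forall>a\<in>?I. eventually (\<lambda>b. g a = g b) (at a within ?I)"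
    proof
      fix a assume a: "a \<in> ?I"
      have "continuous_on ?I (\<lambda>y. norm (q y - g a *v q' y))" by (intro continuous_intros q q')
      then have "((\<lambda>y. norm (q y - g a *v q' y)) \<longlongrightarrow> norm (q a - g a *v q' a)) (at a within ?I)"
        using a by (simp add: continuous_on_def)
      then have "eventually (\<lambda>y. norm (q y - g a *v q' y) < \<delta>) (at a within ?I)"
        by (rule order_tendstoD(2)) (rule g(2)[OF a])
      moreover have "eventually (\<lambda>y. y \<in> ?I) (at a within ?I)" by (simp add: eventually_at_filter)
      ultimately show "eventually (\<lambda>b. g a = g b) (at a within ?I)"
        by eventually_elim (use unique g a in blast)
    qed
  qed auto
  define C where "C = g 0"
  have C: "C \<in> G" "norm (q 0 - C *v q' 0) < \<delta>" "norm (q 1 - C *v q' 1) < \<delta>"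
    using g[of 0] g[of 1] \<open>g 0 = g 1\<close> by (auto simp: C_def)
  obtain A' where A': "A' \<in> G" "A ** A' = mat 1" "A' ** A = mat 1" using inverse_mem[OF A] by metis
  obtain C' where C': "C' \<in> G" "C ** C' = mat 1" "C' ** C = mat 1" using inverse_mem[OF C(1)] by metis
  \<comment> \<open>This is the monodromy of the translate of \<open>q'\<close> by \<open>C\<close>.
    It is compared with \<open>A\<close> through the displacement of \<open>q 0\<close> under the
    inverse of \<open>A\<close> times \<open>D\<close>.\<close>
  define D where "D = C ** B ** C'"
  have D: "D \<in> G" unfolding D_def by (intro mult_mem C B C')
  have DC: "D ** C = C ** B" unfolding D_def by (metis C'(3) matrix_mul_assoc matrix_mul_rid)
  have "norm (D *v (C *v q' 0) - D *v q 0) \<le> op_bound * norm (C *v q' 0 - q 0)"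
    by (rule norm_action_diff_le[OF D])
  also have "\<dots> < op_bound * \<delta>" using C(2) ob by (simp add: norm_minus_commute)
  finally have n1: "norm (D *v (C *v q' 0) - D *v q 0) < op_bound * \<delta>" .
  have "D *v (C *v q' 0) = C *v q' 1" by (simp add: q' matrix_vector_mul_assoc DC)
  then have n2: "norm (A *v q 0 - D *v (C *v q' 0)) < \<delta>" using C(3) q(2) by simp
  have "norm (A *v q 0 - D *v q 0) \<le> norm (A *v q 0 - D *v (C *v q' 0)) + norm (D *v (C *v q' 0) - D *v q 0)"
    using norm_triangle_ineq[of "A *v q 0 - D *v (C *v q' 0)" "D *v (C *v q' 0) - D *v q 0"] by simp
  then have n3: "norm (A *v q 0 - D *v q 0) < (1 + op_bound) * \<delta>" using n1 n2 by (simp add: distrib_right)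
  have mem: "A' ** D \<in> G" using mult_mem A' D by blast
  have "norm (q 0 - (A' ** D) *v q 0) = norm (A' *v (A *v q 0) - A' *v (D *v q 0))"
    by (simp add: matrix_vector_mul_assoc A')
  also have "\<dots> \<le> op_bound * norm (A *v q 0 - D *v q 0)" by (rule norm_action_diff_le[OF A'(1)])
  also have "\<dots> < op_bound * ((1 + op_bound) * \<delta>)" using n3 ob by simp
  finally have "A' ** D = mat 1" using trivial[OF mem, of 0] by (simp add: mult.assoc)
  then have "D = A" using A' by (metis matrix_mul_assoc matrix_mul_lid matrix_mul_rid)
  then have "C ** B = A ** C" using DC by simp
  then have "conjugate B A" using C(1) by (auto simp: conjugate_def)
  then show ?thesis by (rule conjugate_sym)
qed

lemma equiv_lift_circle:
  assumes \<Phi>: "equiv_lift c A \<Phi>"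
  shows "continuous_on {0..1} (\<lambda>t. \<Phi> (\<i> * of_real (2 * pi * t)))"
    "\<Phi> (\<i> * of_real (2 * pi * 1)) = A *v \<Phi> (\<i> * of_real (2 * pi * 0))"
    "\<Phi> (\<i> * of_real (2 * pi * t)) \<noteq> 0"
proof -
  have c: "c > 0" using equiv_liftD(1)[OF \<Phi>] .
  show "continuous_on {0..1} (\<lambda>t. \<Phi> (\<i> * of_real (2 * pi * t)))"
    by (rule continuous_on_compose2[OF equiv_lift_continuous[OF \<Phi>]]) (use c in \<open>auto intro!: continuous_intros\<close>)
  show "\<Phi> (\<i> * of_real (2 * pi * 1)) = A *v \<Phi> (\<i> * of_real (2 * pi * 0))"
    using equiv_liftD(4)[OF \<Phi>, of 0] c by (simp add: mult.commute)
  show "\<Phi> (\<i> * of_real (2 * pi * t)) \<noteq> 0" using equiv_liftD(3)[OF \<Phi>] c by simp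
qed

lemma arc_of_circle:
  assumes "A \<in> G" "equiv_lift c A \<Phi>"
  shows "arc_of \<Phi> (cis (2 * pi * t)) = orbit G (\<Phi> (\<i> * of_real (2 * pi * t)))"
  using arc_of_exp[OF assms, of "\<i> * of_real (2 * pi * t)"] by (simp add: cis_conv_exp)

lemma openin_stratum:
  assumes m: "mtopology_of m = top_of X" and A: "A \<in> G"
  shows "openin (Sh m) (stratum A)"
proof -
  let ?F = "cfunspace (top_of_set (cball (0::complex) 1)) m"
  interpret F: Metric_space "mspace ?F" "mdist ?F" by (rule Metric_space_mspace_mdist)
  have "\<exists>V. openin (Sh m) V \<and> \<phi> \<in> V \<and> V \<subseteq> stratum A" if \<phi>: "\<phi> \<in> stratum A" for \<phi>
  proof -
    obtain c \<Phi> where \<Phi>: "equiv_lift c A \<Phi>" "\<phi> = arc_of \<Phi>" using \<phi> by (auto simp: stratum_def)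
    have \<phi>_short: "\<phi> \<in> short_arcs X (orbit G 0)" using short_arcs_eq_strata A \<phi> by blast
    define q where "q t = \<Phi> (\<i> * of_real (2 * pi * t))" for t
    have q: "continuous_on {0..1} q" "q 1 = A *v q 0" "q t \<noteq> 0" for t
      unfolding q_def[abs_def] using equiv_lift_circle[OF \<Phi>(1)] by auto
    obtain d where d: "d > 0" "\<forall>B\<in>G. \<forall>y\<in>{0..1}. B \<noteq> mat 1 \<longrightarrow> d \<le> norm (q y - B *v q y)"
      using uniform_separation[OF q(1,3) compact_Icc] by blast
    define K where "K = op_bound * (1 + op_bound)"
    have K: "K > 0" using op_bound_ge_1 by (simp add: K_def)
    \<comment> \<open>The quotient \<open>d / K\<close> meets the separation required by
      \<open>close_lifts_conjugate\<close>, and the bound 1 stays below the truncation in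
      \<open>bdist\<close>.\<close>
    define \<delta> where "\<delta> = min 1 (d / K)"
    have \<delta>: "\<delta> > 0" "\<delta> \<le> 1" using d(1) K by (auto simp: \<delta>_def)
    have "K * \<delta> \<le> K * (d / K)" using K by (intro mult_left_mono) (auto simp: \<delta>_def)
    then have K\<delta>: "K * \<delta> \<le> d" using K by simp
    define \<gamma> where "\<gamma> t = \<phi> (cis (2 * pi * t))" for t
    have \<gamma>: "\<gamma> t = orbit G (q t)" for t using arc_of_circle[OF A \<Phi>(1)] by (simp add: \<gamma>_def q_def \<Phi>(2))
    have \<gamma>_cont: "continuous_map (top_of_set {0..1}) (mtopology_of m) \<gamma>"
      unfolding m using continuous_map_orbit_comp[OF q(1)] by (simp add: \<gamma>[abs_def])
    obtain \<eta> where \<eta>: "\<eta> > 0"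
      "\<forall>y\<in>{0..1}. \<forall>x\<in>mspace m. mdist m (\<gamma> y) x < \<eta> \<longrightarrow> dist (bdist (\<gamma> y)) (bdist x) < \<delta>"
      using uniform_continuity_along_compact[OF continuous_map_bdist[folded m] \<gamma>_cont compact_Icc \<delta>(1)] by blast
    define V where "V = short_arcs X (orbit G 0) \<inter> F.mball \<phi> \<eta>"
    have "openin (Sh m) V"
      unfolding V_def ShArc_def mtopology_of_def by (rule openin_subtopology_Int2[OF F.openin_mball])
    moreover have "\<phi> \<in> V"
      unfolding V_def using \<phi>_short short_arc_in_cfunspace[OF m \<phi>_short] \<eta>(1) F.centre_in_mball_iff by blast
    moreover have "V \<subseteq> stratum A"
    proof
      fix \<phi>' assume \<phi>': "\<phi>' \<in> V"
      then have \<phi>'_short: "\<phi>' \<in> short_arcs X (orbit G 0)" by (simp add: V_def)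
      obtain B where B: "B \<in> G" "\<phi>' \<in> stratum B" using \<phi>'_short short_arcs_eq_strata by blast
      then obtain c' \<Psi> where \<Psi>: "equiv_lift c' B \<Psi>" "\<phi>' = arc_of \<Psi>" by (auto simp: stratum_def)
      define q' where "q' t = \<Psi> (\<i> * of_real (2 * pi * t))" for t
      have q': "continuous_on {0..1} q'" "q' 1 = B *v q' 0"
        unfolding q'_def[abs_def] using equiv_lift_circle[OF \<Psi>(1)] by auto
      have "conjugate A B"
      proof (rule close_lifts_conjugate[OF A B(1) q(1,2) q'])
        show "op_bound * (1 + op_bound) * \<delta> \<le> norm (q y - C *v q y)" if "C \<in> G" "y \<in> {0..1}" "C \<noteq> mat 1" for C y
          using K\<delta> d(2) that unfolding K_def by (meson order_trans)
        fix y :: real assume y: "y \<in> {0..1}"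
        have \<gamma>': "\<phi>' (cis (2 * pi * y)) = orbit G (q' y)"
          using arc_of_circle[OF B(1) \<Psi>(1)] by (simp add: q'_def \<Psi>(2))
        have "mdist ?F \<phi> \<phi>' < \<eta>" using \<phi>' F.in_mball[of \<phi>' \<phi> \<eta>] unfolding V_def by blast
        then have "mdist m (\<phi> (cis (2 * pi * y))) (\<phi>' (cis (2 * pi * y))) < \<eta>"
          by (intro cfunspace_mdist_lt[OF _ short_arc_in_cfunspace[OF m \<phi>_short] short_arc_in_cfunspace[OF m \<phi>'_short]]) auto
        then have "mdist m (\<gamma> y) (orbit G (q' y)) < \<eta>" unfolding \<gamma>_def \<gamma>' .
        moreover have "orbit G (q' y) \<in> mspace m"
          using arg_cong[OF m, of topspace] by (simp add: topspace_quotient_cspace)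
        ultimately have "dist (bdist (\<gamma> y)) (bdist (orbit G (q' y))) < \<delta>" using \<eta>(2) y by blast
        then have "dist (bdist (orbit G (q y))) (bdist (orbit G (q' y))) < \<delta>" unfolding \<gamma> .
        from dist_bdist_orbit_less[OF this \<delta>(2)]
        show "\<exists>C\<in>G. norm (q y - C *v q' y) < \<delta>" by metis
      qed
      then show "\<phi>' \<in> stratum A" using stratum_eq[OF A B(1)] B(2) by blast
    qed
    ultimately show ?thesis by blast
  qed
  then show ?thesis using openin_subopen by blast
qed

lemma connected_components_Sh:
  assumes m: "mtopology_of m = top_of X"
  shows "connected_components_of (Sh m) = stratum ` G"
proof (rule connected_components_of_clopen_partition)
  show "topspace (Sh m) = \<Union>(stratum ` G)" using topspace_Sh[OF m] short_arcs_eq_strata by simp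
  show "connectedin (Sh m) S" if "S \<in> stratum ` G" for S using stratum_connected[OF m] that by blast
  show "openin (Sh m) S" if "S \<in> stratum ` G" for S using openin_stratum[OF m] that by blast
  show "{} \<notin> stratum ` G" using stratum_nonempty by force
  show "pairwise disjnt (stratum ` G)"
  proof (rule pairwiseI)
    fix S S' assume "S \<in> stratum ` G" "S' \<in> stratum ` G" "S \<noteq> S'"
    then obtain A B where AB: "A \<in> G" "B \<in> G" "S = stratum A" "S' = stratum B" by blast
    show "disjnt S S'"
    proof (rule ccontr)
      assume "\<not> disjnt S S'"
      then obtain \<phi> where "\<phi> \<in> stratum A" "\<phi> \<in> stratum B" using AB by (auto simp: disjnt_iff)
      then have "S = S'" using strata_meet_imp_conjugate stratum_eq AB by metis
      then show False using \<open>S \<noteq> S'\<close> by simp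
    qed
  qed
qed

end

section \<open>The winding number as a bijection\<close>

context link_setup
begin

lemma winding_class_stratum:
  assumes A: "A \<in> G" and \<phi>: "\<phi> \<in> stratum A"
  shows "winding_class X (orbit G 0) (link G \<epsilon>) b \<phi> = {a \<in> carrier P. conjugate A (monodromy G z0 a)}"
proof -
  obtain c \<Phi> where \<Phi>: "equiv_lift c A \<Phi>" "\<phi> = arc_of \<Phi>" using \<phi> by (auto simp: stratum_def)
  show ?thesis
    by (rule winding_class_eq[of "\<lambda>t. \<Phi> (\<i> * of_real (2 * pi * t))"])
       (use equiv_lift_circle[OF \<Phi>(1)] arc_of_circle[OF A \<Phi>(1)] A in \<open>auto simp: path_def \<Phi>(2)\<close>)
qed

lemma winding_bijection:
  assumes m: "mtopology_of m = top_of X"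
  shows "\<exists>w. bij_betw w (connected_components_of (Sh m)) (conj_classes P) \<and>
    (\<forall>C\<in>connected_components_of (Sh m). \<forall>\<phi>\<in>C. w C = winding_class X (orbit G 0) (link G \<epsilon>) b \<phi>)"
proof -
  let ?W = "\<lambda>A. {a \<in> carrier P. conjugate A (monodromy G z0 a)}"
  \<comment> \<open>Any representative will do, because the winding class is constant on each
    stratum.\<close>
  define w where "w C = winding_class X (orbit G 0) (link G \<epsilon>) b (SOME \<phi>. \<phi> \<in> C)" for C
  have wS: "w (stratum A) = ?W A" if A: "A \<in> G" for A
  proof -
    have "(SOME \<phi>. \<phi> \<in> stratum A) \<in> stratum A"
      using stratum_nonempty[OF A] by (simp add: some_in_eq)
    then show ?thesis unfolding w_def by (rule winding_class_stratum[OF A])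
  qed
  have inj: "stratum A = stratum B" if AB: "A \<in> G" "B \<in> G" and eq: "?W A = ?W B" for A B
  proof -
    have "monodromy G z0 ` carrier P = G" using monodromy_iso by (simp add: iso_def bij_betw_def)
    then have "B \<in> monodromy G z0 ` carrier P" using AB(2) by simp
    then obtain a where a: "B = monodromy G z0 a" "a \<in> carrier P" by (rule imageE)
    then have "a \<in> ?W B" using conjugate_refl by simp
    then have "a \<in> ?W A" by (simp only: eq)
    then have "conjugate A B" using a(1) by simp
    then show ?thesis by (rule stratum_eq[OF AB])
  qed
  have "bij_betw w (stratum ` G) (conj_classes P)"
    unfolding bij_betw_def
  proof
    show "inj_on w (stratum ` G)"
    proof (rule inj_onI)
      fix S S' assume S: "S \<in> stratum ` G" "S' \<in> stratum ` G" "w S = w S'"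
      obtain A where A: "S = stratum A" "A \<in> G" using S(1) by (rule imageE)
      obtain B where B: "S' = stratum B" "B \<in> G" using S(2) by (rule imageE)
      have "?W A = ?W B" using S(3) unfolding A(1) B(1) wS[OF A(2)] wS[OF B(2)] .
      then show "S = S'" unfolding A(1) B(1) by (rule inj[OF A(2) B(2)])
    qed
    show "w ` stratum ` G = conj_classes P"
      unfolding conj_classes_P image_image by (intro image_cong refl wS)
  qed
  moreover have "w C = winding_class X (orbit G 0) (link G \<epsilon>) b \<phi>" if C: "C \<in> stratum ` G" "\<phi> \<in> C" for C \<phi>
  proof -
    obtain A where A: "C = stratum A" "A \<in> G" using C(1) by (rule imageE)
    show ?thesis using winding_class_stratum[OF A(2)] wS[OF A(2)] C(2) unfolding A(1) by simp
  qed
  ultimately show ?thesis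
    unfolding connected_components_Sh[OF m] by (intro exI[of _ w] conjI ballI)
qed

end

theorem theorem8:
  fixes G :: "(complex^'n^'n) set"
    and m :: "(complex^'n) set metric"
    and \<epsilon> :: real
    and z0 :: "complex^'n"
  defines "X \<equiv> quotient_cspace G"
    and "o0 \<equiv> orbit G 0"
    and "GG \<equiv> (GL :: (complex^'n^'n) monoid)\<lparr>carrier := G\<rparr>"
    and "P \<equiv> fundamental_group (subtopology (top_of (quotient_cspace G)) (link G \<epsilon>)) (orbit G z0)"
  assumes "subgroup G GL" and "finite G"
    and "\<forall>A\<in>G. \<not> pseudo_reflection A"
    and "isolated_singularity TYPE('n) X o0"
    and "mtopology_of m = top_of X"
    and "\<epsilon> > 0" and "z0 \<in> link_cover G \<epsilon>"
  shows "(\<exists>w. bij_betw w (connected_components_of (ShArc X o0 m)) (conj_classes P) \<and>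
              (\<forall>C \<in> connected_components_of (ShArc X o0 m). \<forall>\<phi>\<in>C.
                 w C = winding_class X o0 (link G \<epsilon>) (orbit G z0) \<phi>)) \<and>
         monodromy G z0 \<in> iso P GG \<and>
         bij_betw (image (monodromy G z0)) (conj_classes P) (conj_classes GG)"
proof -
  interpret finite_linear_group G by (rule finite_linear_group.intro) fact+
  have npr: "\<not> pseudo_reflection A" if "A \<in> G" for A
    using \<open>\<forall>A\<in>G. \<not> pseudo_reflection A\<close> that by blast
  have iso: "isolated_singularity TYPE('n) (quotient_cspace G) (orbit G 0)"
    using \<open>isolated_singularity TYPE('n) X o0\<close> unfolding X_def o0_def .
  interpret free_linear_group G by (rule isolated_singularity_imp_free(1)[OF npr iso])
  have dim: "2 \<le> CARD('n)" by (rule isolated_singularity_imp_free(2)[OF npr iso])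
  interpret link_setup G \<epsilon> z0 by unfold_locales (fact dim, fact+)
  have m: "mtopology_of m = top_of (quotient_cspace G)"
    using \<open>mtopology_of m = top_of X\<close> unfolding X_def .
  show ?thesis
    unfolding X_def o0_def GG_def P_def
    using winding_bijection[OF m] monodromy_iso conj_classes_iso[OF group_P group_G monodromy_iso]
    by blast
qed

end
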